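(* Let $H$ be a hieroglyph with a finite number $n$ of loops. There exists an algorithm deciding whether $H$ is realizable on the torus whose complexity is $\mathcal{O}(n)$.
   Context: A hieroglyph is a graph with one vertex and $n$ loops together with an oriented cyclic order of the loop ends at the vertex; it is given as input as a word $x_1,\dots,x_{2n}$ in which each of $n$ symbols occurs exactly twice (considered up to cyclic permutation and renaming of symbols). It is realizable on the torus if its loops can be drawn on the torus without intersections (except at the vertex) so that, going around the vertex, the outgoing segments are met in the prescribed cyclic order. *)

theory Defs
  imports "HOL-Analysis.Analysis" "HOL-Library.Landau_Symbols"
begin

section \<open>Hieroglyphs\<close>

text \<open>A hieroglyph is given by the word of its loop ends, read around the vertex. Words that
  differ by a cyclic shift or an injective renaming of symbols give the same hieroglyph; see
  \<open>hieroglyph_rotate\<close>, \<open>hieroglyph_map\<close>, \<open>realizable_on_torus_rotate\<close> and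
  \<open>realizable_on_torus_map\<close> below.\<close>

definition hieroglyph :: "'a list \<Rightarrow> bool" where
  "hieroglyph w \<longleftrightarrow> (\<forall>x\<in>set w. count_list w x = 2)"

definition num_loops :: "'a list \<Rightarrow> nat" where
  "num_loops w = card (set w)"


section \<open>Realizability on the torus\<close>

definition torus :: "(complex \<times> complex) set" where
  "torus = sphere 0 1 \<times> sphere 0 1"

text \<open>Angular coordinates centred at \<open>v\<close>, the plane being identified with the complex numbers.
  This is a covering of the torus by the plane, injective on every disc \<open>cball 0 r\<close>
  with \<open>r < pi\<close>.\<close>

definition torus_chart :: "complex \<times> complex \<Rightarrow> complex \<Rightarrow> complex \<times> complex" where
  "torus_chart v z = (fst v * cis (Re z), snd v * cis (Im z))"

definition torus_drawing ::
    "complex \<times> complex \<Rightarrow> ('a \<Rightarrow> real \<Rightarrow> complex \<times> complex) \<Rightarrow> 'a set \<Rightarrow> bool" where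
  "torus_drawing v \<gamma> X \<longleftrightarrow>
     v \<in> torus \<and>
     (\<forall>x\<in>X. simple_path (\<gamma> x) \<and> path_image (\<gamma> x) \<subseteq> torus \<and>
             pathstart (\<gamma> x) = v \<and> pathfinish (\<gamma> x) = v) \<and>
     (\<forall>x\<in>X. \<forall>y\<in>X. x \<noteq> y \<longrightarrow> path_image (\<gamma> x) \<inter> path_image (\<gamma> y) = {v})"

text \<open>The loop \<open>c\<close> crosses the circle of radius \<open>r\<close> around \<open>v\<close> exactly twice: it leaves the disc at
  angle \<open>\<alpha>\<close> and comes back at angle \<open>\<beta>\<close>. No regularity of \<open>c\<close> beyond this is imposed.\<close>

definition leaves_and_returns ::
    "complex \<times> complex \<Rightarrow> real \<Rightarrow> (real \<Rightarrow> complex \<times> complex) \<Rightarrow> real \<Rightarrow> real \<Rightarrow> bool" where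
  "leaves_and_returns v r c \<alpha> \<beta> \<longleftrightarrow>
     (\<exists>s s'. 0 < s \<and> s < s' \<and> s' < 1 \<and>
        (\<forall>t\<in>{0..1}.
           (c t \<in> torus_chart v ` ball 0 r \<longleftrightarrow> t < s \<or> s' < t) \<and>
           (c t \<in> torus_chart v ` sphere 0 r \<longleftrightarrow> t = s \<or> t = s')) \<and>
        c s = torus_chart v (rcis r \<alpha>) \<and> c s' = torus_chart v (rcis r \<beta>))"

text \<open>Here \<open>\<theta> k\<close> is the angle at which the loop end at position \<open>k\<close> of the word crosses the circle;
  \<open>p\<close> and \<open>q\<close> are the two positions of \<open>x\<close>. The inequalities on \<open>\<theta>\<close> say that one counterclockwise
  turn meets the ends in the order of the word.\<close>

definition met_in_cyclic_order ::
    "complex \<times> complex \<Rightarrow> ('a \<Rightarrow> real \<Rightarrow> complex \<times> complex) \<Rightarrow> 'a list \<Rightarrow> bool" where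
  "met_in_cyclic_order v \<gamma> w \<longleftrightarrow>
     (\<exists>r \<theta>. 0 < r \<and> r < pi \<and>
        (\<forall>i j. i < j \<and> j < length w \<longrightarrow> \<theta> i < \<theta> j \<and> \<theta> j < \<theta> i + 2 * pi) \<and>
        (\<forall>x\<in>set w. \<exists>p q. p < length w \<and> q < length w \<and> p \<noteq> q \<and> w ! p = x \<and> w ! q = x \<and>
            leaves_and_returns v r (\<gamma> x) (\<theta> p) (\<theta> q)))"

definition realizable_on_torus :: "'a list \<Rightarrow> bool" where
  "realizable_on_torus w \<longleftrightarrow>
     (\<exists>v \<gamma>. torus_drawing v \<gamma> (set w) \<and> met_in_cyclic_order v \<gamma> w)"


subsection \<open>Invariance under renaming and cyclic shifts\<close>

lemma hieroglyph_rotate: "hieroglyph (rotate k w) \<longleftrightarrow> hieroglyph w"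
proof -
  have "count_list (rotate1 u) x = count_list u x" for u and x :: 'a
    by (cases u) auto
  then have "count_list (rotate k w) x = count_list w x" for x
    by (induction k) auto
  then show ?thesis by (simp add: hieroglyph_def)
qed

lemma hieroglyph_map:
  assumes "inj_on f (set w)"
  shows "hieroglyph (map f w) \<longleftrightarrow> hieroglyph w"
  using assms by (simp add: hieroglyph_def count_list_inj_map)

lemma realizable_on_torus_map_imp:
  assumes f: "inj_on f (set w)" and "realizable_on_torus (map f w)"
  shows "realizable_on_torus w"
proof -
  from assms obtain v \<gamma> where d: "torus_drawing v \<gamma> (f ` set w)"
    and m: "met_in_cyclic_order v \<gamma> (map f w)"
    by (auto simp: realizable_on_torus_def)
  have "torus_drawing v (\<gamma> \<circ> f) (set w)"
    using d f unfolding torus_drawing_def by (simp add: inj_on_eq_iff)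
  moreover have "w ! p = x" if "x \<in> set w" "p < length w" "map f w ! p = f x" for p x
    using that f by (simp add: inj_on_eq_iff)
  then have "map f w ! p = f x \<longleftrightarrow> w ! p = x" if "x \<in> set w" "p < length w" for p x
    using that by auto
  then have "met_in_cyclic_order v (\<gamma> \<circ> f) w"
    using m unfolding met_in_cyclic_order_def length_map set_map ball_simps o_def
    by (simp cong: conj_cong)
  ultimately show ?thesis unfolding realizable_on_torus_def by blast
qed

lemma realizable_on_torus_map:
  assumes f: "inj_on f (set w)"
  shows "realizable_on_torus (map f w) \<longleftrightarrow> realizable_on_torus w"
proof
  assume w: "realizable_on_torus w"
  let ?g = "inv_into (set w) f"
  have "map ?g (map f w) = w" using f by (simp add: map_idI)
  moreover have "inj_on ?g (set (map f w))" by (simp add: inj_on_inv_into)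
  ultimately show "realizable_on_torus (map f w)"
    using realizable_on_torus_map_imp[of ?g "map f w"] w by simp
qed (use realizable_on_torus_map_imp[OF f] in blast)

lemma realizable_on_torus_rotate1:
  assumes "realizable_on_torus w"
  shows "realizable_on_torus (rotate1 w)"
proof (cases w)
  case Nil
  then show ?thesis using assms by simp
next
  case (Cons a u)
  let ?n = "length u"
  from assms obtain v \<gamma> r and \<theta> :: "nat \<Rightarrow> real"
    where d: "torus_drawing v \<gamma> (set w)" and r: "0 < r" "r < pi"
    and ord: "\<forall>i j. i < j \<and> j < length w \<longrightarrow> \<theta> i < \<theta> j \<and> \<theta> j < \<theta> i + 2 * pi"
    and loops: "\<forall>x\<in>set w. \<exists>p q. p < length w \<and> q < length w \<and> p \<noteq> q \<and> w ! p = x \<and> w ! q = x \<and>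
            leaves_and_returns v r (\<gamma> x) (\<theta> p) (\<theta> q)"
    unfolding realizable_on_torus_def met_in_cyclic_order_def by blast
  define \<theta>' where "\<theta>' i = (if i = ?n then \<theta> 0 + 2 * pi else \<theta> (Suc i))" for i
  define \<pi> where "\<pi> p = (if p = 0 then ?n else p - 1)" for p :: nat
  have ord': "\<theta>' i < \<theta>' j \<and> \<theta>' j < \<theta>' i + 2 * pi"
    if "i < j" "j < length (rotate1 w)" for i j
    using that ord[rule_format, of "Suc i" "Suc j"] ord[rule_format, of 0 "Suc i"]
    by (auto simp: \<theta>'_def Cons)
  have \<pi>: "\<pi> p < length (rotate1 w)" "rotate1 w ! \<pi> p = w ! p"
      "rcis r (\<theta>' (\<pi> p)) = rcis r (\<theta> p)" if "p < length w" for p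
    using that by (auto simp: \<pi>_def \<theta>'_def Cons nth_append rcis_def complex_eq_iff nth_Cons')
  have \<pi>_inj: "\<pi> p \<noteq> \<pi> q" if "p \<noteq> q" "p < length w" "q < length w" for p q
    using that by (auto simp: \<pi>_def Cons)
  have "\<exists>p q. p < length (rotate1 w) \<and> q < length (rotate1 w) \<and> p \<noteq> q \<and>
          rotate1 w ! p = x \<and> rotate1 w ! q = x \<and> leaves_and_returns v r (\<gamma> x) (\<theta>' p) (\<theta>' q)"
    if "x \<in> set w" for x
  proof -
    from loops that obtain p q where
      1: "p < length w" "q < length w" "p \<noteq> q" "w ! p = x" "w ! q = x" and
      2: "leaves_and_returns v r (\<gamma> x) (\<theta> p) (\<theta> q)"
      by blast
    have "leaves_and_returns v r (\<gamma> x) (\<theta>' (\<pi> p)) (\<theta>' (\<pi> q))"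
      using 2 \<pi>(3)[OF 1(1)] \<pi>(3)[OF 1(2)] by (simp add: leaves_and_returns_def)
    then show ?thesis using 1 \<pi>(1,2) \<pi>_inj by metis
  qed
  then have "met_in_cyclic_order v \<gamma> (rotate1 w)"
    unfolding met_in_cyclic_order_def using r ord'
    by (intro exI[of _ r] exI[of _ \<theta>']) simp
  then show ?thesis using d unfolding realizable_on_torus_def set_rotate1 by blast
qed

lemma realizable_on_torus_rotate: "realizable_on_torus (rotate k w) \<longleftrightarrow> realizable_on_torus w"
proof -
  have rot: "realizable_on_torus (rotate m u)" if "realizable_on_torus u" for m and u :: "'a list"
    using that by (induction m) (auto intro: realizable_on_torus_rotate1)
  have "\<exists>m. rotate m (rotate k w) = w"
  proof (cases "w = []")
    case False
    then have "length w * k - k + k = length w * k" by (simp add: Suc_leI)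
    then have "rotate (length w * k - k) (rotate k w) = w"
      by (simp only: rotate_rotate) (simp add: rotate_id)
    then show ?thesis ..
  qed simp
  then show ?thesis using rot by metis
qed


section \<open>Random access machines\<close>

text \<open>A machine has registers and a random access memory, both holding natural numbers. The
  first argument of an instruction is its destination; \<open>Sub\<close> is truncated subtraction.
  \<open>Load d a\<close> and \<open>Store a b\<close> access the memory cell whose address is in register \<open>a\<close>.\<close>

datatype instr =
    Const nat nat
  | Add nat nat nat
  | Sub nat nat nat
  | Load nat nat
  | Store nat nat
  | Jump_If_Zero nat nat

text \<open>Program counter, registers, memory.\<close>

type_synonym config = "nat \<times> (nat \<Rightarrow> nat) \<times> (nat \<Rightarrow> nat)"

fun exec :: "instr \<Rightarrow> config \<Rightarrow> config" where
  "exec (Const d c) (pc, R, M) = (Suc pc, R(d := c), M)"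
| "exec (Add d a b) (pc, R, M) = (Suc pc, R(d := R a + R b), M)"
| "exec (Sub d a b) (pc, R, M) = (Suc pc, R(d := R a - R b), M)"
| "exec (Load d a) (pc, R, M) = (Suc pc, R(d := M (R a)), M)"
| "exec (Store a b) (pc, R, M) = (Suc pc, R, M(R a := R b))"
| "exec (Jump_If_Zero a l) (pc, R, M) = (if R a = 0 then l else Suc pc, R, M)"

definition halted :: "instr list \<Rightarrow> config \<Rightarrow> bool" where
  "halted P c \<longleftrightarrow> fst c \<ge> length P"

definition step :: "instr list \<Rightarrow> config \<Rightarrow> config" where
  "step P c = (if halted P c then c else exec (P ! fst c) c)"

definition initial :: "nat list \<Rightarrow> config" where
  "initial w = (0, (\<lambda>_. 0)(0 := length w), \<lambda>i. if i < length w then w ! i else 0)"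

definition run :: "instr list \<Rightarrow> nat list \<Rightarrow> nat \<Rightarrow> config" where
  "run P w t = (step P ^^ t) (initial w)"

definition answer :: "config \<Rightarrow> nat" where
  "answer c = fst (snd c) 0"

definition fits :: "nat \<Rightarrow> config \<Rightarrow> bool" where
  "fits B c \<longleftrightarrow> (\<forall>i. fst (snd c) i \<le> B \<and> snd (snd c) i \<le> B)"

text \<open>Every instruction costs one unit. So that this is an honest cost, the numbers in use may
  exceed the input length and the input entries only by a constant factor \<open>K\<close> (that is, by
  a constant number of bits), where \<open>K\<close> depends on the program alone. The time bound \<open>T\<close> is in
  terms of the size \<open>sz w\<close> of the input. Inputs outside \<open>D\<close> are unconstrained.\<close>

definition decides_in_time ::
    "instr list \<Rightarrow> (nat list \<Rightarrow> bool) \<Rightarrow> (nat list \<Rightarrow> bool) \<Rightarrow> (nat list \<Rightarrow> nat) \<Rightarrow> (nat \<Rightarrow> nat) \<Rightarrow> bool"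
  where
  "decides_in_time P D Q sz T \<longleftrightarrow>
     (\<exists>K. \<forall>w. D w \<longrightarrow>
        (\<exists>t \<le> T (sz w).
           halted P (run P w t) \<and>
           answer (run P w t) = (if Q w then 1 else 0) \<and>
           (\<forall>u\<le>t. fits (K * (1 + Max (insert (length w) (set w)))) (run P w u))))"

end

theory Submission
  imports Defs "HOL-Complex_Analysis.Complex_Analysis"
begin

text \<open>Two loops that meet only at the vertex lift to paths \<open>X\<close> and \<open>Y\<close> in the plane such that
  \<open>X t - Y s\<close> is a lattice point only for \<open>t = s = 0\<close>. Apply a quasi-periodic function that vanishes
  exactly at the lattice points and compare winding numbers: along the boundary of the unit square
  of pairs \<open>(t, s)\<close>, quasi-periodicity gives the determinant of the homology classes of the loops;
  along the rectangle of the times at which the loops cross the small circle, one reads off whether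
  their ends interlace. So interlacement is an alternating form of rank at most two modulo two.

  Conversely, cancel adjacent equal letters cyclically until there are none left. A word with such a
  form is then, up to a cyclic shift, \<open>A @ B @ C @ rev A @ rev B @ rev C\<close>, and it is drawn as three
  bands of parallel broken lines; the cancelled loops are put back as small loops near the vertex.
  Cancelling with a stack and recognizing this shape take linear time.\<close>

text \<open>The curves are merely continuous, so they have no transverse crossings to count; winding
  numbers of continuous paths take the place of intersection numbers. The combinatorics rests on one
  fact about the plane over the field with two elements: it has three nonzero vectors, two distinct
  ones have determinant one, and equal ones have determinant zero. So the letters of a reduced word
  fall into at most three classes, which become the three bands, and inside a class no two letters
  interlace. A letter of class zero cannot survive cancellation: each of the two sides between its
  ends would contain an interlacing pair, and two such mutually orthogonal pairs do not fit in a
  plane. To stay linear, the program never computes classes. One letter \<open>x\<close> fixes the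
  band \<open>A\<close>, the letters parallel to it are stripped from both sides, and the two
  remaining cores are compared in a single pass, after the first letter of one has been located in
  the other. No stored number exceeds the larger of the input length and the largest entry by more
  than one, so unit cost is honest.\<close>

definition lattice_point :: "complex \<Rightarrow> bool" where
  "lattice_point z \<longleftrightarrow> (\<exists>(m::int) (n::int). z = Complex (2 * pi * m) (2 * pi * n))"

lemma cis_eq_iff: "cis a = cis b \<longleftrightarrow> (\<exists>n::int. a - b = 2 * pi * n)"
proof -
  have "cis a = cis b \<longleftrightarrow> cis (a - b) = 1"
    by (simp add: cis_divide[symmetric])
  also have "\<dots> \<longleftrightarrow> (\<exists>n::int. a - b = 2 * pi * n)"
    using cos_one_2pi_int[of "a - b"] cos_one_sin_zero[of "a - b"]
    by (auto simp: complex_eq_iff algebra_simps)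
  finally show ?thesis .
qed

lemma torus_chart_eq_iff:
  assumes "v \<in> torus"
  shows "torus_chart v z = torus_chart v z' \<longleftrightarrow> lattice_point (z - z')"
proof -
  have "fst v \<noteq> 0" "snd v \<noteq> 0" using assms by (auto simp: torus_def)
  then show ?thesis
    by (auto simp: torus_chart_def lattice_point_def cis_eq_iff complex_eq_iff[of "z - z'"])
qed

lemma lattice_point_small:
  assumes "lattice_point z" "\<bar>Re z\<bar> < 2 * pi" "\<bar>Im z\<bar> < 2 * pi"
  shows "z = 0"
proof -
  from assms(1) obtain m n :: int where z: "z = Complex (2 * pi * m) (2 * pi * n)"
    unfolding lattice_point_def by blast
  have "\<bar>k\<bar> < 1" if "\<bar>2 * pi * real_of_int k\<bar> < 2 * pi" for k :: int
    using that by (simp add: abs_mult)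
  then have "\<bar>m\<bar> < 1" "\<bar>n\<bar> < 1" using assms(2,3) z by auto
  then show ?thesis using z by (simp add: complex_eq_iff)
qed

lemma lattice_point_norm:
  assumes "lattice_point z" "norm z < 2 * pi"
  shows "z = 0"
  using lattice_point_small[OF assms(1)] assms(2) abs_Re_le_cmod[of z] abs_Im_le_cmod[of z] by linarith

lemma lattice_point_0: "lattice_point 0"
  unfolding lattice_point_def by (rule exI[of _ 0], rule exI[of _ 0]) (simp add: complex_eq_iff)

section \<open>Lifting closed curves\<close>

text \<open>A path avoiding zero has a continuous logarithm; on the unit circle its real part
  vanishes, so its imaginary part is an angle, here normalised to start at zero.\<close>

lemma unit_circle_lift:
  fixes p :: "real \<Rightarrow> complex"
  assumes "path p" and 1: "\<And>t. t \<in> {0..1} \<Longrightarrow> norm (p t) = 1"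
  obtains \<theta> :: "real \<Rightarrow> real" where "continuous_on {0..1} \<theta>" "\<theta> 0 = 0"
    "\<forall>t\<in>{0..1}. p t = p 0 * cis (\<theta> t)"
proof -
  have "0 \<notin> path_image p" using 1 by (force simp: path_image_def)
  from winding_number_as_continuous_log[OF \<open>path p\<close> this]
  obtain q where q: "path q" "\<And>t. t \<in> {0..1} \<Longrightarrow> p t = 0 + exp (q t)"
    by blast
  have pq: "p t = cis (Im (q t))" if "t \<in> {0..1}" for t
  proof -
    have "exp (Re (q t)) = 1" using 1[OF that] q(2)[OF that] by simp
    then have "Re (q t) = 0" by simp
    then show ?thesis using q(2)[OF that] by (simp add: exp_eq_polar[of "q t"])
  qed
  show ?thesis
  proof (rule that[of "\<lambda>t. Im (q t) - Im (q 0)"])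
    show "continuous_on {0..1} (\<lambda>t. Im (q t) - Im (q 0))"
      using q(1) unfolding path_def by (intro continuous_on_diff continuous_on_Im continuous_on_const)
    show "\<forall>t\<in>{0..1}. p t = p 0 * cis (Im (q t) - Im (q 0))"
      using pq pq[of 0] by (simp add: cis_mult)
  qed simp
qed

lemma torus_path_lift:
  assumes "path c" "path_image c \<subseteq> torus"
  obtains X where "continuous_on {0..1} X" "X 0 = 0"
    "\<And>t. t \<in> {0..1} \<Longrightarrow> c t = torus_chart (c 0) (X t)"
proof -
  have "norm (fst (c t)) = 1" "norm (snd (c t)) = 1" if "t \<in> {0..1}" for t
  proof -
    have "c t \<in> torus" using assms(2) that by (auto simp: path_image_def)
    then show "norm (fst (c t)) = 1" "norm (snd (c t)) = 1" by (auto simp: torus_def)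
  qed
  note 1 = this
  have "path (\<lambda>t. fst (c t))" "path (\<lambda>t. snd (c t))"
    using assms(1) unfolding path_def by (rule continuous_on_fst continuous_on_snd)+
  note 2 = this
  obtain f :: "real \<Rightarrow> real" where f: "continuous_on {0..1} f" "f 0 = 0"
      "\<forall>t\<in>{0..1}. fst (c t) = fst (c 0) * cis (f t)"
    using unit_circle_lift[OF 2(1) 1(1)] by blast
  obtain g :: "real \<Rightarrow> real" where g: "continuous_on {0..1} g" "g 0 = 0"
      "\<forall>t\<in>{0..1}. snd (c t) = snd (c 0) * cis (g t)"
    using unit_circle_lift[OF 2(2) 1(2)] by blast
  show ?thesis
  proof (rule that[of "\<lambda>t. Complex (f t) (g t)"])
    show "continuous_on {0..1} (\<lambda>t. Complex (f t) (g t))"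
      unfolding Complex_eq by (intro continuous_on_add continuous_on_mult continuous_on_of_real continuous_on_const f(1) g(1))
    show "c t = torus_chart (c 0) (Complex (f t) (g t))" if "t \<in> {0..1}" for t
      unfolding torus_chart_def complex.sel f(3)[rule_format, OF that, symmetric] g(3)[rule_format, OF that, symmetric] by simp
  qed (simp add: f(2) g(2) complex_eq_iff)
qed

section \<open>A section with zeros at the lattice points\<close>

text \<open>An elementary substitute for a theta function: it interpolates linearly between two exponentials
  over each row of lattice cells.\<close>

definition sec_row :: "complex \<Rightarrow> int" where
  "sec_row z = \<lfloor>Im z / (2 * pi) + 1 / 2\<rfloor>"

text \<open>On the line shared by two rows the second factor is \<i> times
  \<open>cis (- Re z / 2)\<close> seen from below and minus \<i> times \<open>cis (Re z / 2)\<close>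
  seen from above. The phase in front makes the two agree, and it causes the quasi-periodicity in
  the imaginary direction.\<close>

definition sec_strip :: "int \<Rightarrow> complex \<Rightarrow> complex" where
  "sec_strip n z = cis (- n * (Re z + pi)) *
     Complex (sin (Re z / 2)) (2 * (Im z / (2 * pi) - n) * cos (Re z / 2))"

definition sec :: "complex \<Rightarrow> complex" where
  "sec z = sec_strip (sec_row z) z"

lemma sec_strip_boundary:
  assumes "Im z / (2 * pi) = n + 1 / 2"
  shows "sec_strip (n + 1) z = sec_strip n z"
proof -
  have 1: "Complex (sin u) (- cos u) = - \<i> * cis u" "Complex (sin u) (cos u) = \<i> * cis (- u)" for u
    by (auto simp: complex_eq_iff)
  have arg: "- (n + 1) * (Re z + pi) + Re z / 2 = - n * (Re z + pi) - Re z / 2 - pi"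
    by (simp add: field_simps)
  have "sec_strip (n + 1) z = cis (- (n + 1) * (Re z + pi)) * (- \<i> * cis (Re z / 2))"
    unfolding sec_strip_def assms 1[symmetric] by simp
  also have "\<dots> = - \<i> * cis (- n * (Re z + pi) - Re z / 2 - pi)"
    unfolding mult.left_commute[of _ "- \<i>"] cis_mult arg by simp
  also have "\<dots> = \<i> * cis (- n * (Re z + pi) - Re z / 2)"
    by (simp add: cis_divide[symmetric])
  also have "\<dots> = cis (- n * (Re z + pi)) * (\<i> * cis (- (Re z / 2)))"
    by (simp add: cis_mult)
  also have "\<dots> = sec_strip n z"
    unfolding sec_strip_def assms 1[symmetric] by simp
  finally show ?thesis .
qed

lemma sec_eq_strip:
  assumes "n - 1 / 2 \<le> Im z / (2 * pi)" "Im z / (2 * pi) \<le> n + 1 / 2"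
  shows "sec z = sec_strip n z"
proof (cases "Im z / (2 * pi) = n + 1 / 2")
  case True
  then have "sec_row z = n + 1" by (simp add: sec_row_def)
  then show ?thesis using sec_strip_boundary[OF True] by (simp add: sec_def)
next
  case False
  then have "sec_row z = n" unfolding sec_row_def using assms by (intro floor_unique) linarith+
  then show ?thesis by (simp add: sec_def)
qed

lemma continuous_sec_strip: "continuous_on A (sec_strip n)"
  unfolding sec_strip_def Complex_eq cis_conv_exp by (intro continuous_intros) auto

text \<open>The open sets \<open>U n\<close> cover the plane, and each contains a single line where
  two strips are glued.\<close>

lemma continuous_sec: "continuous_on A sec"
proof -
  define U where "U n = {z. 2 * pi * (real_of_int n - 1 / 2) < Im z \<and> Im z < 2 * pi * (n + 3 / 2)}" for n :: int
  have "continuous_on (\<Union>n. U n) sec"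
  proof (rule continuous_on_open_UN)
    fix n :: int
    show "open (U n)"
      unfolding U_def by (intro open_Collect_conj open_Collect_less continuous_intros)
    let ?A = "{z \<in> U n. Im z \<le> 2 * pi * (n + 1 / 2)}" and ?B = "{z \<in> U n. 2 * pi * (n + 1 / 2) \<le> Im z}"
    have cont: "continuous_on (?A \<union> ?B) (\<lambda>z. if Im z \<le> 2 * pi * (n + 1 / 2) then sec_strip n z else sec_strip (n + 1) z)"
    proof (rule continuous_on_cases_local)
      show "closedin (top_of_set (?A \<union> ?B)) ?A"
      proof -
        have "closedin (top_of_set (?A \<union> ?B)) ((?A \<union> ?B) \<inter> {z. Im z \<le> 2 * pi * (n + 1 / 2)})"
          by (intro closedin_closed_Int closed_halfspace_Im_le)
        also have "(?A \<union> ?B) \<inter> {z. Im z \<le> 2 * pi * (n + 1 / 2)} = ?A" by auto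
        finally show ?thesis .
      qed
      show "closedin (top_of_set (?A \<union> ?B)) ?B"
      proof -
        have "closedin (top_of_set (?A \<union> ?B)) ((?A \<union> ?B) \<inter> {z. 2 * pi * (n + 1 / 2) \<le> Im z})"
          by (intro closedin_closed_Int closed_halfspace_Im_ge)
        also have "(?A \<union> ?B) \<inter> {z. 2 * pi * (n + 1 / 2) \<le> Im z} = ?B" by auto
        finally show ?thesis .
      qed
      fix z assume "z \<in> ?A \<and> \<not> Im z \<le> 2 * pi * (n + 1 / 2) \<or> z \<in> ?B \<and> Im z \<le> 2 * pi * (n + 1 / 2)"
      then have "Im z / (2 * pi) = n + 1 / 2" by (auto simp: field_simps)
      then show "sec_strip n z = sec_strip (n + 1) z" using sec_strip_boundary by simp
    qed (rule continuous_sec_strip)+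
    have AB: "?A \<union> ?B = U n" by auto
    have eq: "(if Im z \<le> 2 * pi * (n + 1 / 2) then sec_strip n z else sec_strip (n + 1) z) = sec z" if "z \<in> U n" for z
      using that sec_eq_strip[of n z] sec_eq_strip[of "n + 1" z] by (auto simp: U_def field_simps)
    show "continuous_on (U n) sec"
      using cont unfolding AB by (rule continuous_on_eq) (rule eq)
  qed
  moreover have "z \<in> (\<Union>n. U n)" for z
  proof -
    have "sec_row z - 1 - 1 / 2 < Im z / (2 * pi)" "Im z / (2 * pi) < sec_row z - 1 + 3 / 2"
      using floor_correct[of "Im z / (2 * pi) + 1 / 2"] unfolding sec_row_def by linarith+
    then have "2 * pi * (sec_row z - 1 - 1 / 2) < 2 * pi * (Im z / (2 * pi))"
        "2 * pi * (Im z / (2 * pi)) < 2 * pi * (sec_row z - 1 + 3 / 2)"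
      by (intro mult_strict_left_mono; simp)+
    then have "z \<in> U (sec_row z - 1)" by (simp add: U_def)
    then show ?thesis by blast
  qed
  ultimately show ?thesis by (meson UNIV_I continuous_on_subset subsetI)
qed

text \<open>A lattice shift changes the row by \<open>b\<close> and the half-angle by
  \<open>pi * a\<close>. The resulting factor has modulus one and an argument affine in
  \<open>Re z\<close>, so its variation along a path depends only on the endpoints.\<close>

lemma sec_quasi_periodic:
  "sec (z + Complex (2 * pi * of_int a) (2 * pi * of_int b)) =
     sec z * cis (pi * (of_int a - of_int b) - of_int b * Re z)"
proof -
  let ?w = "z + Complex (2 * pi * of_int a) (2 * pi * of_int b)"
  let ?n = "sec_row z"
  have Im: "Im ?w / (2 * pi) = Im z / (2 * pi) + b" by (simp add: field_simps)
  have row: "sec_row ?w = ?n + b"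
    unfolding sec_row_def Im using floor_add_int[of "Im z / (2 * pi) + 1 / 2" b] by (simp add: algebra_simps)
  have sc: "sin (u + pi * of_int a) = cos (pi * of_int a) * sin u"
           "cos (u + pi * of_int a) = cos (pi * of_int a) * cos u" for u :: real
    using sin_add[of u "pi * of_int a"] cos_add[of u "pi * of_int a"] sin_npi_int[of a] by (auto simp: mult.commute)
  have c: "of_real (cos (pi * of_int a)) = cis (pi * of_int a)"
    using sin_npi_int[of a] by (simp add: complex_eq_iff mult.commute)
  have half: "Re ?w / 2 = Re z / 2 + pi * a" by simp
  have "Complex (sin (Re ?w / 2)) (2 * (Im ?w / (2 * pi) - (?n + b)) * cos (Re ?w / 2))
      = of_real (cos (pi * of_int a)) * Complex (sin (Re z / 2)) (2 * (Im z / (2 * pi) - ?n) * cos (Re z / 2))"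
    unfolding Im half sc by (simp add: complex_eq_iff algebra_simps)
  moreover have "cis (- (?n + b) * (Re ?w + pi)) * cis (pi * of_int a)
     = cis (- ?n * (Re z + pi)) * cis (pi * (of_int a - of_int b) - of_int b * Re z)"
    unfolding cis_mult
    \<comment> \<open>The two arguments differ by the integer row number times the shift
      \<open>2 * pi * a\<close> of the real part.\<close>
    by (subst cis_eq_iff, rule exI[of _ "- (?n + b) * a"]) (simp add: algebra_simps)
  ultimately show ?thesis
    unfolding sec_def row sec_strip_def[of "?n + b"] sec_strip_def[of ?n z] c by (simp add: mult_ac)
qed

text \<open>Near the origin both coordinates of \<open>sec z\<close> have the signs of those of
  \<open>z\<close>; this later deforms \<open>sec\<close> to the identity.\<close>

lemma sec_central:
  assumes "\<bar>Im z\<bar> \<le> pi"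
  shows "sec z = Complex (sin (Re z / 2)) (Im z / pi * cos (Re z / 2))"
proof -
  have "sec z = sec_strip 0 z" using assms by (intro sec_eq_strip) (auto simp: field_simps)
  then show ?thesis by (simp add: sec_strip_def)
qed

lemma sec_zero_imp_lattice_point:
  assumes "sec z = 0"
  shows "lattice_point z"
proof -
  let ?n = "sec_row z"
  have 1: "sin (Re z / 2) = 0" and 2: "(Im z / (2 * pi) - ?n) * cos (Re z / 2) = 0"
    using assms by (auto simp: sec_def sec_strip_def cis_neq_zero Complex_eq_0)
  from 1 have "cos (Re z / 2) \<noteq> 0" using sin_zero_abs_cos_one by fastforce
  with 2 have "Im z = 2 * pi * ?n" by (simp add: field_simps)
  moreover from 1 obtain m :: int where "Re z / 2 = m * pi" using sin_zero_iff_int2 by blast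
  then have "Re z = 2 * pi * m" by simp
  ultimately show ?thesis unfolding lattice_point_def by (metis complex_surj)
qed

section \<open>Winding numbers\<close>

lemma winding_number_exp:
  assumes "path q" "\<And>t. t \<in> {0..1} \<Longrightarrow> p t = exp (q t)"
  shows "winding_number p 0 = (q 1 - q 0) / (2 * pi * \<i>)"
proof -
  have "winding_number p 0 = winding_number (exp \<circ> q) 0"
    by (rule winding_number_cong) (use assms(2) in simp)
  then show ?thesis using winding_number_compose_exp[OF assms(1)] by (simp add: pathstart_def pathfinish_def)
qed

text \<open>The sides of a rectangle are mapped to open paths, whose winding numbers are complex:
  the real part is the angle swept, in full turns, and the imaginary part records the change of
  modulus. A unit factor with continuous argument adds its own variation to the real part.\<close>

lemma Re_winding_number_mult_cis:
  fixes g :: "real \<Rightarrow> real"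
  assumes "path p" "\<And>t. t \<in> {0..1} \<Longrightarrow> p t \<noteq> 0" "continuous_on {0..1} g"
  shows "Re (winding_number (\<lambda>t. p t * cis (g t)) 0) = Re (winding_number p 0) + (g 1 - g 0) / (2 * pi)"
proof -
  have "0 \<notin> path_image p" using assms(2) by (auto simp: path_image_def)
  from winding_number_as_continuous_log[OF assms(1) this]
  obtain q where q: "path q" "\<And>t. t \<in> {0..1} \<Longrightarrow> p t = 0 + exp (q t)" by blast
  have 1: "winding_number p 0 = (q 1 - q 0) / (2 * pi * \<i>)"
    by (rule winding_number_exp) (use q in auto)
  have "path (\<lambda>t. q t + \<i> * g t)"
    using q(1) assms(3) unfolding path_def by (intro continuous_intros)
  then have 2: "winding_number (\<lambda>t. p t * cis (g t)) 0 = ((q 1 + \<i> * g 1) - (q 0 + \<i> * g 0)) / (2 * pi * \<i>)"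
    by (rule winding_number_exp) (use q(2) in \<open>simp add: exp_add cis_conv_exp\<close>)
  have "((q 1 + \<i> * g 1) - (q 0 + \<i> * g 0)) / (2 * pi * \<i>) = (q 1 - q 0) / (2 * pi * \<i>) + of_real ((g 1 - g 0) / (2 * pi))"
    by (simp add: field_simps)
  then show ?thesis unfolding 1 2 by (metis Re_complex_of_real plus_complex.sel(1))
qed

text \<open>On an open half-plane bounded by a line through the origin, the rotated principal
  logarithm is a continuous branch, so the angle swept is the difference of the arguments measured
  in that half-plane.\<close>

lemma Re_winding_number_half_plane:
  assumes "path p" "\<And>t. t \<in> {0..1} \<Longrightarrow> 0 < Re (p t * cis (- \<phi>))"
    and p0: "p 0 = of_real \<rho>0 * cis a0" "0 < \<rho>0" "\<bar>a0 - \<phi>\<bar> < pi / 2"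
    and p1: "p 1 = of_real \<rho>1 * cis a1" "0 < \<rho>1" "\<bar>a1 - \<phi>\<bar> < pi / 2"
  shows "Re (winding_number p 0) = (a1 - a0) / (2 * pi)"
proof -
  define q where "q t = Ln (p t * cis (- \<phi>)) + \<i> * \<phi>" for t
  have ne: "p t * cis (- \<phi>) \<notin> \<real>\<^sub>\<le>\<^sub>0" if "t \<in> {0..1}" for t
    using assms(2)[OF that] by (auto simp: complex_nonpos_Reals_iff)
  have "continuous_on {0..1} (\<lambda>t. p t * cis (- \<phi>))"
    using assms(1) unfolding path_def by (intro continuous_intros)
  then have "path q"
    unfolding path_def q_def by (intro continuous_on_add continuous_on_Ln' continuous_on_const) (use ne in auto)
  moreover have "p t = exp (q t)" if "t \<in> {0..1}" for t
  proof -
    have "p t * cis (- \<phi>) \<noteq> 0" using assms(2)[OF that] by force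
    then have "exp (q t) = p t * (cis (- \<phi>) * cis \<phi>)"
      by (simp add: q_def exp_add exp_Ln cis_conv_exp del: cis_mult)
    then show ?thesis by (simp add: cis_mult)
  qed
  ultimately have wn: "winding_number p 0 = (q 1 - q 0) / (2 * pi * \<i>)" by (rule winding_number_exp)
  have Im_q: "Im (q t) = a" if "p t = of_real \<rho> * cis a" "0 < \<rho>" "\<bar>a - \<phi>\<bar> < pi / 2" for t \<rho> a
  proof -
    have "p t * cis (- \<phi>) = exp (of_real (ln \<rho>) + \<i> * (a - \<phi>))"
      using that(1,2) by (simp add: exp_add exp_of_real cis_mult cis_conv_exp[of "a - \<phi>"] mult.assoc)
    moreover have "Ln (exp (of_real (ln \<rho>) + \<i> * (a - \<phi>))) = of_real (ln \<rho>) + \<i> * (a - \<phi>)"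
      using that(3) pi_gt_zero by (intro Ln_exp; simp; linarith)
    ultimately have "Ln (p t * cis (- \<phi>)) = of_real (ln \<rho>) + \<i> * (a - \<phi>)" by simp
    then show ?thesis by (simp add: q_def)
  qed
  have "Re ((q 1 - q 0) / (2 * pi * \<i>)) = (Im (q 1) - Im (q 0)) / (2 * pi)"
    by (simp add: Re_divide power2_eq_square field_simps)
  then show ?thesis unfolding wn using Im_q[OF p0] Im_q[OF p1] by simp
qed

text \<open>An argument of the chord \<open>rcis r \<alpha> - rcis r \<beta>\<close>, whose
  direction flips with the sign of \<open>sin ((\<alpha> - \<beta>) / 2)\<close>. The
  \<open>sgn\<close> term selects the branch within \<open>pi / 2\<close> of \<alpha> when the
  angles differ by less than a full turn; it is the source of the signs in the crossing
  formula.\<close>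

definition chord_angle :: "real \<Rightarrow> real \<Rightarrow> real" where
  "chord_angle \<alpha> \<beta> = (\<alpha> + \<beta> + pi * sgn (\<alpha> - \<beta>)) / 2"

lemma chord_polar:
  assumes "\<alpha> \<noteq> \<beta>" "\<bar>\<alpha> - \<beta>\<bar> < 2 * pi" "0 < r"
  obtains \<rho> where "0 < \<rho>" "rcis r \<alpha> - rcis r \<beta> = of_real \<rho> * cis (chord_angle \<alpha> \<beta>)"
proof -
  define u m where "u = (\<alpha> - \<beta>) / 2" and "m = (\<alpha> + \<beta>) / 2"
  have \<alpha>\<beta>: "\<alpha> = m + u" "\<beta> = m - u" by (auto simp: u_def m_def field_simps)
  have "rcis r \<alpha> - rcis r \<beta> = of_real (2 * r * sin u) * cis (m + pi / 2)"
    unfolding \<alpha>\<beta> by (simp add: complex_eq_iff rcis_def cos_add sin_add cos_diff sin_diff algebra_simps)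
  moreover have "cis (m - pi / 2) = - cis (m + pi / 2)"
    by (simp add: complex_eq_iff cos_add sin_add cos_diff sin_diff)
  moreover have "sin u > 0" if "\<alpha> > \<beta>"
    using that assms(2) by (intro sin_gt_zero) (auto simp: u_def)
  moreover have "sin u < 0" if "\<alpha> < \<beta>"
    using that assms(2) sin_gt_zero[of "-u"] unfolding u_def by (simp add: field_simps)
  ultimately show ?thesis
    using assms(1,3) that[of "2 * r * \<bar>sin u\<bar>"]
    by (cases "\<alpha> < \<beta>") (auto simp: chord_angle_def m_def add_divide_distrib diff_divide_distrib zero_less_mult_iff mult_pos_neg)
qed

text \<open>The point of angle \<alpha> stays on the circle and \<open>q\<close> in the closed disc.
  The tangent line at that point meets the disc nowhere else, so the difference stays in the open
  half-plane with inner direction \<alpha>.\<close>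

lemma Re_winding_number_side:
  assumes "path q" and q: "\<And>t. t \<in> {0..1} \<Longrightarrow> norm (q t) \<le> r \<and> q t \<noteq> rcis r \<alpha>" and "0 < r"
    and ends: "q 0 = rcis r \<beta>0" "q 1 = rcis r \<beta>1"
    and small: "\<bar>\<alpha> - \<beta>0\<bar> < 2 * pi" "\<bar>\<alpha> - \<beta>1\<bar> < 2 * pi"
  shows "Re (winding_number (\<lambda>t. rcis r \<alpha> - q t) 0) = (chord_angle \<alpha> \<beta>1 - chord_angle \<alpha> \<beta>0) / (2 * pi)"
proof -
  have ne: "\<alpha> \<noteq> \<beta>0" "\<alpha> \<noteq> \<beta>1" using q[of 0] q[of 1] ends by auto
  obtain \<rho>0 where \<rho>0: "0 < \<rho>0" "rcis r \<alpha> - rcis r \<beta>0 = of_real \<rho>0 * cis (chord_angle \<alpha> \<beta>0)"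
    using chord_polar[OF ne(1) small(1) \<open>0 < r\<close>] by blast
  obtain \<rho>1 where \<rho>1: "0 < \<rho>1" "rcis r \<alpha> - rcis r \<beta>1 = of_real \<rho>1 * cis (chord_angle \<alpha> \<beta>1)"
    using chord_polar[OF ne(2) small(2) \<open>0 < r\<close>] by blast
  have ang: "\<bar>chord_angle \<alpha> \<beta> - \<alpha>\<bar> < pi / 2" if "\<alpha> \<noteq> \<beta>" "\<bar>\<alpha> - \<beta>\<bar> < 2 * pi" for \<beta>
    using that unfolding chord_angle_def by (cases "\<alpha> < \<beta>") (auto simp: abs_less_iff field_simps)
  show ?thesis
  proof (rule Re_winding_number_half_plane[where \<phi> = \<alpha>])
    show "path (\<lambda>t. rcis r \<alpha> - q t)"
      using assms(1) unfolding path_def by (intro continuous_intros)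
    fix t :: real assume t: "t \<in> {0..1}"
    \<comment> \<open>A rotation brings \<alpha> to zero, where the half-plane condition reads
      \<open>Re w < r\<close>.\<close>
    define w where "w = q t * cis (- \<alpha>)"
    have "norm w \<le> r" using q[OF t] by (simp add: w_def norm_mult)
    moreover have "w \<noteq> of_real r"
    proof
      assume "w = of_real r"
      then have "w * cis \<alpha> = rcis r \<alpha>" by (simp add: rcis_def)
      then show False using q[OF t] by (simp add: w_def mult.assoc cis_mult)
    qed
    ultimately have "Re w < r"
    proof -
      have "Re w \<le> r" using \<open>norm w \<le> r\<close> complex_Re_le_cmod[of w] by linarith
      moreover have "Re w \<noteq> r"
      proof
        assume "Re w = r"
        then have "r\<^sup>2 + (Im w)\<^sup>2 \<le> r\<^sup>2"
          using \<open>norm w \<le> r\<close> \<open>0 < r\<close> cmod_power2[of w] by (metis norm_ge_zero power_mono)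
        then have "Im w = 0" by simp
        then show False using \<open>Re w = r\<close> \<open>w \<noteq> of_real r\<close> by (simp add: complex_eq_iff)
      qed
      ultimately show ?thesis by simp
    qed
    moreover have "(rcis r \<alpha> - q t) * cis (- \<alpha>) = of_real r - w"
      by (simp add: w_def rcis_def left_diff_distrib mult.assoc cis_mult)
    ultimately show "0 < Re ((rcis r \<alpha> - q t) * cis (- \<alpha>))" by simp
  next
    show "rcis r \<alpha> - q 0 = of_real \<rho>0 * cis (chord_angle \<alpha> \<beta>0)" "rcis r \<alpha> - q 1 = of_real \<rho>1 * cis (chord_angle \<alpha> \<beta>1)"
      using \<rho>0 \<rho>1 ends by auto
  qed (use \<rho>0 \<rho>1 ang[OF ne(1) small(1)] ang[OF ne(2) small(2)] in auto)
qed

lemma winding_number_uminus_path: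
  assumes "path p" "\<And>t. t \<in> {0..1} \<Longrightarrow> p t \<noteq> 0"
  shows "Re (winding_number (\<lambda>t. - p t) 0) = Re (winding_number p 0)"
  using Re_winding_number_mult_cis[OF assms, of "\<lambda>_. pi"] by simp

text \<open>Opposite sides of a fundamental square are traversed in opposite directions and differ
  by a quasi-periodicity factor; in their sum only the variation of that factor survives.\<close>

lemma Re_winding_number_reverse_mult_cis:
  fixes g :: "real \<Rightarrow> real"
  assumes "path p" "\<And>t. t \<in> {0..1} \<Longrightarrow> p t \<noteq> 0" "continuous_on {0..1} g"
    and "\<And>t. t \<in> {0..1} \<Longrightarrow> p' t = p (1 - t) * cis (g t)"
  shows "Re (winding_number p' 0) = (g 1 - g 0) / (2 * pi) - Re (winding_number p 0)"
proof -
  have "0 \<notin> path_image p" using assms(2) by (auto simp: path_image_def)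
  then have "winding_number (reversepath p) 0 = - winding_number p 0"
    by (rule winding_number_reversepath[OF assms(1)])
  moreover have "winding_number p' 0 = winding_number (\<lambda>t. reversepath p t * cis (g t)) 0"
    by (rule winding_number_cong) (use assms(4) in \<open>simp add: reversepath_def\<close>)
  moreover have "Re (winding_number (\<lambda>t. reversepath p t * cis (g t)) 0) =
      Re (winding_number (reversepath p) 0) + (g 1 - g 0) / (2 * pi)"
  proof (rule Re_winding_number_mult_cis)
    show "path (reversepath p)" using assms(1) by simp
  qed (use assms in \<open>auto simp: reversepath_def\<close>)
  ultimately show ?thesis by simp
qed

text \<open>At equal times both rectangles are on corresponding sides. The two points then lie in a
  common open half-plane, and the segment between them misses the origin.\<close>

lemma homotopic_loops_rectpaths:
  assumes "Re a < 0" "0 < Re b" "Im a < 0" "0 < Im b" "Re a' < 0" "0 < Re b'" "Im a' < 0" "0 < Im b'"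
    and "convex S" "path_image (rectpath a b) \<subseteq> S" "path_image (rectpath a' b') \<subseteq> S"
  shows "homotopic_loops (S - {0}) (rectpath a b) (rectpath a' b')"
proof (rule homotopic_loops_linear)
  fix t :: real assume t: "t \<in> {0..1}"
  have "rectpath a b t \<in> S" "rectpath a' b' t \<in> S"
    using assms(10,11) t by (auto simp: path_image_def)
  then have "closed_segment (rectpath a b t) (rectpath a' b' t) \<subseteq> S"
    using \<open>convex S\<close> by (rule closed_segment_subset)
  moreover have "z \<noteq> 0" if "z \<in> closed_segment (rectpath a b t) (rectpath a' b' t)" for z
  proof -
    let ?w = "rectpath a b t" and ?w' = "rectpath a' b' t"
    have sides: "(Im ?w < 0 \<and> Im ?w' < 0) \<or> (0 < Re ?w \<and> 0 < Re ?w') \<or> (0 < Im ?w \<and> 0 < Im ?w') \<or> (Re ?w < 0 \<and> Re ?w' < 0)"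
      using assms(1-8) t
      by (auto simp: rectpath_def Let_def joinpaths_def linepath_def algebra_simps simp flip: distrib_right)
    from that obtain u where u: "0 \<le> u" "u \<le> 1" "z = (1 - u) *\<^sub>R ?w + u *\<^sub>R ?w'"
      by (auto simp: closed_segment_def)
    have comb: "(1 - u) * x + u * y < 0" if "x < 0" "y < 0" for x y :: real
      using that u convex_bound_lt[of x 0 y "1 - u" u] by simp
    have "Re z = (1 - u) * Re ?w + u * Re ?w'" "Im z = (1 - u) * Im ?w + u * Im ?w'"
      using u(3) by auto
    then show ?thesis using sides comb[of "Re ?w" "Re ?w'"] comb[of "Im ?w" "Im ?w'"]
      comb[of "- Re ?w" "- Re ?w'"] comb[of "- Im ?w" "- Im ?w'"] by (auto simp: algebra_simps)
  qed
  ultimately show "closed_segment (rectpath a b t) (rectpath a' b' t) \<subseteq> S - {0}" by auto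
qed auto

lemma winding_number_image_rectpath:
  assumes "continuous_on (path_image (rectpath a b)) f" "\<And>z. z \<in> path_image (rectpath a b) \<Longrightarrow> f z \<noteq> 0"
  shows "winding_number (f \<circ> rectpath a b) 0 =
    winding_number (f \<circ> linepath a (Complex (Re b) (Im a))) 0 +
    winding_number (f \<circ> linepath (Complex (Re b) (Im a)) b) 0 +
    winding_number (f \<circ> linepath b (Complex (Re a) (Im b))) 0 +
    winding_number (f \<circ> linepath (Complex (Re a) (Im b)) a) 0"
proof -
  let ?c = "Complex (Re b) (Im a)" and ?d = "Complex (Re a) (Im b)"
  have im: "path_image (rectpath a b) = closed_segment a ?c \<union> closed_segment ?c b \<union> closed_segment b ?d \<union> closed_segment ?d a"
    by (auto simp: rectpath_def Let_def path_image_join)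
  have p: "path (f \<circ> linepath x y)" "0 \<notin> path_image (f \<circ> linepath x y)"
    if "closed_segment x y \<subseteq> path_image (rectpath a b)" for x y
    using that assms(2) by (auto intro!: path_continuous_image continuous_on_subset[OF assms(1)] simp: path_image_compose)
  have s: "closed_segment a ?c \<subseteq> path_image (rectpath a b)" "closed_segment ?c b \<subseteq> path_image (rectpath a b)"
    "closed_segment b ?d \<subseteq> path_image (rectpath a b)" "closed_segment ?d a \<subseteq> path_image (rectpath a b)"
    using im by auto
  have "f \<circ> rectpath a b = (f \<circ> linepath a ?c) +++ (f \<circ> linepath ?c b) +++ (f \<circ> linepath b ?d) +++ (f \<circ> linepath ?d a)"
    by (simp add: rectpath_def Let_def path_compose_join)
  then show ?thesis
    using p[OF s(1)] p[OF s(2)] p[OF s(3)] p[OF s(4)]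
    by (simp add: winding_number_join path_image_join pathfinish_compose pathstart_compose path_join)
qed

text \<open>The lifts live on \<open>{-1..1}\<close> so that the vertex, at time zero, is an
  interior point and the only zero of \<open>sec \<circ> F\<close> in the open square
  \<open>Q\<close>. The boundary of the centred unit square can then be deformed inside
  \<open>Q - {0}\<close> to the rectangle of crossing times. The sum of signs vanishes unless
  exactly one of \<alpha> and \<beta> lies between \<alpha>' and \<beta>'.\<close>

lemma crossing_formula:
  fixes X Y :: "real \<Rightarrow> complex" and a b c d :: int
  assumes X: "continuous_on {-1..1} X" "X 0 = 0"
      "\<And>t. \<lbrakk>-1 \<le> t; t \<le> 0\<rbrakk> \<Longrightarrow> X (t + 1) = X t + Complex (2 * pi * a) (2 * pi * b)"
    and Y: "continuous_on {-1..1} Y" "Y 0 = 0"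
      "\<And>t. \<lbrakk>-1 \<le> t; t \<le> 0\<rbrakk> \<Longrightarrow> Y (t + 1) = Y t + Complex (2 * pi * c) (2 * pi * d)"
    and meet: "\<And>t s. \<lbrakk>\<bar>t\<bar> < 1; \<bar>s\<bar> < 1; lattice_point (X t - Y s)\<rbrakk> \<Longrightarrow> t = 0 \<and> s = 0"
    and r: "0 < r" "r < pi"
    and s: "-1 < s2" "s2 < 0" "0 < s1" "s1 < 1" "\<And>t. \<lbrakk>s2 \<le> t; t \<le> s1\<rbrakk> \<Longrightarrow> norm (X t) \<le> r"
      "X s1 = rcis r \<alpha>" "X s2 = rcis r \<beta>"
    and s': "-1 < s2'" "s2' < 0" "0 < s1'" "s1' < 1" "\<And>t. \<lbrakk>s2' \<le> t; t \<le> s1'\<rbrakk> \<Longrightarrow> norm (Y t) \<le> r"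
      "Y s1' = rcis r \<alpha>'" "Y s2' = rcis r \<beta>'"
    and angles: "\<bar>\<alpha> - \<alpha>'\<bar> < 2 * pi" "\<bar>\<alpha> - \<beta>'\<bar> < 2 * pi" "\<bar>\<beta> - \<alpha>'\<bar> < 2 * pi" "\<bar>\<beta> - \<beta>'\<bar> < 2 * pi"
  shows "2 * real_of_int (b * c - a * d) = sgn (\<alpha> - \<alpha>') + sgn (\<beta> - \<beta>') + sgn (\<alpha>' - \<beta>) + sgn (\<beta>' - \<alpha>)"
proof -
  define Q where "Q = {z. \<bar>Re z\<bar> < 1 \<and> \<bar>Im z\<bar> < 1}"
  define F where "F z = X (Re z) - Y (Im z)" for z
  define big where "big = rectpath (Complex (-1/2) (-1/2)) (Complex (1/2) (1/2))"
  define small where "small = rectpath (Complex s2 s2') (Complex s1 s1')"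
  have "convex Q"
  proof -
    have "Q = {z. Re z < 1} \<inter> {z. Re z > -1} \<inter> {z. Im z < 1} \<inter> {z. Im z > -1}" by (auto simp: Q_def)
    then show ?thesis
      by (simp add: convex_Int convex_halfspace_Re_lt convex_halfspace_Re_gt convex_halfspace_Im_lt convex_halfspace_Im_gt)
  qed
  have cont_F: "continuous_on Q F"
    unfolding F_def
    by (intro continuous_on_diff continuous_on_compose2[OF X(1)] continuous_on_compose2[OF Y(1)] continuous_intros)
       (auto simp: Q_def)
  have F_lattice: "\<not> lattice_point (F z)" if "z \<in> Q - {0}" for z
    using that meet[of "Re z" "Im z"] by (auto simp: Q_def F_def complex_eq_iff)
  have F_ne: "F z \<noteq> 0" if "z \<in> Q - {0}" for z
    using F_lattice[OF that] lattice_point_0 by metis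
  have im_big: "path_image big \<subseteq> Q"
  proof -
    have "path_image big \<subseteq> cbox (Complex (-1/2) (-1/2)) (Complex (1/2) (1/2))"
      unfolding big_def by (intro path_image_rectpath_subset_cbox) auto
    also have "\<dots> \<subseteq> Q" by (auto simp: Q_def in_cbox_complex_iff)
    finally show ?thesis .
  qed
  have im_small': "path_image small \<subseteq> cbox (Complex s2 s2') (Complex s1 s1')"
    unfolding small_def by (intro path_image_rectpath_subset_cbox) (use s s' in auto)
  also have "\<dots> \<subseteq> Q" using s s' by (auto simp: Q_def in_cbox_complex_iff)
  finally have im_small: "path_image small \<subseteq> Q" .
  have hom: "homotopic_loops (Q - {0}) big small"
    unfolding big_def small_def
    by (rule homotopic_loops_rectpaths) (use s s' \<open>convex Q\<close> im_big im_small in \<open>auto simp: big_def small_def\<close>)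
  have small0: "path_image small \<subseteq> Q - {0}" and big0: "path_image big \<subseteq> Q - {0}"
    using hom by (meson homotopic_loops_imp_subset)+
  have loop: "pathfinish small = pathstart small" by (simp add: small_def)
  have pF: "path (F \<circ> small)"
    by (rule path_continuous_image) (use im_small in \<open>auto simp: small_def intro: continuous_on_subset[OF cont_F]\<close>)
  have sec_F: "sec (F z) \<noteq> 0" if "z \<in> Q - {0}" for z
    using F_lattice[OF that] sec_zero_imp_lattice_point by blast
  have h1: "homotopic_loops (- {0}) ((sec \<circ> F) \<circ> big) ((sec \<circ> F) \<circ> small)"
  proof (rule homotopic_loops_continuous_image[OF hom])
    show "continuous_on (Q - {0}) (sec \<circ> F)"
      by (intro continuous_on_compose continuous_sec continuous_on_subset[OF cont_F]) auto
  qed (use sec_F in auto)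
  have bound: "norm (F (small t)) < 2 * pi" "F (small t) \<noteq> 0" if "t \<in> {0..1}" for t
  proof -
    have t: "small t \<in> path_image small" using that by (simp add: path_image_def)
    then have "small t \<in> cbox (Complex s2 s2') (Complex s1 s1')" using im_small' by blast
    then have "norm (X (Re (small t))) \<le> r" "norm (Y (Im (small t))) \<le> r"
      using s(5) s'(5) by (auto simp: in_cbox_complex_iff)
    then show "norm (F (small t)) < 2 * pi"
      using norm_triangle_ineq4[of "X (Re (small t))" "Y (Im (small t))"] r unfolding F_def by linarith
    show "F (small t) \<noteq> 0" using F_ne small0 t by blast
  qed
  \<comment> \<open>Division by four moves the values into the row of the origin, where
    \<open>sec_central\<close> applies and the signs of \<open>sin\<close> and \<open>cos\<close> of
    the half-angle are known. On the way no lattice point is met, since the disc of radius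
    \<open>2 * pi\<close> contains only the origin.\<close>
  define G where "G t = F (small t) / 4" for t
  have pG: "path G" using pF unfolding G_def path_def o_def by (intro continuous_intros) auto
  have loopG: "pathfinish G = pathstart G" using loop by (simp add: G_def pathfinish_def pathstart_def)
  have h2: "homotopic_loops (ball 0 (2 * pi) - {0}) (F \<circ> small) G"
  proof (rule homotopic_loops_linear)
    fix t :: real assume t: "t \<in> {0..1}"
    show "closed_segment ((F \<circ> small) t) (G t) \<subseteq> ball 0 (2 * pi) - {0}"
    proof
      fix z assume "z \<in> closed_segment ((F \<circ> small) t) (G t)"
      then obtain u where u: "0 \<le> u" "u \<le> 1" and z: "z = (1 - u) *\<^sub>R F (small t) + u *\<^sub>R (F (small t) / 4)"
        by (auto simp: closed_segment_def G_def)
      have z': "z = (1 - 3 * u / 4) *\<^sub>R F (small t)"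
        unfolding z by (simp add: complex_eq_iff algebra_simps)
      have "norm z \<le> norm (F (small t))" unfolding z' using u by (simp add: mult_left_le_one_le)
      then have "norm z < 2 * pi" using bound(1)[OF t] by linarith
      moreover have "z \<noteq> 0" unfolding z' using bound(2)[OF t] u by simp
      ultimately show "z \<in> ball 0 (2 * pi) - {0}" by simp
    qed
  qed (use pF pG loop loopG in \<open>auto simp: pathfinish_compose pathstart_compose\<close>)
  have h3: "homotopic_loops (- {0}) (sec \<circ> (F \<circ> small)) (sec \<circ> G)"
  proof (rule homotopic_loops_continuous_image[OF h2 continuous_sec])
    show "sec \<in> ball 0 (2 * pi) - {0} \<rightarrow> - {0}"
      using sec_zero_imp_lattice_point lattice_point_norm by (fastforce simp: dist_norm)
  qed
  \<comment> \<open>\<open>sec (G t)\<close> and \<open>F (small t)\<close> agree in the sign of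
    each coordinate, so the segment between them avoids zero.\<close>
  have h4: "homotopic_loops (- {0}) (sec \<circ> G) (F \<circ> small)"
  proof (rule homotopic_loops_linear)
    fix t :: real assume t: "t \<in> {0..1}"
    define w where "w = F (small t)"
    have w: "norm w < 2 * pi" "w \<noteq> 0" using bound[OF t] by (auto simp: w_def)
    have re: "\<bar>Re w\<bar> < 2 * pi" "\<bar>Im w\<bar> < 2 * pi"
      using w abs_Re_le_cmod[of w] abs_Im_le_cmod[of w] by linarith+
    have sG: "sec (G t) = Complex (sin (Re w / 8)) (Im w / 4 / pi * cos (Re w / 8))"
      using re sec_central[of "G t"] by (simp add: G_def w_def[symmetric])
    have sin_pos: "0 < sin (x / 8)" if "0 < x" "x < 2 * pi" for x
      using that by (intro sin_gt_zero) auto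
    have cos_pos: "0 < cos (Re w / 8)" using re by (intro cos_gt_zero_pi) auto
    show "closed_segment ((sec \<circ> G) t) ((F \<circ> small) t) \<subseteq> - {0}"
    proof
      fix z assume "z \<in> closed_segment ((sec \<circ> G) t) ((F \<circ> small) t)"
      then obtain u where u: "0 \<le> u" "u \<le> 1" and z: "z = (1 - u) *\<^sub>R sec (G t) + u *\<^sub>R w"
        by (auto simp: closed_segment_def w_def)
      have Rz: "Re z = (1 - u) * sin (Re w / 8) + u * Re w"
        and Iz: "Im z = (1 - u) * (Im w / 4 / pi * cos (Re w / 8)) + u * Im w"
        unfolding z sG by auto
      have comb: "0 < (1 - u) * x + u * y" if "0 < x" "0 < y" for x y :: real
        using that u convex_bound_lt[of "-x" 0 "-y" "1 - u" u] by simp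
      have comb': "(1 - u) * x + u * y < 0" if "x < 0" "y < 0" for x y :: real
        using that u convex_bound_lt[of x 0 y "1 - u" u] by simp
      have "Re w \<noteq> 0 \<or> Im w \<noteq> 0" using w(2) by (auto simp: complex_eq_iff)
      then consider "0 < Re w" | "Re w < 0" | "0 < Im w" | "Im w < 0" by linarith
      then show "z \<in> - {0}"
      proof cases
        case 1
        then show ?thesis using comb[OF sin_pos[of "Re w"] 1] re Rz by auto
      next
        case 2
        then show ?thesis using comb'[of "sin (Re w / 8)" "Re w"] sin_pos[of "- Re w"] re Rz by auto
      next
        case 3
        then show ?thesis using comb[of "Im w / 4 / pi * cos (Re w / 8)" "Im w"] cos_pos Iz by auto
      next
        case 4
        then have "Im w / 4 / pi * cos (Re w / 8) < 0" using cos_pos by (simp add: mult_neg_pos divide_neg_pos)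
        then show ?thesis using comb'[of "Im w / 4 / pi * cos (Re w / 8)" "Im w"] 4 Iz by auto
      qed
    qed
  next
    show "path (sec \<circ> G)" by (intro path_continuous_image pG continuous_sec)
  qed (use pF loop loopG in \<open>auto simp: pathfinish_compose pathstart_compose\<close>)
  have "winding_number ((sec \<circ> F) \<circ> big) 0 = winding_number (F \<circ> small) 0"
    using h1 h3 h4 by (metis comp_assoc winding_number_homotopic_loops)
  moreover have "Re (winding_number ((sec \<circ> F) \<circ> big) 0) = b * c - a * d"
  proof -
    let ?l = "- 1 / 2 :: real" and ?h = "1 / 2 :: real"
    let ?bot = "(sec \<circ> F) \<circ> linepath (Complex ?l ?l) (Complex ?h ?l)"
    let ?right = "(sec \<circ> F) \<circ> linepath (Complex ?h ?l) (Complex ?h ?h)"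
    let ?top = "(sec \<circ> F) \<circ> linepath (Complex ?h ?h) (Complex ?l ?h)"
    let ?left = "(sec \<circ> F) \<circ> linepath (Complex ?l ?h) (Complex ?l ?l)"
    have im: "path_image big = closed_segment (Complex ?l ?l) (Complex ?h ?l) \<union> closed_segment (Complex ?h ?l) (Complex ?h ?h)
        \<union> closed_segment (Complex ?h ?h) (Complex ?l ?h) \<union> closed_segment (Complex ?l ?h) (Complex ?l ?l)"
      by (auto simp: big_def rectpath_def Let_def path_image_join)
    have cont_sF: "continuous_on (path_image big) (sec \<circ> F)"
      by (intro continuous_on_compose continuous_sec continuous_on_subset[OF cont_F] im_big)
    have sum: "winding_number ((sec \<circ> F) \<circ> big) 0 =
        winding_number ?bot 0 + winding_number ?right 0 + winding_number ?top 0 + winding_number ?left 0"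
      using winding_number_image_rectpath[OF cont_sF[unfolded big_def]] sec_F big0 unfolding big_def by simp blast
    have seg: "path ((sec \<circ> F) \<circ> linepath x y)" "\<And>t. t \<in> {0..1} \<Longrightarrow> ((sec \<circ> F) \<circ> linepath x y) t \<noteq> 0"
      if "closed_segment x y \<subseteq> path_image big" for x y
    proof -
      show "path ((sec \<circ> F) \<circ> linepath x y)"
        using that by (intro path_continuous_image continuous_on_subset[OF cont_sF]) auto
      show "((sec \<circ> F) \<circ> linepath x y) t \<noteq> 0" if t: "t \<in> {0..1}" for t
      proof -
        have "linepath x y t \<in> closed_segment x y" using t by (simp add: linepath_in_path)
        then show ?thesis using sec_F \<open>closed_segment x y \<subseteq> path_image big\<close> big0 by (simp, blast)
      qed
    qed
    have cont_X: "continuous_on {0..1} (\<lambda>t. Re (F (Complex (?h - t) ?l)))"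
      and cont_Y: "continuous_on {0..1} (\<lambda>t. Re (F (Complex ?h (?h - t))))"
      unfolding F_def complex.sel
      by (intro continuous_intros continuous_on_compose2[OF X(1)] continuous_on_compose2[OF Y(1)]; auto)+
    \<comment> \<open>The top side is the bottom side shifted by the period of \<open>Y\<close>,
      with the sign reversed because \<open>F\<close> subtracts \<open>Y\<close>.\<close>
    have "Re (winding_number ?top 0) =
        ((pi * (of_int (-c) - of_int (-d)) - of_int (-d) * Re (F (Complex (?h - 1) ?l))) -
         (pi * (of_int (-c) - of_int (-d)) - of_int (-d) * Re (F (Complex (?h - 0) ?l)))) / (2 * pi) - Re (winding_number ?bot 0)"
    proof (rule Re_winding_number_reverse_mult_cis[OF seg])
      fix t :: real
      have "F (Complex (?h - t) ?h) = F (Complex (?h - t) ?l) + Complex (2 * pi * of_int (- c)) (2 * pi * of_int (- d))"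
        using Y(3)[of ?l] by (simp add: F_def complex_eq_iff)
      moreover have l: "linepath (Complex ?h ?h) (Complex ?l ?h) t = Complex (?h - t) ?h"
          "linepath (Complex ?l ?l) (Complex ?h ?l) (1 - t) = Complex (?h - t) ?l"
        by (auto simp: linepath_def complex_eq_iff field_simps)
      ultimately show "?top t = ?bot (1 - t) * cis (pi * (of_int (-c) - of_int (-d)) - of_int (-d) * Re (F (Complex (?h - t) ?l)))"
        by (simp only: comp_apply l sec_quasi_periodic)
    qed (use cont_X im in \<open>auto intro!: continuous_intros\<close>)
    moreover have "Re (winding_number ?left 0) =
        ((pi * (of_int (-a) - of_int (-b)) - of_int (-b) * Re (F (Complex ?h (?h - 1)))) -
         (pi * (of_int (-a) - of_int (-b)) - of_int (-b) * Re (F (Complex ?h (?h - 0))))) / (2 * pi) - Re (winding_number ?right 0)"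
    proof (rule Re_winding_number_reverse_mult_cis[OF seg])
      fix t :: real
      have "F (Complex ?l (?h - t)) = F (Complex ?h (?h - t)) + Complex (2 * pi * of_int (- a)) (2 * pi * of_int (- b))"
        using X(3)[of ?l] by (simp add: F_def complex_eq_iff)
      moreover have l: "linepath (Complex ?l ?h) (Complex ?l ?l) t = Complex ?l (?h - t)"
          "linepath (Complex ?h ?l) (Complex ?h ?h) (1 - t) = Complex ?h (?h - t)"
        by (auto simp: linepath_def complex_eq_iff field_simps)
      ultimately show "?left t = ?right (1 - t) * cis (pi * (of_int (-a) - of_int (-b)) - of_int (-b) * Re (F (Complex ?h (?h - t))))"
        by (simp only: comp_apply l sec_quasi_periodic)
    qed (use cont_Y im in \<open>auto intro!: continuous_intros\<close>)
    ultimately have "Re (winding_number ((sec \<circ> F) \<circ> big) 0) =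
       (d * (Re (X ?l) - Re (X ?h)) + b * (Re (Y ?h) - Re (Y ?l))) / (2 * pi)"
      unfolding sum by (simp add: F_def add_divide_distrib diff_divide_distrib algebra_simps)
    also have "\<dots> = b * c - a * d"
      using X(3)[of ?l] Y(3)[of ?l] by (simp add: field_simps)
    finally show ?thesis by simp
  qed
  moreover have "Re (winding_number (F \<circ> small) 0) =
      (sgn (\<alpha> - \<alpha>') + sgn (\<beta> - \<beta>') + sgn (\<alpha>' - \<beta>) + sgn (\<beta>' - \<alpha>)) / 2"
  proof -
    have im: "path_image small = closed_segment (Complex s2 s2') (Complex s1 s2') \<union> closed_segment (Complex s1 s2') (Complex s1 s1')
        \<union> closed_segment (Complex s1 s1') (Complex s2 s1') \<union> closed_segment (Complex s2 s1') (Complex s2 s2')"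
      by (auto simp: small_def rectpath_def Let_def path_image_join)
    have cont_F': "continuous_on (path_image small) F"
      by (intro continuous_on_subset[OF cont_F] im_small)
    have sum: "winding_number (F \<circ> small) 0 =
        winding_number (F \<circ> linepath (Complex s2 s2') (Complex s1 s2')) 0
        + winding_number (F \<circ> linepath (Complex s1 s2') (Complex s1 s1')) 0
        + winding_number (F \<circ> linepath (Complex s1 s1') (Complex s2 s1')) 0
        + winding_number (F \<circ> linepath (Complex s2 s1') (Complex s2 s2')) 0"
      using winding_number_image_rectpath[OF cont_F'[unfolded small_def]] F_ne small0 unfolding small_def by simp blast
    have lp: "Complex (linepath u v t) k = linepath (Complex u k) (Complex v k) t"
        "Complex k (linepath u v t) = linepath (Complex k u) (Complex k v) t" for u v t k :: real
      by (auto simp: linepath_def complex_eq_iff algebra_simps)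
    have lpc: "linepath u v t \<in> closed_segment u v" if "t \<in> {0..1}" for u v t :: real
      using that by (simp add: linepath_in_path)
    \<comment> \<open>On a vertical side \<open>X\<close> rests at a point of the circle while
      \<open>Y\<close> moves in the disc; on a horizontal side the roles are exchanged.\<close>
    have side_X: "Re (winding_number (F \<circ> linepath (Complex k u) (Complex k v)) 0) =
        (chord_angle \<xi> \<eta>1 - chord_angle \<xi> \<eta>0) / (2 * pi)"
      if k: "X k = rcis r \<xi>" "Y u = rcis r \<eta>0" "Y v = rcis r \<eta>1" "\<bar>\<xi> - \<eta>0\<bar> < 2 * pi" "\<bar>\<xi> - \<eta>1\<bar> < 2 * pi"
        and seg: "closed_segment u v \<subseteq> {s2'..s1'}" "closed_segment (Complex k u) (Complex k v) \<subseteq> path_image small"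
      for k u v \<xi> \<eta>0 \<eta>1
    proof -
      have "F \<circ> linepath (Complex k u) (Complex k v) = (\<lambda>t. rcis r \<xi> - Y (linepath u v t))"
        by (simp add: fun_eq_iff F_def lp(2)[symmetric] k)
      moreover have "Re (winding_number (\<lambda>t. rcis r \<xi> - Y (linepath u v t)) 0) = (chord_angle \<xi> \<eta>1 - chord_angle \<xi> \<eta>0) / (2 * pi)"
      proof (rule Re_winding_number_side)
        show "path (\<lambda>t. Y (linepath u v t))"
          unfolding path_def
          proof (rule continuous_on_compose2[OF Y(1) continuous_on_linepath])
            have "linepath u v t \<in> {s2'..s1'}" if "t \<in> {0..1}" for t
              using lpc[OF that] seg(1) by blast
            then show "linepath u v ` {0..1} \<subseteq> {-1..1}" using s'(1-4) by (force simp: image_subset_iff)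
          qed
        fix t :: real assume t: "t \<in> {0..1}"
        have "F (Complex k (linepath u v t)) \<noteq> 0"
          unfolding lp(2) using seg(2) t F_ne small0 linepath_in_path[OF t] by blast
        then have "Y (linepath u v t) \<noteq> rcis r \<xi>" by (simp add: F_def k)
        moreover have "norm (Y (linepath u v t)) \<le> r" using lpc[OF t, of u v] seg(1) s'(5) by auto
        ultimately show "norm (Y (linepath u v t)) \<le> r \<and> Y (linepath u v t) \<noteq> rcis r \<xi>" by simp
      qed (use k r in \<open>auto simp: linepath_0' linepath_1'\<close>)
      ultimately show ?thesis by simp
    qed
    have side_Y: "Re (winding_number (F \<circ> linepath (Complex u k) (Complex v k)) 0) =
        (chord_angle \<xi> \<eta>1 - chord_angle \<xi> \<eta>0) / (2 * pi)"
      if k: "Y k = rcis r \<xi>" "X u = rcis r \<eta>0" "X v = rcis r \<eta>1" "\<bar>\<xi> - \<eta>0\<bar> < 2 * pi" "\<bar>\<xi> - \<eta>1\<bar> < 2 * pi"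
        and seg: "closed_segment u v \<subseteq> {s2..s1}" "closed_segment (Complex u k) (Complex v k) \<subseteq> path_image small"
      for k u v \<xi> \<eta>0 \<eta>1
    proof -
      have pX: "path (\<lambda>t. X (linepath u v t))"
        unfolding path_def
        proof (rule continuous_on_compose2[OF X(1) continuous_on_linepath])
          have "linepath u v t \<in> {s2..s1}" if "t \<in> {0..1}" for t
            using lpc[OF that] seg(1) by blast
          then show "linepath u v ` {0..1} \<subseteq> {-1..1}" using s(1-4) by (force simp: image_subset_iff)
        qed
      have ne: "X (linepath u v t) \<noteq> rcis r \<xi>" if t: "t \<in> {0..1}" for t
      proof -
        have "F (Complex (linepath u v t) k) \<noteq> 0"
          unfolding lp(1) using seg(2) F_ne small0 linepath_in_path[OF t] by blast
        then show ?thesis by (simp add: F_def k)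
      qed
      have "F \<circ> linepath (Complex u k) (Complex v k) = (\<lambda>t. - (rcis r \<xi> - X (linepath u v t)))"
        by (simp add: fun_eq_iff F_def lp(1)[symmetric] k)
      moreover have "Re (winding_number (\<lambda>t. - (rcis r \<xi> - X (linepath u v t))) 0) = Re (winding_number (\<lambda>t. rcis r \<xi> - X (linepath u v t)) 0)"
      proof (rule winding_number_uminus_path)
        show "path (\<lambda>t. rcis r \<xi> - X (linepath u v t))"
          using pX unfolding path_def by (intro continuous_on_diff continuous_on_const)
        show "rcis r \<xi> - X (linepath u v t) \<noteq> 0" if "t \<in> {0..1}" for t
          using ne[OF that] by simp
      qed
      moreover have "Re (winding_number (\<lambda>t. rcis r \<xi> - X (linepath u v t)) 0) = (chord_angle \<xi> \<eta>1 - chord_angle \<xi> \<eta>0) / (2 * pi)"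
      proof (rule Re_winding_number_side[OF pX])
        fix t :: real assume t: "t \<in> {0..1}"
        have "norm (X (linepath u v t)) \<le> r" using lpc[OF t, of u v] seg(1) s(5) by auto
        then show "norm (X (linepath u v t)) \<le> r \<and> X (linepath u v t) \<noteq> rcis r \<xi>" using ne[OF t] by simp
      qed (use k r in \<open>auto simp: linepath_0' linepath_1'\<close>)
      ultimately show ?thesis by simp
    qed
    have "Re (winding_number (F \<circ> small) 0) = (chord_angle \<beta>' \<alpha> - chord_angle \<beta>' \<beta>) / (2 * pi)
        + (chord_angle \<alpha> \<alpha>' - chord_angle \<alpha> \<beta>') / (2 * pi)
        + (chord_angle \<alpha>' \<beta> - chord_angle \<alpha>' \<alpha>) / (2 * pi) + (chord_angle \<beta> \<beta>' - chord_angle \<beta> \<alpha>') / (2 * pi)"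
    proof -
      have "Re (winding_number (F \<circ> linepath (Complex s2 s2') (Complex s1 s2')) 0) = (chord_angle \<beta>' \<alpha> - chord_angle \<beta>' \<beta>) / (2 * pi)"
        by (rule side_Y) (use s s' angles im in \<open>auto simp: closed_segment_eq_real_ivl abs_minus_commute\<close>)
      moreover have "Re (winding_number (F \<circ> linepath (Complex s1 s2') (Complex s1 s1')) 0) = (chord_angle \<alpha> \<alpha>' - chord_angle \<alpha> \<beta>') / (2 * pi)"
        by (rule side_X) (use s s' angles im in \<open>auto simp: closed_segment_eq_real_ivl abs_minus_commute\<close>)
      moreover have "Re (winding_number (F \<circ> linepath (Complex s1 s1') (Complex s2 s1')) 0) = (chord_angle \<alpha>' \<beta> - chord_angle \<alpha>' \<alpha>) / (2 * pi)"
        by (rule side_Y) (use s s' angles im in \<open>auto simp: closed_segment_eq_real_ivl abs_minus_commute\<close>)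
      moreover have "Re (winding_number (F \<circ> linepath (Complex s2 s1') (Complex s2 s2')) 0) = (chord_angle \<beta> \<beta>' - chord_angle \<beta> \<alpha>') / (2 * pi)"
        by (rule side_X) (use s s' angles im in \<open>auto simp: closed_segment_eq_real_ivl abs_minus_commute\<close>)
      ultimately show ?thesis unfolding sum by simp
    qed
    also have "\<dots> = (sgn (\<alpha> - \<alpha>') + sgn (\<beta> - \<beta>') + sgn (\<alpha>' - \<beta>) + sgn (\<beta>' - \<alpha>)) / 2"
    proof -
      have flip: "sgn (x - y) = - sgn (y - x)" for x y :: real by (simp add: sgn_if)
      show ?thesis
        unfolding chord_angle_def flip[of \<beta>' \<beta>] flip[of \<alpha> \<beta>'] flip[of \<alpha>' \<alpha>] flip[of \<beta> \<alpha>']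
        by (simp add: field_simps)
    qed
    finally show ?thesis .
  qed
  ultimately show ?thesis by simp
qed

section \<open>Realizable words have an intersection form of rank at most two\<close>

text \<open>For a hieroglyph the parity of \<open>inv_count x y w\<close> tells whether the ends of \<open>x\<close> and \<open>y\<close> interlace.\<close>

fun inv_count :: "'a \<Rightarrow> 'a \<Rightarrow> 'a list \<Rightarrow> nat" where
  "inv_count x y [] = 0"
| "inv_count x y (z # w) = (if z = x then count_list w y else 0) + inv_count x y w"

text \<open>\<open>a\<close> and \<open>b\<close> stand for the homology coordinates of the loops.
  The diagonal is left out because \<open>inv_count x x w\<close> is one, not zero, for a letter of
  a hieroglyph.\<close>

definition torus_form :: "'a list \<Rightarrow> bool" where
  "torus_form w \<longleftrightarrow> (\<exists>a b :: 'a \<Rightarrow> int. \<forall>x\<in>set w. \<forall>y\<in>set w. x \<noteq> y \<longrightarrow>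
     (odd (inv_count x y w) \<longleftrightarrow> odd (a x * b y - a y * b x)))"

lemma count_list_eq_sum: "count_list w x = (\<Sum>i<length w. if w ! i = x then 1 else 0)"
  by (induction w) (auto simp: sum.lessThan_Suc_shift simp del: sum.lessThan_Suc)

lemma inv_count_eq_sum:
  "inv_count x y w = (\<Sum>i<length w. \<Sum>j<length w. if i < j \<and> w ! i = x \<and> w ! j = y then 1 else 0)"
proof (induction w)
  case (Cons z w)
  have "(\<Sum>i<length (z # w). \<Sum>j<length (z # w). if i < j \<and> (z # w) ! i = x \<and> (z # w) ! j = y then 1 else 0)
     = (\<Sum>j<length w. if z = x \<and> w ! j = y then 1 else 0) +
       (\<Sum>i<length w. \<Sum>j<length w. if i < j \<and> w ! i = x \<and> w ! j = y then 1 else (0 :: nat))"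
    by (simp add: sum.lessThan_Suc_shift del: sum.lessThan_Suc)
  then show ?case using Cons by (simp add: count_list_eq_sum)
qed simp

lemma count_list_eq_card: "count_list w x = card {i. i < length w \<and> w ! i = x}"
  by (simp add: count_list_eq_length_filter length_filter_conv_card eq_commute)

lemma inv_count_positions:
  assumes "count_list w x = 2" "count_list w y = 2"
    and p: "p < length w" "q < length w" "p \<noteq> q" "w ! p = x" "w ! q = x"
    and p': "p' < length w" "q' < length w" "p' \<noteq> q'" "w ! p' = y" "w ! q' = y"
  shows "inv_count x y w = of_bool (p < p') + of_bool (p < q') + of_bool (q < p') + of_bool (q < q')"
proof -
  have pos: "{i. i < length w \<and> w ! i = z} = {k, l}"
    if "count_list w z = 2" "k < length w" "l < length w" "k \<noteq> l" "w ! k = z" "w ! l = z" for k l z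
  proof -
    have "card {k, l} = card {i. i < length w \<and> w ! i = z}"
      using that by (simp flip: count_list_eq_card)
    then have "{k, l} = {i. i < length w \<and> w ! i = z}"
      by (intro card_subset_eq) (use that in auto)
    then show ?thesis by simp
  qed
  have "inv_count x y w = (\<Sum>i<length w. \<Sum>j<length w. if w ! i = x then (if w ! j = y then of_bool (i < j) else 0) else 0)"
    unfolding inv_count_eq_sum by (intro sum.cong refl) auto
  also have "\<dots> = (\<Sum>i\<in>{i\<in>{..<length w}. w ! i = x}. \<Sum>j\<in>{j\<in>{..<length w}. w ! j = y}. of_bool (i < j))"
    unfolding sum.inter_filter[OF finite_lessThan] by (intro sum.cong refl) auto
  also have "{i\<in>{..<length w}. w ! i = x} = {p, q}" using pos[OF assms(1) p] by auto
  also have "{i\<in>{..<length w}. w ! i = y} = {p', q'}" using pos[OF assms(2) p'] by auto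
  finally show ?thesis using p(3) p'(3) by simp
qed

text \<open>The loop is run through once before and once after time zero. By the intermediate value
  theorem, a lift starting at the centre leaves the disc only at a time when the loop meets the
  circle; the returning end is treated in the same way around the lattice point
  \<open>X 1\<close>.\<close>

lemma loop_lift:
  assumes v: "v \<in> torus" and c: "simple_path c" "path_image c \<subseteq> torus" "pathstart c = v" "pathfinish c = v"
    and r: "0 < r" "r < pi" and lr: "leaves_and_returns v r c \<alpha> \<beta>"
  obtains X and a b :: int and s1 s2 :: real where
    "continuous_on {-1..1} X" "X 0 = 0"
    "\<forall>t. -1 \<le> t \<and> t \<le> 0 \<longrightarrow> X (t + 1) = X t + Complex (2 * pi * a) (2 * pi * b)"
    "\<forall>t. -1 \<le> t \<and> t \<le> 1 \<longrightarrow> torus_chart v (X t) = c (if t \<le> 0 then t + 1 else t)"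
    "-1 < s2" "s2 < 0" "0 < s1" "s1 < 1" "\<forall>t. s2 \<le> t \<and> t \<le> s1 \<longrightarrow> norm (X t) \<le> r"
    "X s1 = rcis r \<alpha>" "X s2 = rcis r \<beta>"
proof -
  have c01: "c 0 = v" "c 1 = v" using c by (auto simp: pathstart_def pathfinish_def)
  obtain X where X: "continuous_on {0..1} X" "X 0 = 0"
      "\<And>t. t \<in> {0..1} \<Longrightarrow> c t = torus_chart (c 0) (X t)"
    using torus_path_lift[OF simple_path_imp_path[OF c(1)] c(2)] by blast
  have Xc: "torus_chart v (X t) = c t" if "0 \<le> t" "t \<le> 1" for t using X(3)[of t] that c01 by simp
  have chart0: "torus_chart v 0 = v" by (simp add: torus_chart_def)
  have "torus_chart v (X 1) = torus_chart v 0" using Xc[of 1] c01 chart0 by simp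
  then obtain a b :: int where L: "X 1 = Complex (2 * pi * a) (2 * pi * b)"
    unfolding torus_chart_eq_iff[OF v] by (auto simp: lattice_point_def)
  have shift: "torus_chart v (z - X 1) = torus_chart v z" for z
    unfolding torus_chart_eq_iff[OF v] lattice_point_def
    by (rule exI[of _ "-a"], rule exI[of _ "-b"]) (simp add: L complex_eq_iff)
  define E where "E t = (if t \<le> 0 then X (t + 1) - X 1 else X t)" for t
  obtain s s' where s: "0 < s" "s < s'" "s' < 1"
    and sph: "\<And>t. t \<in> {0..1} \<Longrightarrow> c t \<in> torus_chart v ` sphere 0 r \<longleftrightarrow> t = s \<or> t = s'"
    and cs: "c s = torus_chart v (rcis r \<alpha>)" "c s' = torus_chart v (rcis r \<beta>)"
    using lr unfolding leaves_and_returns_def by blast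
  have near: "norm (X t) \<le> r" if t: "0 \<le> t" "t \<le> s" for t
  proof (rule ccontr)
    assume n: "\<not> norm (X t) \<le> r"
    have "continuous_on {0..t} (\<lambda>t. norm (X t))"
      by (intro continuous_on_norm continuous_on_subset[OF X(1)]) (use that s in auto)
    then obtain u where u: "0 \<le> u" "u \<le> t" "norm (X u) = r"
      using IVT'[of "\<lambda>t. norm (X t)" 0 r t] n X(2) r t s by auto
    then have "c u \<in> torus_chart v ` sphere 0 r" using Xc[of u] u t s by (intro image_eqI[of _ _ "X u"]) auto
    then have "u = s \<or> u = s'" using sph[of u] u t s by auto
    then show False using u n that s by auto
  qed
  have far: "norm (X t - X 1) \<le> r" if t: "s' \<le> t" "t \<le> 1" for t
  proof (rule ccontr)
    assume n: "\<not> norm (X t - X 1) \<le> r"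
    have "continuous_on {t..1} (\<lambda>t. norm (X t - X 1))"
      by (intro continuous_on_norm continuous_on_diff continuous_on_const continuous_on_subset[OF X(1)]) (use that s in auto)
    then obtain u where u: "t \<le> u" "u \<le> 1" "norm (X u - X 1) = r"
      using IVT2'[of "\<lambda>t. norm (X t - X 1)" 1 r t] n r t s by auto
    then have "c u \<in> torus_chart v ` sphere 0 r"
      using Xc[of u] shift[of "X u"] u t s by (intro image_eqI[of _ _ "X u - X 1"]) auto
    then have "u = s \<or> u = s'" using sph[of u] u t s by auto
    then show False using u n that s by auto
  qed
  \<comment> \<open>Two points of a disc of radius less than \<open>pi\<close> cannot differ by a
    nonzero lattice point, so the crossings lift to the prescribed points and not to
    translates.\<close>
  have on_circle: "z = rcis r \<delta>" if "torus_chart v z = torus_chart v (rcis r \<delta>)" "norm z \<le> r" for z \<delta>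
  proof -
    have "lattice_point (z - rcis r \<delta>)" using that(1) torus_chart_eq_iff[OF v] by simp
    moreover have "norm (z - rcis r \<delta>) < 2 * pi"
      using norm_triangle_ineq4[of z "rcis r \<delta>"] that(2) r by simp
    ultimately show ?thesis using lattice_point_norm by fastforce
  qed
  show ?thesis
  proof (rule that[of E a b "s' - 1" s])
    have "continuous_on ({-1..0} \<union> {0..1}) (\<lambda>t. if t \<le> 0 then X (t + 1) - X 1 else X t)"
    proof (rule continuous_on_cases)
      show "continuous_on {-1..0} (\<lambda>t. X (t + 1) - X 1)"
        by (intro continuous_intros continuous_on_compose2[OF X(1)]) auto
    qed (use X in auto)
    moreover have "{-1..0} \<union> {0..1} = {-1..(1::real)}" by auto
    ultimately show "continuous_on {-1..1} E" unfolding E_def by simp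
    show "E 0 = 0" by (simp add: E_def)
    show "\<forall>t. -1 \<le> t \<and> t \<le> 0 \<longrightarrow> E (t + 1) = E t + Complex (2 * pi * a) (2 * pi * b)"
    proof (intro allI impI)
      fix t :: real assume t: "-1 \<le> t \<and> t \<le> 0"
      have "E (t + 1) = E t + X 1"
        using t X(2) by (cases "t = -1") (auto simp: E_def)
      then show "E (t + 1) = E t + Complex (2 * pi * a) (2 * pi * b)" by (simp add: L)
    qed
    show "\<forall>t. -1 \<le> t \<and> t \<le> 1 \<longrightarrow> torus_chart v (E t) = c (if t \<le> 0 then t + 1 else t)"
      using Xc shift by (auto simp: E_def)
    show "\<forall>t. s' - 1 \<le> t \<and> t \<le> s \<longrightarrow> norm (E t) \<le> r"
      using near far s by (auto simp: E_def)
    show "E s = rcis r \<alpha>"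
      by (rule on_circle) (use near Xc cs s in \<open>auto simp: E_def\<close>)
    show "E (s' - 1) = rcis r \<beta>"
      by (rule on_circle) (use far Xc shift cs s in \<open>auto simp: E_def\<close>)
  qed (use s in auto)
qed

theorem realizable_imp_torus_form:
  assumes "hieroglyph w" "realizable_on_torus w"
  shows "torus_form w"
proof -
  from assms(2) obtain v \<gamma> r and \<theta> :: "nat \<Rightarrow> real"
    where draw: "torus_drawing v \<gamma> (set w)" and r: "0 < r" "r < pi"
    and ord: "\<And>i j. i < j \<Longrightarrow> j < length w \<Longrightarrow> \<theta> i < \<theta> j \<and> \<theta> j < \<theta> i + 2 * pi"
    and loops: "\<forall>x\<in>set w. \<exists>p q. p < length w \<and> q < length w \<and> p \<noteq> q \<and> w ! p = x \<and> w ! q = x \<and>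
            leaves_and_returns v r (\<gamma> x) (\<theta> p) (\<theta> q)"
    unfolding realizable_on_torus_def met_in_cyclic_order_def by blast
  have v: "v \<in> torus" using draw by (simp add: torus_drawing_def)
  define lift where "lift x a b X p q s1 s2 \<longleftrightarrow>
    p < length w \<and> q < length w \<and> p \<noteq> q \<and> w ! p = x \<and> w ! q = x \<and>
    continuous_on {-1..1} X \<and> X 0 = 0 \<and>
    (\<forall>t. -1 \<le> t \<and> t \<le> 0 \<longrightarrow> X (t + 1) = X t + Complex (2 * pi * of_int a) (2 * pi * of_int b)) \<and>
    (\<forall>t. -1 \<le> t \<and> t \<le> 1 \<longrightarrow> torus_chart v (X t) = \<gamma> x (if t \<le> 0 then t + 1 else t)) \<and>
    -1 < s2 \<and> s2 < 0 \<and> 0 < s1 \<and> s1 < 1 \<and> (\<forall>t. s2 \<le> t \<and> t \<le> s1 \<longrightarrow> norm (X t) \<le> r) \<and>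
    X s1 = rcis r (\<theta> p) \<and> X s2 = rcis r (\<theta> q)" for x a b X p q s1 s2
  have ex: "\<exists>a b X p q s1 s2. lift x a b X p q s1 s2" if "x \<in> set w" for x
  proof -
    from loops that obtain p q where pq: "p < length w" "q < length w" "p \<noteq> q" "w ! p = x" "w ! q = x"
      and lr: "leaves_and_returns v r (\<gamma> x) (\<theta> p) (\<theta> q)" by blast
    have c: "simple_path (\<gamma> x)" "path_image (\<gamma> x) \<subseteq> torus" "pathstart (\<gamma> x) = v" "pathfinish (\<gamma> x) = v"
      using draw that by (auto simp: torus_drawing_def)
    obtain X and a b :: int and s1 s2 :: real where
      "continuous_on {-1..1} X" "X 0 = 0"
      "\<forall>t. -1 \<le> t \<and> t \<le> 0 \<longrightarrow> X (t + 1) = X t + Complex (2 * pi * a) (2 * pi * b)"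
      "\<forall>t. -1 \<le> t \<and> t \<le> 1 \<longrightarrow> torus_chart v (X t) = \<gamma> x (if t \<le> 0 then t + 1 else t)"
      "-1 < s2" "s2 < 0" "0 < s1" "s1 < 1" "\<forall>t. s2 \<le> t \<and> t \<le> s1 \<longrightarrow> norm (X t) \<le> r"
      "X s1 = rcis r (\<theta> p)" "X s2 = rcis r (\<theta> q)"
      by (rule loop_lift[OF v c r lr])
    then have "lift x a b X p q s1 s2" using pq unfolding lift_def by simp
    then show ?thesis by blast
  qed
  \<comment> \<open>The class is chosen once per letter, since \<open>a\<close> and \<open>b\<close>
    must serve all pairs; the other data of the lift may vary with the pair.\<close>
  then obtain a b where ab: "\<And>x. x \<in> set w \<Longrightarrow> \<exists>X p q s1 s2. lift x (a x) (b x) X p q s1 s2" by metis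
  have "odd (inv_count x y w) \<longleftrightarrow> odd (a x * b y - a y * b x)" if xy: "x \<in> set w" "y \<in> set w" "x \<noteq> y" for x y
  proof -
    obtain X p q s1 s2 where X: "lift x (a x) (b x) X p q s1 s2" using ab xy by blast
    obtain Y p' q' s1' s2' where Y: "lift y (a y) (b y) Y p' q' s1' s2'" using ab xy by blast
    note X = X[unfolded lift_def] and Y = Y[unfolded lift_def]
    have diff: "\<bar>\<theta> i - \<theta> j\<bar> < 2 * pi" if "i < length w" "j < length w" for i j
      using ord[of i j] ord[of j i] that by (cases i j rule: linorder_cases) auto
    have sg: "sgn (\<theta> i - \<theta> j) = 1 - 2 * of_bool (i < j)" if "i < length w" "j < length w" "i \<noteq> j" for i j
      using ord[of i j] ord[of j i] that by (cases i j rule: linorder_cases) auto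
    have ne: "p \<noteq> p'" "p \<noteq> q'" "q \<noteq> p'" "q \<noteq> q'" using X Y xy(3) by auto
    \<comment> \<open>A simple loop visits the vertex only at its ends, which is time zero in the
      doubled parametrization.\<close>
    have simple: "\<tau> = 0" if "\<gamma> z (if \<tau> \<le> 0 then \<tau> + 1 else \<tau>) = v" "\<bar>\<tau>\<bar> < 1" "z \<in> set w" for z \<tau>
    proof -
      have sp: "simple_path (\<gamma> z)" and "\<gamma> z 0 = v"
        using draw that(3) by (auto simp: torus_drawing_def pathstart_def)
      then have "\<gamma> z (if \<tau> \<le> 0 then \<tau> + 1 else \<tau>) = \<gamma> z 0" using that(1) by simp
      then show ?thesis
        using sp that(2) unfolding simple_path_def loop_free_def by (fastforce split: if_splits)
    qed
    have meet: "t = 0 \<and> s = 0" if ts: "\<bar>t\<bar> < 1" "\<bar>s\<bar> < 1" "lattice_point (X t - Y s)" for t s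
    proof -
      have "torus_chart v (X t) = torus_chart v (Y s)" using ts(3) torus_chart_eq_iff[OF v] by simp
      then have eq: "\<gamma> x (if t \<le> 0 then t + 1 else t) = \<gamma> y (if s \<le> 0 then s + 1 else s)"
        using X Y ts by auto
      have "\<gamma> x (if t \<le> 0 then t + 1 else t) \<in> path_image (\<gamma> x)"
        "\<gamma> y (if s \<le> 0 then s + 1 else s) \<in> path_image (\<gamma> y)"
        unfolding path_image_def using ts by (auto intro!: imageI)
      then have "\<gamma> x (if t \<le> 0 then t + 1 else t) \<in> path_image (\<gamma> x) \<inter> path_image (\<gamma> y)"
        using eq by (simp only: Int_iff)
      also have "path_image (\<gamma> x) \<inter> path_image (\<gamma> y) = {v}" using draw xy by (simp add: torus_drawing_def)
      finally have "\<gamma> x (if t \<le> 0 then t + 1 else t) = v" "\<gamma> y (if s \<le> 0 then s + 1 else s) = v"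
        using eq by (simp_all only: singleton_iff)
      then show ?thesis using simple ts xy by blast
    qed
    have "2 * real_of_int (b x * a y - a x * b y) = sgn (\<theta> p - \<theta> p') + sgn (\<theta> q - \<theta> q') + sgn (\<theta> p' - \<theta> q) + sgn (\<theta> q' - \<theta> p)"
      by (rule crossing_formula[of X "a x" "b x" Y "a y" "b y" r s2 s1 "\<theta> p" "\<theta> q" s2' s1' "\<theta> p'" "\<theta> q'"])
         (use X Y r meet diff in auto)
    also have "\<dots> = 2 * real_of_int (of_bool (p < q') + of_bool (q < p') - of_bool (p < p') - of_bool (q < q'))"
      using X Y ne by (simp add: sg of_bool_def)
    finally have 1: "b x * a y - a x * b y = of_bool (p < q') + of_bool (q < p') - of_bool (p < p') - of_bool (q < q')"
      unfolding mult_cancel_left of_int_eq_iff by simp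
    have "inv_count x y w = of_bool (p < p') + of_bool (p < q') + of_bool (q < p') + of_bool (q < q')"
      by (rule inv_count_positions) (use X Y xy assms(1) in \<open>auto simp: hieroglyph_def\<close>)
    \<comment> \<open>Modulo two the signs of the four comparisons do not matter.\<close>
    then have "odd (inv_count x y w) \<longleftrightarrow> odd (b x * a y - a x * b y)"
      unfolding 1 by (simp add: of_bool_def)
    then show ?thesis by auto
  qed
  then show ?thesis unfolding torus_form_def by blast
qed

section \<open>Radial drawings\<close>

abbreviation chart :: "complex \<Rightarrow> complex \<times> complex" where
  "chart \<equiv> torus_chart (1, 1)"

text \<open>In contrast to \<open>leaves_and_returns\<close>, the two ends are straight inside the disc, so that the
  disc may be shrunk and new loops may be drawn in the sectors between the ends.\<close>

definition radial_loop :: "real \<Rightarrow> (real \<Rightarrow> complex \<times> complex) \<Rightarrow> real \<Rightarrow> real \<Rightarrow> bool" where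
  "radial_loop r c \<alpha> \<beta> \<longleftrightarrow> (\<exists>s s'. 0 < s \<and> s < s' \<and> s' < 1 \<and>
     (\<forall>t. 0 \<le> t \<and> t \<le> s \<longrightarrow> c t = chart (rcis (r * (t / s)) \<alpha>)) \<and>
     (\<forall>t. s' \<le> t \<and> t \<le> 1 \<longrightarrow> c t = chart (rcis (r * ((1 - t) / (1 - s'))) \<beta>)) \<and>
     (\<forall>t. s < t \<and> t < s' \<longrightarrow> c t \<notin> chart ` cball 0 r))"

definition radially_realizable :: "'a list \<Rightarrow> bool" where
  "radially_realizable w \<longleftrightarrow> (\<exists>\<gamma> r \<theta>. torus_drawing (1, 1) \<gamma> (set w) \<and> 0 < r \<and> r < pi \<and>
     (\<forall>i j. i < j \<and> j < length w \<longrightarrow> \<theta> i < \<theta> j \<and> \<theta> j < \<theta> i + 2 * pi) \<and>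
     (\<forall>x\<in>set w. \<exists>p q. p < length w \<and> q < length w \<and> p \<noteq> q \<and> w ! p = x \<and> w ! q = x \<and>
        radial_loop r (\<gamma> x) (\<theta> p) (\<theta> q)))"

lemma base_point_in_torus: "(1, 1) \<in> torus"
  by (simp add: torus_def)

lemma chart_0: "chart 0 = (1, 1)"
  by (simp add: torus_chart_def)

lemma chart_in_torus: "chart z \<in> torus"
  by (simp add: torus_chart_def torus_def)

lemma chart_inj:
  assumes "chart z = chart z'" "norm z < pi" "norm z' < pi"
  shows "z = z'"
proof -
  have "lattice_point (z - z')" using assms(1) torus_chart_eq_iff[OF base_point_in_torus] by simp
  moreover have "norm (z - z') < 2 * pi"
    using norm_triangle_ineq4[of z z'] assms(2,3) by linarith
  ultimately show ?thesis using lattice_point_norm by fastforce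
qed

lemma chart_in_image_iff:
  assumes "norm z < pi" "\<And>y. y \<in> S \<Longrightarrow> norm y < pi"
  shows "chart z \<in> chart ` S \<longleftrightarrow> z \<in> S"
proof
  assume "chart z \<in> chart ` S"
  then obtain y where "y \<in> S" "chart z = chart y" by blast
  then show "z \<in> S" using chart_inj[of z y] assms by simp
qed simp

text \<open>A straight end crosses every smaller concentric circle at the same angle, at a time
  scaled by \<open>k\<close>; the pieces of the ends cut off in this way stay outside the smaller
  disc.\<close>

lemma radial_loop_shrink:
  assumes "radial_loop r c \<alpha> \<beta>" "0 < r'" "r' < r" "r < pi"
  shows "radial_loop r' c \<alpha> \<beta>"
proof -
  from assms(1) obtain s s' where s: "0 < s" "s < s'" "s' < 1"
    and out: "\<And>t. \<lbrakk>0 \<le> t; t \<le> s\<rbrakk> \<Longrightarrow> c t = chart (rcis (r * (t / s)) \<alpha>)"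
    and ret: "\<And>t. \<lbrakk>s' \<le> t; t \<le> 1\<rbrakk> \<Longrightarrow> c t = chart (rcis (r * ((1 - t) / (1 - s'))) \<beta>)"
    and mid: "\<And>t. \<lbrakk>s < t; t < s'\<rbrakk> \<Longrightarrow> c t \<notin> chart ` cball 0 r"
    unfolding radial_loop_def by blast
  define k where "k = r' / r"
  have k: "0 < k" "k < 1" "r' = k * r" using assms by (auto simp: k_def)
  have ks: "0 < s * k" "s * k < s" "0 < (1 - s') * k" "(1 - s') * k < 1 - s'" using s k by auto
  have scale: "r' < r * u" "r * u \<le> r" if "k < u" "u \<le> 1" for u
    using mult_strict_left_mono[OF that(1), of r] that assms k by (auto simp: mult.commute mult_left_le)
  have far: "chart (rcis \<rho> \<phi>) \<notin> chart ` cball 0 r'" if "r' < \<rho>" "\<rho> \<le> r" for \<rho> \<phi>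
    using that assms by (subst chart_in_image_iff) auto
  show ?thesis unfolding radial_loop_def
  proof (rule exI[of _ "s * k"], rule exI[of _ "1 - (1 - s') * k"], intro conjI allI impI)
    show "0 < s * k" "s * k < 1 - (1 - s') * k" "1 - (1 - s') * k < 1" using s ks by auto
  next
    fix t assume t: "0 \<le> t \<and> t \<le> s * k"
    then have "c t = chart (rcis (r * (t / s)) \<alpha>)" using out ks by auto
    also have "r * (t / s) = r' * (t / (s * k))" using k by simp
    finally show "c t = chart (rcis (r' * (t / (s * k))) \<alpha>)" .
  next
    fix t assume t: "1 - (1 - s') * k \<le> t \<and> t \<le> 1"
    then have "c t = chart (rcis (r * ((1 - t) / (1 - s'))) \<beta>)" using ret ks by auto
    also have "r * ((1 - t) / (1 - s')) = r' * ((1 - t) / (1 - (1 - (1 - s') * k)))" using k by simp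
    finally show "c t = chart (rcis (r' * ((1 - t) / (1 - (1 - (1 - s') * k)))) \<beta>)" .
  next
    fix t assume t: "s * k < t \<and> t < 1 - (1 - s') * k"
    consider "t \<le> s" | "s < t" "t < s'" | "s' \<le> t" by linarith
    then show "c t \<notin> chart ` cball 0 r'"
    proof cases
      case 1
      have "k < t / s" "t / s \<le> 1" using t 1 s by (auto simp: field_simps)
      then have "r' < r * (t / s)" "r * (t / s) \<le> r" by (rule scale)+
      then show ?thesis using far out[of t] 1 t ks by simp
    next
      case 2
      have "chart ` cball 0 r' \<subseteq> chart ` cball 0 r" using assms by (intro image_mono) auto
      then show ?thesis using mid 2 by blast
    next
      case 3
      have "k < (1 - t) / (1 - s')" "(1 - t) / (1 - s') \<le> 1" using t 3 s by (auto simp: field_simps)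
      then have "r' < r * ((1 - t) / (1 - s'))" "r * ((1 - t) / (1 - s')) \<le> r" by (rule scale)+
      then show ?thesis using far ret[of t] 3 t ks by simp
    qed
  qed
qed

lemma radial_loop_imp_leaves_and_returns:
  assumes "radial_loop r c \<alpha> \<beta>" "0 < r" "r < pi"
  shows "leaves_and_returns (1, 1) r c \<alpha> \<beta>"
proof -
  from assms(1) obtain s s' where s: "0 < s" "s < s'" "s' < 1"
    and out: "\<And>t. \<lbrakk>0 \<le> t; t \<le> s\<rbrakk> \<Longrightarrow> c t = chart (rcis (r * (t / s)) \<alpha>)"
    and ret: "\<And>t. \<lbrakk>s' \<le> t; t \<le> 1\<rbrakk> \<Longrightarrow> c t = chart (rcis (r * ((1 - t) / (1 - s'))) \<beta>)"
    and mid: "\<And>t. \<lbrakk>s < t; t < s'\<rbrakk> \<Longrightarrow> c t \<notin> chart ` cball 0 r"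
    unfolding radial_loop_def by blast
  have disc: "(chart (rcis (r * u) \<phi>) \<in> chart ` ball 0 r \<longleftrightarrow> u < 1) \<and> (chart (rcis (r * u) \<phi>) \<in> chart ` sphere 0 r \<longleftrightarrow> u = 1)"
    if "0 \<le> u" "u \<le> 1" for u \<phi>
  proof -
    have "r * u \<le> r" using that assms by (simp add: mult_left_le)
    moreover have "norm (rcis (r * u) \<phi>) = r * u" using that assms by simp
    ultimately have n: "norm (rcis (r * u) \<phi>) < pi" using assms by linarith
    have "chart (rcis (r * u) \<phi>) \<in> chart ` ball 0 r \<longleftrightarrow> rcis (r * u) \<phi> \<in> ball 0 r"
      by (rule chart_in_image_iff[OF n]) (use assms in auto)
    moreover have "chart (rcis (r * u) \<phi>) \<in> chart ` sphere 0 r \<longleftrightarrow> rcis (r * u) \<phi> \<in> sphere 0 r"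
      by (rule chart_in_image_iff[OF n]) (use assms in auto)
    ultimately show ?thesis using that assms by (auto simp: abs_mult)
  qed
  have "(c t \<in> chart ` ball 0 r \<longleftrightarrow> t < s \<or> s' < t) \<and> (c t \<in> chart ` sphere 0 r \<longleftrightarrow> t = s \<or> t = s')"
    if t: "t \<in> {0..1}" for t
  proof -
    consider "t \<le> s" | "s < t" "t < s'" | "s' \<le> t" by linarith
    then show ?thesis
    proof cases
      case 1
      then show ?thesis using disc[of "t / s" \<alpha>] out[of t] t s by auto
    next
      case 2
      have "ball 0 r \<subseteq> cball (0 :: complex) r" "sphere 0 r \<subseteq> cball (0 :: complex) r" by auto
      then show ?thesis using mid[OF 2] 2 by (auto dest: image_mono)
    next
      case 3
      then have "0 \<le> (1 - t) / (1 - s')" "(1 - t) / (1 - s') \<le> 1" using t s by auto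
      moreover have "(1 - t) / (1 - s') < 1 \<longleftrightarrow> s' < t" "(1 - t) / (1 - s') = 1 \<longleftrightarrow> t = s'"
        using s by (auto simp: field_simps)
      ultimately show ?thesis using disc[of "(1 - t) / (1 - s')" \<beta>] ret[of t] 3 t s by auto
    qed
  qed
  then show ?thesis
    unfolding leaves_and_returns_def using s out[of s] ret[of s']
    by (intro exI[of _ s] exI[of _ s']) auto
qed

lemma radially_realizable_imp_realizable:
  assumes "radially_realizable w"
  shows "realizable_on_torus w"
proof -
  from assms obtain \<gamma> r \<theta> where *: "torus_drawing (1, 1) \<gamma> (set w)" "0 < r" "r < pi"
     "\<forall>i j. i < j \<and> j < length w \<longrightarrow> \<theta> i < \<theta> j \<and> \<theta> j < \<theta> i + 2 * pi"
     "\<forall>x\<in>set w. \<exists>p q. p < length w \<and> q < length w \<and> p \<noteq> q \<and> w ! p = x \<and> w ! q = x \<and>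
        radial_loop r (\<gamma> x) (\<theta> p) (\<theta> q)" unfolding radially_realizable_def by blast
  have "\<exists>p q. p < length w \<and> q < length w \<and> p \<noteq> q \<and> w ! p = x \<and> w ! q = x \<and>
      leaves_and_returns (1, 1) r (\<gamma> x) (\<theta> p) (\<theta> q)" if "x \<in> set w" for x
  proof -
    obtain p q where pq: "p < length w" "q < length w" "p \<noteq> q" "w ! p = x" "w ! q = x"
      "radial_loop r (\<gamma> x) (\<theta> p) (\<theta> q)" using *(5) \<open>x \<in> set w\<close> by blast
    from radial_loop_imp_leaves_and_returns[OF pq(6) *(2,3)] show ?thesis using pq by blast
  qed
  then have "met_in_cyclic_order (1, 1) \<gamma> w"
    unfolding met_in_cyclic_order_def using *(2-4) by (intro exI[of _ r] exI[of _ \<theta>]) blast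
  then show ?thesis using *(1) unfolding realizable_on_torus_def by (intro exI conjI)
qed

text \<open>The end that moves from the first place to the last gets a full turn added to its angle;
  the drawing stays the same.\<close>

lemma radially_realizable_rotate1:
  assumes "radially_realizable w"
  shows "radially_realizable (rotate1 w)"
proof (cases w)
  case Nil
  then show ?thesis using assms by simp
next
  case (Cons a u)
  let ?n = "length u"
  from assms obtain \<gamma> r and \<theta> :: "nat \<Rightarrow> real"
    where d: "torus_drawing (1, 1) \<gamma> (set w)" and r: "0 < r" "r < pi"
    and ord: "\<forall>i j. i < j \<and> j < length w \<longrightarrow> \<theta> i < \<theta> j \<and> \<theta> j < \<theta> i + 2 * pi"
    and loops: "\<forall>x\<in>set w. \<exists>p q. p < length w \<and> q < length w \<and> p \<noteq> q \<and> w ! p = x \<and> w ! q = x \<and>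
            radial_loop r (\<gamma> x) (\<theta> p) (\<theta> q)"
    unfolding radially_realizable_def by blast
  define \<theta>' where "\<theta>' i = (if i = ?n then \<theta> 0 + 2 * pi else \<theta> (Suc i))" for i
  define \<pi> where "\<pi> p = (if p = 0 then ?n else p - 1)" for p :: nat
  have ord': "\<theta>' i < \<theta>' j \<and> \<theta>' j < \<theta>' i + 2 * pi"
    if "i < j" "j < length (rotate1 w)" for i j
    using that ord[rule_format, of "Suc i" "Suc j"] ord[rule_format, of 0 "Suc i"]
    by (auto simp: \<theta>'_def Cons)
  have \<pi>: "\<pi> p < length (rotate1 w)" "rotate1 w ! \<pi> p = w ! p"
      "rcis \<rho> (\<theta>' (\<pi> p)) = rcis \<rho> (\<theta> p)" if "p < length w" for p \<rho>
    using that by (auto simp: \<pi>_def \<theta>'_def Cons nth_append rcis_def complex_eq_iff nth_Cons')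
  have \<pi>_inj: "\<pi> p \<noteq> \<pi> q" if "p \<noteq> q" "p < length w" "q < length w" for p q
    using that by (auto simp: \<pi>_def Cons)
  have "\<exists>p q. p < length (rotate1 w) \<and> q < length (rotate1 w) \<and> p \<noteq> q \<and>
          rotate1 w ! p = x \<and> rotate1 w ! q = x \<and> radial_loop r (\<gamma> x) (\<theta>' p) (\<theta>' q)"
    if "x \<in> set w" for x
  proof -
    from loops that obtain p q where
      1: "p < length w" "q < length w" "p \<noteq> q" "w ! p = x" "w ! q = x" and
      2: "radial_loop r (\<gamma> x) (\<theta> p) (\<theta> q)"
      by blast
    have "radial_loop r (\<gamma> x) (\<theta>' (\<pi> p)) (\<theta>' (\<pi> q))"
      using 2 \<pi>(3)[OF 1(1)] \<pi>(3)[OF 1(2)] by (simp add: radial_loop_def)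
    then show ?thesis using 1 \<pi>(1,2) \<pi>_inj by metis
  qed
  then show ?thesis
    unfolding radially_realizable_def using r ord' d
    by (intro exI[of _ \<gamma>] exI[of _ r] exI[of _ \<theta>']) simp
qed

lemma radially_realizable_append_commute:
  assumes "radially_realizable (u @ w)"
  shows "radially_realizable (w @ u)"
proof -
  have "radially_realizable (rotate k x)" if "radially_realizable x" for k and x :: "'a list"
    using that by (induction k) (auto intro: radially_realizable_rotate1)
  from this[OF assms, of "length u"] show ?thesis by (simp add: rotate_append)
qed

section \<open>Adding a small loop\<close>

lemma rcis_eqD:
  assumes "rcis a \<phi> = rcis b \<psi>" "0 \<le> a" "0 \<le> b"
  shows "a = b" "0 < a \<Longrightarrow> cis \<phi> = cis \<psi>"
proof -
  have "norm (rcis a \<phi>) = norm (rcis b \<psi>)" using assms(1) by simp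
  then show "a = b" using assms(2,3) by simp
  then show "cis \<phi> = cis \<psi>" if "0 < a" using assms(1) that by (simp add: rcis_def)
qed

lemma cis_eqD:
  assumes "cis \<phi> = cis \<psi>" "\<bar>\<phi> - \<psi>\<bar> < 2 * pi"
  shows "\<phi> = \<psi>"
proof -
  obtain n :: int where n: "\<phi> - \<psi> = 2 * pi * n" using assms(1) cis_eq_iff by blast
  then have "2 * pi * \<bar>real_of_int n\<bar> < 2 * pi * 1" using assms(2) by (simp add: abs_mult)
  then have "\<bar>real_of_int n\<bar> < 1" by (subst (asm) mult_less_cancel_left_pos) auto
  then have "n = 0" by linarith
  then show ?thesis using n by simp
qed

text \<open>The petal bounds a circular sector: in the first third of the time it goes out at angle
  \<alpha>, in the second along an arc of radius \<open>2 * r / 3\<close>, in the last back at angle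
  \<beta>.\<close>

definition petal_radius :: "real \<Rightarrow> real \<Rightarrow> real" where
  "petal_radius r t = 2 * r * min t (min (1 / 3) (1 - t))"

definition petal_angle :: "real \<Rightarrow> real \<Rightarrow> real \<Rightarrow> real" where
  "petal_angle \<alpha> \<beta> t = \<alpha> + (\<beta> - \<alpha>) * max 0 (min 1 (3 * t - 1))"

definition petal :: "real \<Rightarrow> real \<Rightarrow> real \<Rightarrow> real \<Rightarrow> complex" where
  "petal r \<alpha> \<beta> t = rcis (petal_radius r t) (petal_angle \<alpha> \<beta> t)"

lemma petal_radius_bounds:
  assumes "0 < r" "0 \<le> t" "t \<le> 1"
  shows "0 \<le> petal_radius r t" "petal_radius r t < r" "petal_radius r t = 0 \<longleftrightarrow> t = 0 \<or> t = 1"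
  using assms by (auto simp: petal_radius_def min_def)

lemma petal_angle_bounds:
  assumes "\<alpha> < \<beta>"
  shows "\<alpha> \<le> petal_angle \<alpha> \<beta> t" "petal_angle \<alpha> \<beta> t \<le> \<beta>"
proof -
  define m where "m = max 0 (min 1 (3 * t - 1))"
  have m: "0 \<le> m" "m \<le> 1" by (auto simp: m_def)
  have "0 \<le> (\<beta> - \<alpha>) * m" "(\<beta> - \<alpha>) * m \<le> \<beta> - \<alpha>" using m assms by (auto simp: mult_left_le)
  then show "\<alpha> \<le> petal_angle \<alpha> \<beta> t" "petal_angle \<alpha> \<beta> t \<le> \<beta>" by (auto simp: petal_angle_def m_def)
qed

text \<open>Away from the centre a point determines radius and angle. The angle tells the thirds
  apart and is injective in the middle one; the radius is injective in each outer one.\<close>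

lemma petal_inj:
  assumes "0 < r" "\<alpha> < \<beta>" "\<beta> < \<alpha> + 2 * pi" "0 \<le> t" "t \<le> 1" "0 \<le> t'" "t' \<le> 1" "petal r \<alpha> \<beta> t = petal r \<alpha> \<beta> t'"
  shows "t = t' \<or> t = 0 \<and> t' = 1 \<or> t = 1 \<and> t' = 0"
proof -
  note eqD = rcis_eqD[OF assms(8)[unfolded petal_def] petal_radius_bounds(1)[OF assms(1,4,5)]
        petal_radius_bounds(1)[OF assms(1,6,7)]]
  have R: "petal_radius r t = petal_radius r t'" by (rule eqD(1))
  show ?thesis
  proof (cases "petal_radius r t = 0")
    case True
    then have "t = 0 \<or> t = 1" "t' = 0 \<or> t' = 1"
      using R petal_radius_bounds(3)[OF assms(1,4,5)] petal_radius_bounds(3)[OF assms(1,6,7)] by simp_all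
    then show ?thesis by auto
  next
    case False
    then have "0 < petal_radius r t" using petal_radius_bounds(1)[OF assms(1,4,5)] by simp
    then have "petal_angle \<alpha> \<beta> t = petal_angle \<alpha> \<beta> t'"
    proof (rule cis_eqD[OF eqD(2)])
      show "\<bar>petal_angle \<alpha> \<beta> t - petal_angle \<alpha> \<beta> t'\<bar> < 2 * pi"
        using petal_angle_bounds[OF assms(2), of t] petal_angle_bounds[OF assms(2), of t'] assms(3) by linarith
    qed
    then have "max 0 (min 1 (3 * t - 1)) = max 0 (min 1 (3 * t' - 1))"
      using assms(2) by (simp add: petal_angle_def)
    moreover have "min t (min (1 / 3) (1 - t)) = min t' (min (1 / 3) (1 - t'))"
      using R assms(1) by (simp add: petal_radius_def)
    ultimately have "t = t'" by (auto simp: min_def max_def split: if_splits)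
    then show ?thesis by simp
  qed
qed

lemma petal_radial:
  assumes "0 < r" "r < pi"
  shows "radial_loop (r / 3) (chart \<circ> petal r \<alpha> \<beta>) \<alpha> \<beta>"
  unfolding radial_loop_def
\<comment> \<open>The radius \<open>2 * r * t\<close> reaches \<open>r / 3\<close> at time
  \<open>1 / 6\<close>, and symmetrically on the way back.\<close>
proof (rule exI[of _ "1 / 6"], rule exI[of _ "5 / 6"], intro conjI allI impI)
  fix t :: real assume "0 \<le> t \<and> t \<le> 1 / 6"
  then have "petal_radius r t = r / 3 * (t / (1 / 6))" "petal_angle \<alpha> \<beta> t = \<alpha>"
    by (auto simp: petal_radius_def petal_angle_def min_def)
  then show "(chart \<circ> petal r \<alpha> \<beta>) t = chart (rcis (r / 3 * (t / (1 / 6))) \<alpha>)"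
    by (simp only: comp_apply petal_def)
next
  fix t :: real assume "5 / 6 \<le> t \<and> t \<le> 1"
  then have "petal_radius r t = r / 3 * ((1 - t) / (1 - 5 / 6))" "petal_angle \<alpha> \<beta> t = \<beta>"
    by (auto simp: petal_radius_def petal_angle_def min_def max_def)
  then show "(chart \<circ> petal r \<alpha> \<beta>) t = chart (rcis (r / 3 * ((1 - t) / (1 - 5 / 6))) \<beta>)"
    by (simp only: comp_apply petal_def)
next
  fix t :: real assume t: "1 / 6 < t \<and> t < 5 / 6"
  then have "1 / 6 < min t (min (1 / 3) (1 - t))" by auto
  then have "2 * r * (1 / 6) < petal_radius r t"
    unfolding petal_radius_def using assms(1) by (intro mult_strict_left_mono) auto
  moreover have "petal_radius r t < r" "0 \<le> petal_radius r t" using petal_radius_bounds assms t by auto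
  ultimately show "(chart \<circ> petal r \<alpha> \<beta>) t \<notin> chart ` cball 0 (r / 3)"
    unfolding comp_apply petal_def using assms by (subst chart_in_image_iff) auto
qed auto

lemma continuous_petal: "continuous_on A (petal r \<alpha> \<beta>)"
  unfolding petal_def rcis_def cis_conv_exp petal_radius_def petal_angle_def
  by (intro continuous_intros)

lemma continuous_chart: "continuous_on A chart"
  unfolding torus_chart_def cis_conv_exp by (intro continuous_intros)

text \<open>Inside the disc there is nothing but straight ends, so the sector from the last end to
  the first is free for a petal. The new disc has radius \<open>r / 3\<close>, smaller than that of
  the arc. Cyclic shifts reduce insertion at any other place to this one.\<close>

lemma radially_realizable_add_loop:
  assumes "radially_realizable u" "x \<notin> set u"
  shows "radially_realizable (u @ [x, x])"
proof -
  let ?n = "length u"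
  from assms(1) obtain \<gamma> r and \<theta> :: "nat \<Rightarrow> real"
    where d: "torus_drawing (1, 1) \<gamma> (set u)" and r: "0 < r" "r < pi"
    and ord': "\<forall>i j. i < j \<and> j < ?n \<longrightarrow> \<theta> i < \<theta> j \<and> \<theta> j < \<theta> i + 2 * pi"
    and loops': "\<forall>x\<in>set u. \<exists>p q. p < ?n \<and> q < ?n \<and> p \<noteq> q \<and> u ! p = x \<and> u ! q = x \<and>
            radial_loop r (\<gamma> x) (\<theta> p) (\<theta> q)"
    unfolding radially_realizable_def by blast
  note ord = ord'[rule_format, OF conjI] and loops = loops'[rule_format]
  \<comment> \<open>The free sector ends at the first end, one turn later. Without any ends it is
    the arbitrary interval from zero to one.\<close>
  define lo where "lo = (if ?n = 0 then 0 else \<theta> (?n - 1))"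
  define hi where "hi = (if ?n = 0 then 1 else \<theta> 0 + 2 * pi)"
  have lo: "\<theta> i \<le> lo" if "i < ?n" for i
  proof -
    consider "i = ?n - 1" | "i < ?n - 1" using \<open>i < ?n\<close> by linarith
    then show ?thesis using ord[of i "?n - 1"] that by cases (auto simp: lo_def)
  qed
  have hi: "hi \<le> \<theta> i + 2 * pi" if "i < ?n" for i
    using ord[of 0 i] that by (cases "i = 0") (auto simp: hi_def)
  have lohi: "lo < hi" "hi \<le> lo + 2 * pi"
  proof -
    consider "?n = 0" | "?n = 1" | "0 < ?n - 1" by linarith
    then show "lo < hi" "hi \<le> lo + 2 * pi"
      using ord[of 0 "?n - 1"] pi_gt3 by (cases; auto simp: lo_def hi_def)+
  qed
  define \<alpha> \<beta> where "\<alpha> = lo + (hi - lo) / 3" and "\<beta> = lo + 2 * (hi - lo) / 3"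
  have \<alpha>\<beta>: "lo < \<alpha>" "\<alpha> < \<beta>" "\<beta> < hi" "\<beta> < \<alpha> + 2 * pi" using lohi by (auto simp: \<alpha>_def \<beta>_def field_simps)
  define \<theta>' where "\<theta>' i = (if i < ?n then \<theta> i else if i = ?n then \<alpha> else \<beta>)" for i
  define \<gamma>' where "\<gamma>' = \<gamma>(x := chart \<circ> petal r \<alpha> \<beta>)"
  have ord': "\<theta>' i < \<theta>' j \<and> \<theta>' j < \<theta>' i + 2 * pi" if "i < j" "j < length (u @ [x, x])" for i j
  proof -
    have "j < ?n \<or> i < ?n \<and> \<not> j < ?n \<or> i = ?n \<and> j = Suc ?n" using that by auto
    then consider "j < ?n" | "i < ?n" "\<not> j < ?n" | "i = ?n" "j = Suc ?n" by blast
    then show ?thesis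
      using that ord[of i j] lo[of i] hi[of i] \<alpha>\<beta> by cases (auto simp: \<theta>'_def)
  qed
  have simple: "simple_path (chart \<circ> petal r \<alpha> \<beta>)"
    unfolding simple_path_def loop_free_def path_def
  proof (intro conjI ballI impI)
    show "continuous_on {0..1} (chart \<circ> petal r \<alpha> \<beta>)"
      by (intro continuous_on_compose continuous_petal continuous_chart)
    fix t t' :: real assume t: "t \<in> {0..1}" "t' \<in> {0..1}" and eq: "(chart \<circ> petal r \<alpha> \<beta>) t = (chart \<circ> petal r \<alpha> \<beta>) t'"
    have "norm (petal r \<alpha> \<beta> u) < pi" if "u \<in> {0..1}" for u
      using petal_radius_bounds[of r u] that r by (simp add: petal_def)
    then have "petal r \<alpha> \<beta> t = petal r \<alpha> \<beta> t'" using eq t by (intro chart_inj) auto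
    then show "t = t' \<or> t = 0 \<and> t' = 1 \<or> t = 1 \<and> t' = 0"
      using petal_inj[OF r(1) \<alpha>\<beta>(2,4)] t by auto
  qed
  have petal_ends: "petal r \<alpha> \<beta> 0 = 0" "petal r \<alpha> \<beta> 1 = 0"
    by (auto simp: petal_def petal_radius_def)
  have disj: "z = (1, 1)" if y: "y \<in> set u" and z: "z \<in> path_image (\<gamma> y)" "z \<in> path_image (chart \<circ> petal r \<alpha> \<beta>)" for y z
  proof -
    obtain p q where pq: "p < ?n" "q < ?n" and rad: "radial_loop r (\<gamma> y) (\<theta> p) (\<theta> q)"
      using loops[OF y] by blast
    obtain s s' where s: "0 < s" "s < s'" "s' < 1"
      and out: "\<And>t. \<lbrakk>0 \<le> t; t \<le> s\<rbrakk> \<Longrightarrow> \<gamma> y t = chart (rcis (r * (t / s)) (\<theta> p))"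
      and ret: "\<And>t. \<lbrakk>s' \<le> t; t \<le> 1\<rbrakk> \<Longrightarrow> \<gamma> y t = chart (rcis (r * ((1 - t) / (1 - s'))) (\<theta> q))"
      and mid: "\<And>t. \<lbrakk>s < t; t < s'\<rbrakk> \<Longrightarrow> \<gamma> y t \<notin> chart ` cball 0 r"
      using rad unfolding radial_loop_def by blast
    obtain t where t: "0 \<le> t" "t \<le> 1" "z = chart (petal r \<alpha> \<beta> t)" using z(2) by (auto simp: path_image_def)
    have pr: "0 \<le> petal_radius r t" "petal_radius r t < r" using petal_radius_bounds r t by auto
    obtain \<tau> where \<tau>: "0 \<le> \<tau>" "\<tau> \<le> 1" "z = \<gamma> y \<tau>" using z(1) by (auto simp: path_image_def)
    have "z \<in> chart ` cball 0 r" using t pr by (auto simp: petal_def)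
    then consider "\<tau> \<le> s" | "s' \<le> \<tau>" using mid[of \<tau>] \<tau>(3) by force
    then obtain k f where k: "k < ?n" "0 \<le> f" "f \<le> 1" "z = chart (rcis (r * f) (\<theta> k))"
    proof cases
      case 1
      show ?thesis by (rule that[OF pq(1), of "\<tau> / s"]) (use 1 out[of \<tau>] \<tau> s in auto)
    next
      case 2
      show ?thesis by (rule that[OF pq(2), of "(1 - \<tau>) / (1 - s')"]) (use 2 ret[of \<tau>] \<tau> s in auto)
    qed
    have rf: "r * f \<le> r" "0 \<le> r * f" using k r by (auto simp: mult_left_le)
    then have rfp: "r * f < pi" using r by linarith
    have "petal r \<alpha> \<beta> t = rcis (r * f) (\<theta> k)"
      using k t pr r rfp by (intro chart_inj) (auto simp: petal_def)
    then have eq: "petal_radius r t = r * f" "0 < petal_radius r t \<Longrightarrow> cis (petal_angle \<alpha> \<beta> t) = cis (\<theta> k)"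
      using rcis_eqD[of "petal_radius r t" "petal_angle \<alpha> \<beta> t"] pr rf by (auto simp: petal_def)
    have "\<theta> k < petal_angle \<alpha> \<beta> t" "petal_angle \<alpha> \<beta> t < \<theta> k + 2 * pi"
      using petal_angle_bounds[OF \<alpha>\<beta>(2), of t] \<alpha>\<beta> lo[OF k(1)] hi[OF k(1)] by linarith+
    then have "cis (petal_angle \<alpha> \<beta> t) \<noteq> cis (\<theta> k)"
      using cis_eqD[of "petal_angle \<alpha> \<beta> t" "\<theta> k"] by auto
    then have "petal_radius r t = 0" using eq(2) pr by fastforce
    then show ?thesis using t by (simp add: petal_def chart_0)
  qed
  have base: "(1, 1) \<in> path_image (\<gamma> y)" if "y \<in> set u" for y
  proof -
    have "pathstart (\<gamma> y) = (1, 1)" using d that by (simp add: torus_drawing_def)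
    then show ?thesis using pathstart_in_path_image[of "\<gamma> y"] by simp
  qed
  have base': "(1, 1) \<in> path_image (chart \<circ> petal r \<alpha> \<beta>)"
  proof -
    have "pathstart (chart \<circ> petal r \<alpha> \<beta>) = (1, 1)" by (simp add: pathstart_def petal_ends chart_0)
    then show ?thesis using pathstart_in_path_image[of "chart \<circ> petal r \<alpha> \<beta>"] by simp
  qed
  have "torus_drawing (1, 1) \<gamma>' (set (u @ [x, x]))"
    unfolding torus_drawing_def
  proof (intro conjI ballI impI)
    fix y assume y: "y \<in> set (u @ [x, x])"
    have "y = x \<or> y \<in> set u \<and> y \<noteq> x" using y assms(2) by auto
    then show "simple_path (\<gamma>' y)" "path_image (\<gamma>' y) \<subseteq> torus" "pathstart (\<gamma>' y) = (1, 1)" "pathfinish (\<gamma>' y) = (1, 1)"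
      using d simple petal_ends chart_in_torus
      by (auto simp: \<gamma>'_def torus_drawing_def chart_0 path_image_def pathstart_def pathfinish_def)
  next
    fix y z assume y: "y \<in> set (u @ [x, x])" and z: "z \<in> set (u @ [x, x])" and "y \<noteq> z"
    then consider "y = x" "z \<in> set u" "z \<noteq> x" | "z = x" "y \<in> set u" "y \<noteq> x" | "y \<in> set u" "z \<in> set u" "y \<noteq> x" "z \<noteq> x"
      using assms(2) by auto
    then show "path_image (\<gamma>' y) \<inter> path_image (\<gamma>' z) = {(1, 1)}"
    proof cases
      case 1
      then show ?thesis using disj[of z] base[of z] base' by (auto simp: \<gamma>'_def)
    next
      case 2
      then show ?thesis using disj[of y] base[of y] base' by (auto simp: \<gamma>'_def)
    next
      case 3
      then show ?thesis using d \<open>y \<noteq> z\<close> by (simp add: \<gamma>'_def torus_drawing_def)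
    qed
  qed (rule base_point_in_torus)
  moreover have "\<exists>p q. p < length (u @ [x, x]) \<and> q < length (u @ [x, x]) \<and> p \<noteq> q \<and> (u @ [x, x]) ! p = y \<and> (u @ [x, x]) ! q = y \<and>
      radial_loop (r / 3) (\<gamma>' y) (\<theta>' p) (\<theta>' q)" if "y \<in> set (u @ [x, x])" for y
  proof (cases "y = x")
    case True
    show ?thesis
      by (rule exI[of _ ?n], rule exI[of _ "Suc ?n"])
         (use True petal_radial[OF r, of \<alpha> \<beta>] in \<open>auto simp: \<gamma>'_def \<theta>'_def nth_append\<close>)
  next
    case False
    then have "y \<in> set u" using that by auto
    then obtain p q where pq: "p < ?n" "q < ?n" "p \<noteq> q" "u ! p = y" "u ! q = y" and rad: "radial_loop r (\<gamma> y) (\<theta> p) (\<theta> q)"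
      using loops[of y] by blast
    have "radial_loop (r / 3) (\<gamma> y) (\<theta> p) (\<theta> q)"
      by (rule radial_loop_shrink[OF rad]) (use r in auto)
    then show ?thesis
      using pq False by (intro exI[of _ p] exI[of _ q]) (auto simp: \<gamma>'_def \<theta>'_def nth_append)
  qed
  ultimately show ?thesis
    unfolding radially_realizable_def using r ord'
    by (intro exI[of _ \<gamma>'] exI[of _ "r / 3"] exI[of _ \<theta>']) auto
qed

section \<open>Three bands of parallel loops\<close>

definition tent :: "real \<Rightarrow> real" where
  "tent t = min t (1 - t)"

text \<open>In the plane of the torus with period one, the bands go from the origin to \<open>1\<close>, \<open>1 + \<i>\<close> and \<open>\<i>\<close>;
  these three segments and their translates triangulate the plane. The loops of a band are broken
  lines, at distinct heights \<open>h\<close> over the segment.\<close>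

definition band_dir :: "nat \<Rightarrow> complex" where
  "band_dir k = (if k = 0 then 1 else if k = 1 then Complex 1 1 else \<i>)"

text \<open>For the diagonal band this is transverse but not orthogonal: an axis direction is taken
  so that one coordinate of \<open>strand k h t\<close> is exactly \<open>t\<close>.\<close>

definition band_normal :: "nat \<Rightarrow> complex" where
  "band_normal k = (if k = 0 then \<i> else 1)"

definition strand :: "nat \<Rightarrow> real \<Rightarrow> real \<Rightarrow> complex" where
  "strand k h t = t *\<^sub>R band_dir k + (h * tent t) *\<^sub>R band_normal k"

definition strand_loop :: "nat \<Rightarrow> real \<Rightarrow> real \<Rightarrow> complex \<times> complex" where
  "strand_loop k h t = chart ((2 * pi) *\<^sub>R strand k h t)"

text \<open>On the unit interval \<open>tent t\<close> is the distance from \<open>t\<close> to the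
  nearest integer.\<close>

lemma tent_le_dist: "0 \<le> t \<Longrightarrow> t \<le> 1 \<Longrightarrow> tent t \<le> \<bar>t - of_int m\<bar>"
  by (cases "m \<le> 0") (auto simp: tent_def)

lemma tent_bounds: "0 \<le> t \<Longrightarrow> t \<le> 1 \<Longrightarrow> 0 \<le> tent t \<and> tent t \<le> 1 / 2"
  by (auto simp: tent_def min_def)

lemma tent_eq_0_iff: "0 \<le> t \<Longrightarrow> t \<le> 1 \<Longrightarrow> tent t = 0 \<longleftrightarrow> t = 0 \<or> t = 1"
  by (auto simp: tent_def min_def)

lemma chart_scaled_eq_iff:
  "chart ((2 * pi) *\<^sub>R z) = chart ((2 * pi) *\<^sub>R z') \<longleftrightarrow>
     (\<exists>(m :: int) (n :: int). Re z - Re z' = m \<and> Im z - Im z' = n)"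
  by (simp add: torus_chart_eq_iff[OF base_point_in_torus] lattice_point_def complex_eq_iff flip: right_diff_distrib)

lemma Re_strand: "Re (strand k h t) = (if k = 0 then t else if k = 1 then t + h * tent t else h * tent t)"
  and Im_strand: "Im (strand k h t) = (if k = 0 then h * tent t else t)"
  by (auto simp: strand_def band_dir_def band_normal_def)

lemma continuous_strand_loop: "continuous_on A (strand_loop k h)"
  unfolding strand_loop_def strand_def tent_def
  by (intro continuous_on_compose2[OF continuous_chart] continuous_intros) auto

lemma strand_loop_ends: "strand_loop k h 0 = (1, 1)" "strand_loop k h 1 = (1, 1)"
proof -
  have "strand_loop k h t = (1, 1)" if "t = 0 \<or> t = 1" for t
  proof -
    have "tent t = 0" using that by (auto simp: tent_def)
    then have "chart ((2 * pi) *\<^sub>R strand k h t) = chart ((2 * pi) *\<^sub>R 0)"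
      unfolding chart_scaled_eq_iff
      by (intro exI[of _ "\<lfloor>Re (strand k h t)\<rfloor>"] exI[of _ "\<lfloor>Im (strand k h t)\<rfloor>"])
         (use that in \<open>auto simp: Re_strand Im_strand\<close>)
    then show ?thesis by (simp add: strand_loop_def chart_0)
  qed
  then show "strand_loop k h 0 = (1, 1)" "strand_loop k h 1 = (1, 1)" by auto
qed

text \<open>In one band, equal points have times equal modulo one, hence equal tents, and then
  different heights force the tent to vanish. In two different bands, integrality of both coordinate
  differences bounds each tent by a displacement or a sum of displacements; a displacement is at
  most a quarter of its tent, so both tents vanish.\<close>

lemma strand_loops_meet:
  assumes h: "0 < h" "h \<le> 1 / 4" "0 < h'" "h' \<le> 1 / 4"
    and k: "k \<le> 2" "k' \<le> 2" and t: "0 \<le> t" "t \<le> 1" "0 \<le> t'" "t' \<le> 1"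
    and eq: "strand_loop k h t = strand_loop k' h' t'" and ne: "k \<noteq> k' \<or> h \<noteq> h'"
  shows "tent t = 0"
proof -
  obtain m n :: int where m: "Re (strand k h t) - Re (strand k' h' t') = m"
    and n: "Im (strand k h t) - Im (strand k' h' t') = n"
    using eq unfolding strand_loop_def chart_scaled_eq_iff by blast
  define d d' where "d = h * tent t" and "d' = h' * tent t'"
  have T: "0 \<le> tent t" "tent t \<le> 1 / 2" "0 \<le> tent t'" "tent t' \<le> 1 / 2"
    using tent_bounds t by auto
  have d: "0 \<le> d" "d \<le> tent t / 4" "0 \<le> d'" "d' \<le> tent t' / 4"
    using h T mult_right_mono[of h "1/4" "tent t"] mult_right_mono[of h' "1/4" "tent t'"]
    by (auto simp: d_def d'_def)
  note dist = tent_le_dist[OF t(1,2)] tent_le_dist[OF t(3,4)]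
  have d0: "tent t = 0" if "d = d'" "tent t = tent t'" "h \<noteq> h'"
    using that by (auto simp: d_def d'_def)
  have same: "tent t = tent t'" if "t - t' = of_int j" for j
  proof -
    have "tent t' \<le> tent t \<and> tent t \<le> tent t'"
    proof -
      have "\<bar>real_of_int j\<bar> \<le> 1" using that t by auto
      then have "j = -1 \<or> j = 0 \<or> j = 1" by linarith
      then show ?thesis using that t by (auto simp: tent_def)
    qed
    then show ?thesis by simp
  qed
  have small: "j = 0" if "d - d' = of_int j" for j
  proof -
    have "\<bar>real_of_int j\<bar> < 1" using that d T by linarith
    then show ?thesis by linarith
  qed
  have "k = 0 \<or> k = 1 \<or> k = 2" "k' = 0 \<or> k' = 1 \<or> k' = 2" using k by linarith+
  then consider "k = 0" "k' = 0" | "k = 0" "k' = 1" | "k = 0" "k' = 2" | "k = 1" "k' = 0" | "k = 1" "k' = 1" | "k = 1" "k' = 2"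
    | "k = 2" "k' = 0" | "k = 2" "k' = 1" | "k = 2" "k' = 2" by blast
  then show ?thesis
  proof cases
    case 1
    then have "t - t' = of_int m" "d - d' = of_int n" using m n by (auto simp: Re_strand Im_strand d_def d'_def)
    then show ?thesis using same small d0 ne 1 by auto
  next
    case 2
    then have "t - t' - d' = of_int m" "d - t' = of_int n" using m n by (auto simp: Re_strand Im_strand d_def d'_def)
    then show ?thesis using dist(2)[of "- n"] dist(1)[of "m - n"] d T by auto
  next
    case 3
    then have "t - d' = of_int m" "d - t' = of_int n" using m n by (auto simp: Re_strand Im_strand d_def d'_def)
    then show ?thesis using dist(2)[of "- n"] dist(1)[of m] d T by auto
  next
    case 4
    then have "t + d - t' = of_int m" "t - d' = of_int n" using m n by (auto simp: Re_strand Im_strand d_def d'_def)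
    then show ?thesis using dist(1)[of n] dist(2)[of "n - m"] d T by auto
  next
    case 5
    then have 1: "t + d - (t' + d') = of_int m" "t - t' = of_int n" using m n by (auto simp: Re_strand Im_strand d_def d'_def)
    then have "d - d' = of_int (m - n)" by simp
    then show ?thesis using same[OF 1(2)] small[of "m - n"] d0 ne 5 by auto
  next
    case 6
    then have "t + d - d' = of_int m" "t - t' = of_int n" using m n by (auto simp: Re_strand Im_strand d_def d'_def)
    then show ?thesis using dist(1)[of m] dist(2)[of "m - n"] d T by auto
  next
    case 7
    then have "d - t' = of_int m" "t - d' = of_int n" using m n by (auto simp: Re_strand Im_strand d_def d'_def)
    then show ?thesis using dist(2)[of "- m"] dist(1)[of n] d T by auto
  next
    case 8
    then have "d - t' - d' = of_int m" "t - t' = of_int n" using m n by (auto simp: Re_strand Im_strand d_def d'_def)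
    then show ?thesis using dist(2)[of "- m"] dist(1)[of "n - m"] d T by auto
  next
    case 9
    then have "t - t' = of_int n" "d - d' = of_int m" using m n by (auto simp: Re_strand Im_strand d_def d'_def)
    then show ?thesis using same small d0 ne 9 by auto
  qed
qed

text \<open>One coordinate of a strand is the time itself, so equal points have times differing by
  an integer.\<close>

lemma simple_path_strand_loop:
  assumes "0 < h" "h \<le> 1 / 4" "k \<le> 2"
  shows "simple_path (strand_loop k h)"
  unfolding simple_path_def loop_free_def path_def
proof (intro conjI ballI impI continuous_strand_loop)
  fix t t' :: real assume t: "t \<in> {0..1}" "t' \<in> {0..1}" and eq: "strand_loop k h t = strand_loop k h t'"
  then obtain m n :: int where m: "Re (strand k h t) - Re (strand k h t') = m"
    and n: "Im (strand k h t) - Im (strand k h t') = n"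
    unfolding strand_loop_def chart_scaled_eq_iff by blast
  then obtain j :: int where j: "t - t' = j"
    by (cases "k = 0") (auto simp: Re_strand Im_strand)
  then have "\<bar>real_of_int j\<bar> \<le> 1" using t by auto
  then have "j = -1 \<or> j = 0 \<or> j = 1" by linarith
  then show "t = t' \<or> t = 0 \<and> t' = 1 \<or> t = 1 \<and> t' = 0" using j t by auto
qed

text \<open>For \<open>k \<le> 2\<close> the index \<open>k\<close> gives an argument of the
  outgoing direction \<open>band_dir k + h *\<^sub>R band_normal k\<close>, and \<open>k + 3\<close>
  that of the returning end \<open>- band_dir k + h *\<^sub>R band_normal k\<close> seen from the
  vertex.\<close>

definition band_angle :: "nat \<Rightarrow> real \<Rightarrow> real" where
  "band_angle b h = (if b = 0 then arctan h else if b = 1 then arctan (1 / (1 + h)) else if b = 2 then pi / 2 - arctan h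
     else if b = 3 then pi - arctan h else if b = 4 then pi + arctan (1 / (1 - h)) else 3 * pi / 2 + arctan h)"

lemma arctan_polar: "of_real (sqrt (1 + x\<^sup>2)) * cis (arctan x) = Complex 1 x"
proof -
  have "1 + x\<^sup>2 > 0" by (simp add: add_pos_nonneg)
  then show ?thesis by (simp add: complex_eq_iff cos_arctan sin_arctan)
qed

lemma rcis_norm_eqI:
  assumes "z = of_real c * cis \<phi>" "0 < c"
  shows "rcis (norm z) \<phi> = z"
  using assms by (simp add: rcis_def norm_mult)

lemma band_angle_out:
  assumes "0 < h" "h \<le> 1 / 4" "k \<le> 2" "z = band_dir k + h *\<^sub>R band_normal k"
  shows "rcis (norm z) (band_angle k h) = z"
proof -
  let ?c = "\<lambda>x :: real. sqrt (1 + x\<^sup>2)"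
  have c: "0 < ?c x" for x by (simp add: add_pos_nonneg)
  have polar: "?c x * cos (arctan x) = 1" "?c x * sin (arctan x) = x" for x
    using arctan_polar[of x] by (simp_all add: complex_eq_iff)
  consider "k = 0" | "k = 1" | "k = 2" using assms(3) by linarith
  then show ?thesis
  proof cases
    case 1
    show ?thesis
      by (rule rcis_norm_eqI[of _ "?c h"])
        (use 1 assms(4) c polar[of h] in \<open>auto simp: band_angle_def band_dir_def band_normal_def complex_eq_iff\<close>)
  next
    case 2
    let ?x = "1 / (1 + h)"
    have "z = of_real ((1 + h) * ?c ?x) * cis (arctan ?x)"
      using 2 assms polar[of ?x]
      by (auto simp: band_dir_def band_normal_def complex_eq_iff mult.assoc)
    then show ?thesis
      by (intro rcis_norm_eqI[of _ "(1 + h) * ?c ?x"]) (use 2 assms c[of ?x] in \<open>auto simp: band_angle_def\<close>)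
  next
    case 3
    show ?thesis
      by (rule rcis_norm_eqI[of _ "?c h"])
        (use 3 assms(4) c polar[of h] in \<open>auto simp: band_angle_def band_dir_def band_normal_def complex_eq_iff cos_diff sin_diff\<close>)
  qed
qed

lemma band_angle_in:
  assumes "0 < h" "h \<le> 1 / 4" "k \<le> 2" "z = - band_dir k + h *\<^sub>R band_normal k"
  shows "rcis (norm z) (band_angle (k + 3) h) = z"
proof -
  let ?c = "\<lambda>x :: real. sqrt (1 + x\<^sup>2)"
  have c: "0 < ?c x" for x by (simp add: add_pos_nonneg)
  have polar: "?c x * cos (arctan x) = 1" "?c x * sin (arctan x) = x" for x
    using arctan_polar[of x] by (simp_all add: complex_eq_iff)
  have cos32: "cos (3 * pi / 2) = 0" "sin (3 * pi / 2) = -1"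
    using cos_add[of pi "pi / 2"] sin_add[of pi "pi / 2"] by (simp_all add: field_simps)
  consider "k = 0" | "k = 1" | "k = 2" using assms(3) by linarith
  then show ?thesis
  proof cases
    case 1
    show ?thesis
      by (rule rcis_norm_eqI[of _ "?c h"])
        (use 1 assms(4) c polar[of h] in \<open>auto simp: band_angle_def band_dir_def band_normal_def complex_eq_iff\<close>)
  next
    case 2
    let ?x = "1 / (1 - h)"
    have "z = of_real ((1 - h) * ?c ?x) * cis (pi + arctan ?x)"
      using 2 assms polar[of ?x]
      by (auto simp: band_dir_def band_normal_def complex_eq_iff mult.assoc cos_add sin_add)
    then show ?thesis
      by (intro rcis_norm_eqI[of _ "(1 - h) * ?c ?x"]) (use 2 assms c[of ?x] in \<open>auto simp: band_angle_def\<close>)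
  next
    case 3
    show ?thesis
      by (rule rcis_norm_eqI[of _ "?c h"])
        (use 3 assms(4) c polar[of h] cos32 in \<open>auto simp: band_angle_def band_dir_def band_normal_def complex_eq_iff cos_add sin_add\<close>)
  qed
qed

lemma norm_band_ge:
  assumes "0 < h" "h \<le> 1 / 4"
  shows "1 \<le> norm (band_dir k + h *\<^sub>R band_normal k)" "norm (band_dir k + h *\<^sub>R band_normal k) \<le> 9 / 4"
    "1 \<le> norm (- band_dir k + h *\<^sub>R band_normal k)" "norm (- band_dir k + h *\<^sub>R band_normal k) \<le> 9 / 4"
proof -
  have 1: "1 \<le> \<bar>Re z\<bar> \<or> 1 \<le> \<bar>Im z\<bar> \<Longrightarrow> 1 \<le> norm z" for z
    using abs_Re_le_cmod[of z] abs_Im_le_cmod[of z] by linarith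
  show "1 \<le> norm (band_dir k + h *\<^sub>R band_normal k)" "1 \<le> norm (- band_dir k + h *\<^sub>R band_normal k)"
    by (rule 1; simp add: band_dir_def band_normal_def)+
  have "norm (band_dir k) \<le> 2" "norm (h *\<^sub>R band_normal k) \<le> 1 / 4"
    using cmod_le[of "Complex 1 1"] assms by (auto simp: band_dir_def band_normal_def)
  then show "norm (band_dir k + h *\<^sub>R band_normal k) \<le> 9 / 4" "norm (- band_dir k + h *\<^sub>R band_normal k) \<le> 9 / 4"
    using norm_triangle_ineq[of "band_dir k" "h *\<^sub>R band_normal k"]
      norm_triangle_ineq[of "- band_dir k" "h *\<^sub>R band_normal k"] by auto
qed

text \<open>The first and last eighths of a strand are straight. In the plane of period one the
  circle has radius \<open>1 / 8\<close>, and the end directions have length between one and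
  \<open>9 / 4\<close>: the circle is crossed during these eighths, which stay where the chart is
  injective. In between, one coordinate is more than \<open>1 / 8\<close> away from every
  integer.\<close>

lemma radial_strand_loop:
  assumes h: "0 < h" "h \<le> 1 / 4" and k: "k \<le> 2"
  shows "radial_loop (pi / 4) (strand_loop k h) (band_angle k h) (band_angle (k + 3) h)"
proof -
  define u u' where "u = band_dir k + h *\<^sub>R band_normal k" and "u' = - band_dir k + h *\<^sub>R band_normal k"
  have u: "1 \<le> norm u" "norm u \<le> 9 / 4" "1 \<le> norm u'" "norm u' \<le> 9 / 4"
    using norm_band_ge[OF h, of k] by (auto simp: u_def u'_def)
  have polar: "rcis (norm u) (band_angle k h) = u" "rcis (norm u') (band_angle (k + 3) h) = u'"
    using band_angle_out[OF h k] band_angle_in[OF h k] by (auto simp: u_def u'_def)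
  have scale: "rcis (c * norm z) \<phi> = c *\<^sub>R z" if "rcis (norm z) \<phi> = z" for c z \<phi>
    using that by (simp add: rcis_def scaleR_conv_of_real mult.assoc)
  have out: "strand_loop k h t = chart ((2 * pi * t) *\<^sub>R u)" if "0 \<le> t" "t \<le> 1 / 8" for t
  proof -
    have "tent t = t" using that by (simp add: tent_def)
    then have "strand k h t = t *\<^sub>R u" by (simp add: strand_def u_def algebra_simps)
    then show ?thesis by (simp add: strand_loop_def)
  qed
  have ret: "strand_loop k h t = chart ((2 * pi * (1 - t)) *\<^sub>R u')" if "7 / 8 \<le> t" "t \<le> 1" for t
  proof -
    have "tent t = 1 - t" using that by (simp add: tent_def)
    then have "strand k h t - (1 - t) *\<^sub>R u' = band_dir k"
      unfolding strand_def u'_def by (simp only: \<open>tent t = 1 - t\<close>) (simp add: algebra_simps)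
    moreover have "\<exists>(m::int) (n::int). Re (band_dir k) = m \<and> Im (band_dir k) = n"
      by (intro exI[of _ "\<lfloor>Re (band_dir k)\<rfloor>"] exI[of _ "\<lfloor>Im (band_dir k)\<rfloor>"]) (auto simp: band_dir_def)
    ultimately have "chart ((2 * pi) *\<^sub>R strand k h t) = chart ((2 * pi) *\<^sub>R ((1 - t) *\<^sub>R u'))"
      unfolding chart_scaled_eq_iff by (metis minus_complex.sel)
    then show ?thesis by (simp add: strand_loop_def)
  qed
  have far: "chart (c *\<^sub>R z) \<notin> chart ` cball 0 (pi / 4)"
    if "pi / 4 < c * norm z" "0 \<le> c" "c \<le> pi / 4" "norm z \<le> 9 / 4" for c z
  proof -
    have "c * norm z \<le> pi / 4 * (9 / 4)" using that by (intro mult_mono) auto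
    then have "norm (c *\<^sub>R z) < pi" using that pi_gt_zero by simp
    then show ?thesis using that by (subst chart_in_image_iff) auto
  qed
  show ?thesis unfolding radial_loop_def
  \<comment> \<open>At this time \<open>2 * pi * t * norm u\<close> reaches
    \<open>pi / 4\<close>.\<close>
  proof (rule exI[of _ "1 / (8 * norm u)"], rule exI[of _ "1 - 1 / (8 * norm u')"], intro conjI allI impI)
    have b: "0 < 1 / (8 * norm u)" "1 / (8 * norm u) \<le> 1 / 8" "0 < 1 / (8 * norm u')" "1 / (8 * norm u') \<le> 1 / 8"
    proof -
      have "0 < 1 / (8 * c) \<and> 1 / (8 * c) \<le> 1 / 8" if "1 \<le> c" for c :: real
        using that by (simp add: pos_divide_le_eq)
      then show "0 < 1 / (8 * norm u)" "1 / (8 * norm u) \<le> 1 / 8" "0 < 1 / (8 * norm u')" "1 / (8 * norm u') \<le> 1 / 8"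
        using u by blast+
    qed
    then show "0 < 1 / (8 * norm u)" "1 / (8 * norm u) < 1 - 1 / (8 * norm u')" "1 - 1 / (8 * norm u') < 1" by linarith+
    {
      fix t assume t: "0 \<le> t \<and> t \<le> 1 / (8 * norm u)"
      have "t \<le> 1 / 8" using t b by linarith
      with t have "strand_loop k h t = chart ((2 * pi * t) *\<^sub>R u)" using out by blast
      also have "(2 * pi * t) *\<^sub>R u = rcis (2 * pi * t * norm u) (band_angle k h)"
        using scale[OF polar(1)] by simp
      also have "2 * pi * t * norm u = pi / 4 * (t / (1 / (8 * norm u)))" by simp
      finally show "strand_loop k h t = chart (rcis (pi / 4 * (t / (1 / (8 * norm u)))) (band_angle k h))" .
    next
      fix t assume t: "1 - 1 / (8 * norm u') \<le> t \<and> t \<le> 1"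
      have "7 / 8 \<le> t" using t b by linarith
      with t have "strand_loop k h t = chart ((2 * pi * (1 - t)) *\<^sub>R u')" using ret by blast
      also have "(2 * pi * (1 - t)) *\<^sub>R u' = rcis (2 * pi * (1 - t) * norm u') (band_angle (k + 3) h)"
        using scale[OF polar(2)] by simp
      also have "2 * pi * (1 - t) * norm u' = pi / 4 * ((1 - t) / (1 - (1 - 1 / (8 * norm u'))))" by simp
      finally show "strand_loop k h t =
        chart (rcis (pi / 4 * ((1 - t) / (1 - (1 - 1 / (8 * norm u'))))) (band_angle (k + 3) h))" .
    next
      fix t assume t: "1 / (8 * norm u) < t \<and> t < 1 - 1 / (8 * norm u')"
      have t01: "0 \<le> t" "t \<le> 1" using t b by linarith+
      have "t \<le> 1 / 8 \<or> 7 / 8 \<le> t \<or> 1 / 8 < tent t" by (auto simp: tent_def)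
      then consider "t \<le> 1 / 8" | "7 / 8 \<le> t" | "1 / 8 < tent t" by blast
      then show "strand_loop k h t \<notin> chart ` cball 0 (pi / 4)"
      proof cases
        case 1
        have "1 < 8 * norm u * t"
        proof -
          have "1 / (8 * norm u) < t" using t by linarith
          moreover have "0 < 8 * norm u" using u by linarith
          ultimately show ?thesis by (simp add: pos_divide_less_eq mult.commute)
        qed
        then have "pi / 4 * 1 < pi / 4 * (8 * norm u * t)" by (intro mult_strict_left_mono) auto
        then have "pi / 4 < 2 * pi * t * norm u" by (simp add: mult_ac)
        then show ?thesis using out[OF t01(1) 1] far[of "2 * pi * t" u] 1 t01 u by simp
      next
        case 2
        have "1 < 8 * norm u' * (1 - t)"
        proof -
          have "1 / (8 * norm u') < 1 - t" using t by linarith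
          moreover have "0 < 8 * norm u'" using u by linarith
          ultimately show ?thesis by (simp add: pos_divide_less_eq mult.commute)
        qed
        then have "pi / 4 * 1 < pi / 4 * (8 * norm u' * (1 - t))" by (intro mult_strict_left_mono) auto
        then have "pi / 4 < 2 * pi * (1 - t) * norm u'" by (simp add: mult_ac)
        then show ?thesis using ret[OF 2 t01(2)] far[of "2 * pi * (1 - t)" u'] 2 t01 u by simp
      next
        case 3
        show ?thesis
        proof
          assume "strand_loop k h t \<in> chart ` cball 0 (pi / 4)"
          then obtain z where z: "norm z \<le> pi / 4" "strand_loop k h t = chart z" by auto
          define y where "y = (1 / (2 * pi)) *\<^sub>R z"
          have "strand_loop k h t = chart ((2 * pi) *\<^sub>R y)" using z by (simp add: y_def)
          then obtain m n :: int where m: "Re (strand k h t) - Re y = m" and n: "Im (strand k h t) - Im y = n"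
            unfolding strand_loop_def chart_scaled_eq_iff by blast
          have "norm y \<le> 1 / 8" using z(1) by (simp add: y_def field_simps)
          then have y: "\<bar>Re y\<bar> \<le> 1 / 8" "\<bar>Im y\<bar> \<le> 1 / 8"
            using abs_Re_le_cmod[of y] abs_Im_le_cmod[of y] by linarith+
          have "\<bar>t - of_int m\<bar> \<le> 1 / 8 \<or> \<bar>t - of_int n\<bar> \<le> 1 / 8"
          proof (cases "k = 0")
            case True
            then have "t - of_int m = Re y" using m by (simp add: Re_strand)
            then show ?thesis using y by simp
          next
            case False
            then have "t - of_int n = Im y" using n by (simp add: Im_strand)
            then show ?thesis using y by simp
          qed
          then show False using tent_le_dist[OF t01, of m] tent_le_dist[OF t01, of n] 3 by linarith
        qed
      qed
    }
  qed
qed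

text \<open>Rays separating the six groups of ends. The slope \<open>1 / 3\<close> lies between the
  outgoing slopes of band 0, at most \<open>1 / 4\<close>, and those of band 1, at least
  \<open>4 / 5\<close>; the other rays are the diagonal and the half-axes.\<close>

definition band_bound :: "nat \<Rightarrow> real" where
  "band_bound b = [0, arctan (1 / 3), pi / 4, pi / 2, pi, 3 * pi / 2, 2 * pi] ! b"

lemma band_angle_bounds:
  assumes "0 < h" "h \<le> 1 / 4" "b < 6"
  shows "band_bound b < band_angle b h" "band_angle b h < band_bound (Suc b)"
proof -
  have a: "0 < arctan h" "arctan h < arctan (1 / 3)" "arctan h < pi / 4" "arctan h < pi / 2"
    using assms arctan_ubound[of h] arctan_monotone[of 0 h] arctan_monotone[of h "1/3"] arctan_monotone[of h 1] arctan_one by auto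
  have b: "arctan (1 / 3) < arctan (1 / (1 + h))" "arctan (1 / (1 + h)) < pi / 4"
    using assms arctan_monotone[of "1/3" "1 / (1 + h)"] arctan_monotone[of "1 / (1 + h)" 1] arctan_one
    by (auto simp: field_simps)
  have c: "0 < arctan (1 / (1 - h))" "arctan (1 / (1 - h)) < pi / 2"
    using assms arctan_monotone[of 0 "1 / (1 - h)"] arctan_ubound by auto
  have bounds: "band_bound 0 = 0" "band_bound 1 = arctan (1 / 3)" "band_bound 2 = pi / 4" "band_bound 3 = pi / 2"
    "band_bound 4 = pi" "band_bound 5 = 3 * pi / 2" "band_bound 6 = 2 * pi"
    by (simp_all add: band_bound_def)
  have angles: "band_angle 0 h = arctan h" "band_angle 1 h = arctan (1 / (1 + h))" "band_angle 2 h = pi / 2 - arctan h"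
    "band_angle 3 h = pi - arctan h" "band_angle 4 h = pi + arctan (1 / (1 - h))" "band_angle 5 h = 3 * pi / 2 + arctan h"
    by (simp_all add: band_angle_def)
  have all: "band_bound 0 < band_angle 0 h \<and> band_angle 0 h < band_bound 1"
    "band_bound 1 < band_angle 1 h \<and> band_angle 1 h < band_bound 2"
    "band_bound 2 < band_angle 2 h \<and> band_angle 2 h < band_bound 3"
    "band_bound 3 < band_angle 3 h \<and> band_angle 3 h < band_bound 4"
    "band_bound 4 < band_angle 4 h \<and> band_angle 4 h < band_bound 5"
    "band_bound 5 < band_angle 5 h \<and> band_angle 5 h < band_bound 6"
    unfolding bounds angles using a b c by linarith+
  have "b = 0 \<or> b = 1 \<or> b = 2 \<or> b = 3 \<or> b = 4 \<or> b = 5" using assms(3) by linarith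
  then have "band_bound b < band_angle b h \<and> band_angle b h < band_bound (Suc b)"
  proof -
    have "Suc 0 = 1" "Suc 1 = 2" "Suc 2 = 3" "Suc 3 = 4" "Suc 4 = 5" "Suc 5 = 6" by simp_all
    moreover assume "b = 0 \<or> b = 1 \<or> b = 2 \<or> b = 3 \<or> b = 4 \<or> b = 5"
    ultimately show ?thesis using all by (elim disjE) (simp_all only: simp_thms)
  qed
  then show "band_bound b < band_angle b h" "band_angle b h < band_bound (Suc b)" by auto
qed

lemma band_bound_mono:
  assumes "b \<le> c" "c \<le> 6"
  shows "band_bound b \<le> band_bound c"
proof -
  \<comment> \<open>Each sector is nonempty, as it contains the end of height
    \<open>1 / 4\<close>.\<close>
  have step: "band_bound b \<le> band_bound (Suc b)" if "b < 6" for b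
    using band_angle_bounds[of "1/4" b] that by simp
  show ?thesis using assms
  proof (induction c)
    case (Suc c)
    then show ?case using step[of c] by (cases "b = Suc c") auto
  qed simp
qed

text \<open>The indices \<open>b\<close> and \<open>b + 3\<close> always fall into different cases:
  the two ends of a band list its strands in opposite orders. This is why the second half of the
  word consists of reversed blocks.\<close>

lemma band_angle_mono:
  assumes "0 < h" "h < h'" "h' \<le> 1 / 4"
  shows "b \<in> {0, 4, 5} \<Longrightarrow> band_angle b h < band_angle b h'"
    "b \<in> {1, 2, 3} \<Longrightarrow> band_angle b h' < band_angle b h"
proof -
  have "arctan h < arctan h'" "arctan (1 / (1 + h')) < arctan (1 / (1 + h))" "arctan (1 / (1 - h)) < arctan (1 / (1 - h'))"
    using assms by (intro arctan_monotone; simp add: field_simps)+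
  then show "b \<in> {0, 4, 5} \<Longrightarrow> band_angle b h < band_angle b h'"
    "b \<in> {1, 2, 3} \<Longrightarrow> band_angle b h' < band_angle b h"
    by (auto simp: band_angle_def)
qed

text \<open>Loop \<open>j\<close> of the word \<open>A @ B @ C @ rev A @ rev B @ rev C\<close> has its ends at the positions \<open>j\<close> and
  \<open>m + mate j\<close>, where \<open>p\<close>, \<open>q\<close> and \<open>m\<close> are the lengths of \<open>A\<close>, \<open>B\<close> and \<open>A @ B @ C\<close>.\<close>

locale band_word =
  fixes p q m :: nat
  assumes m: "p + q \<le> m"
begin

definition band :: "nat \<Rightarrow> nat" where
  "band j = (if j < p then 0 else if j < p + q then 1 else 2)"

text \<open>With growing height the outgoing ends turn counterclockwise in band 0 and clockwise in
  the other two, so heights increase along \<open>A\<close> and decrease along \<open>B\<close> and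
  \<open>C\<close>. The denominator keeps them at most \<open>1 / 4\<close>.\<close>

definition height :: "nat \<Rightarrow> real" where
  "height j = (if j < p then real (j + 1) else real (m - j)) / (4 * (m + 1))"

text \<open>Reflection of a position inside its own block, hence an involution.\<close>

definition mate :: "nat \<Rightarrow> nat" where
  "mate j = (if j < p then p - 1 - j else if j < p + q then 2 * p + q - 1 - j else m + p + q - 1 - j)"

definition block :: "nat \<Rightarrow> nat" where
  "block i = (if i < m then band i else 3 + band (mate (i - m)))"

definition loop_of :: "nat \<Rightarrow> nat" where
  "loop_of i = (if i < m then i else mate (i - m))"

definition end_angle :: "nat \<Rightarrow> real" where
  "end_angle i = band_angle (block i) (height (loop_of i))"

lemma band_le: "band j \<le> 2"
  by (simp add: band_def)

lemma mate: "j < m \<Longrightarrow> mate j < m" "j < m \<Longrightarrow> mate (mate j) = j" "j < m \<Longrightarrow> band (mate j) = band j"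
  using m by (auto simp: mate_def band_def)

lemma height_bounds: "j < m \<Longrightarrow> 0 < height j \<and> height j \<le> 1 / 4"
  by (auto simp: height_def field_simps)

lemma height_inj: "\<lbrakk>i < m; j < m; band i = band j; height i = height j\<rbrakk> \<Longrightarrow> i = j"
  by (auto simp: height_def band_def split: if_splits)

lemma block_le: "Suc (block i) \<le> 6"
  using band_le[of i] band_le[of "mate (i - m)"] by (simp add: block_def)

lemma end_angle_bounds:
  assumes "i < 2 * m"
  shows "band_bound (block i) < end_angle i" "end_angle i < band_bound (Suc (block i))"
proof -
  have "loop_of i < m" using assms mate by (auto simp: loop_of_def)
  moreover have "block i < 6" using block_le[of i] by linarith
  ultimately show "band_bound (block i) < end_angle i" "end_angle i < band_bound (Suc (block i))"
    using band_angle_bounds height_bounds unfolding end_angle_def by blast+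
qed

lemma block_mono: "i < j \<Longrightarrow> j < 2 * m \<Longrightarrow> block i \<le> block j"
  using m mate(3)[of "i - m"] mate(3)[of "j - m"] band_le[of i] by (auto simp: block_def) (auto simp: band_def)

text \<open>Ends of different blocks are separated by a ray of \<open>band_bound\<close>. Within a
  block, heights are monotone in the position, in the sense that \<open>band_angle_mono\<close>
  turns into growing angles.\<close>

lemma end_angle_strict_mono:
  assumes "i < j" "j < 2 * m"
  shows "end_angle i < end_angle j"
proof (cases "block i = block j")
  case False
  then have "Suc (block i) \<le> block j" using block_mono[OF assms] by simp
  then have "band_bound (Suc (block i)) \<le> band_bound (block j)"
    using block_le[of j] by (intro band_bound_mono) auto
  then show ?thesis
    using end_angle_bounds[of i] end_angle_bounds[of j] assms by linarith
next
  case True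
  have lm: "loop_of i < m" "loop_of j < m" using assms mate by (auto simp: loop_of_def)
  note hb = height_bounds[OF lm(1)] height_bounds[OF lm(2)]
  have "i < m \<longleftrightarrow> j < m"
    using True band_le[of i] band_le[of j] by (auto simp: block_def split: if_splits)
  have h: "if block i \<in> {0, 4, 5} then height (loop_of i) < height (loop_of j) else height (loop_of j) < height (loop_of i)"
  proof (cases "i < m")
    case T: True
    then have ij: "j < m" "band i = band j" using True \<open>i < m \<longleftrightarrow> j < m\<close> by (auto simp: block_def)
    have "block i = band i" "loop_of i = i" "loop_of j = j" using T ij by (auto simp: block_def loop_of_def)
    moreover have "band i \<in> {0, 4, 5} \<longleftrightarrow> i < p" "i < p \<longleftrightarrow> j < p" using ij by (auto simp: band_def split: if_splits)
    ultimately show ?thesis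
      using T ij assms by (auto simp: height_def intro!: divide_strict_right_mono)
  next
    case F: False
    define i' j' where "i' = i - m" and "j' = j - m"
    have ij: "\<not> j < m" "i' < j'" "j' < m" "i' < m"
      using F \<open>i < m \<longleftrightarrow> j < m\<close> assms by (auto simp: i'_def j'_def)
    have b: "band i' = band j'" using True F mate(3) ij by (simp add: block_def i'_def j'_def)
    have "block i = 3 + band i'" "loop_of i = mate i'" "loop_of j = mate j'"
      using F ij mate(3) by (auto simp: block_def loop_of_def i'_def j'_def)
    moreover have "3 + band i' \<in> {0, 4, 5} \<longleftrightarrow> \<not> i' < p" by (auto simp: band_def)
    moreover have "i' < p \<longleftrightarrow> j' < p" "i' < p + q \<longleftrightarrow> j' < p + q" using b by (auto simp: band_def split: if_splits)
    moreover have "mate j' < mate i'" "mate i' < p \<longleftrightarrow> i' < p" "mate j' < p \<longleftrightarrow> j' < p" "mate i' < m"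
      using ij m calculation by (auto simp: mate_def)
    ultimately show ?thesis
      by (auto simp: height_def intro!: divide_strict_right_mono)
  qed
  have "block i \<in> {0, 4, 5} \<or> block i \<in> {1, 2, 3}" using block_le[of i] by auto
  then show ?thesis
  proof
    assume "block i \<in> {0, 4, 5}"
    then show ?thesis using h band_angle_mono(1)[of "height (loop_of i)" "height (loop_of j)" "block i"] hb
      by (simp add: end_angle_def True)
  next
    assume b: "block i \<in> {1, 2, 3}"
    then have "height (loop_of j) < height (loop_of i)" using h by auto
    then show ?thesis using b band_angle_mono(2)[of "height (loop_of j)" "height (loop_of i)" "block i"] hb
      by (simp add: end_angle_def True)
  qed
qed

lemma end_angle_range:
  assumes "i < 2 * m"
  shows "0 < end_angle i" "end_angle i < 2 * pi"
proof -
  have "band_bound 0 \<le> band_bound (block i)" "band_bound (Suc (block i)) \<le> band_bound 6"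
    using block_le[of i] by (intro band_bound_mono; simp)+
  moreover have "band_bound 0 = 0" "band_bound 6 = 2 * pi" by (auto simp: band_bound_def)
  ultimately show "0 < end_angle i" "end_angle i < 2 * pi" using end_angle_bounds[OF assms] by linarith+
qed

end

lemma radially_realizable_bands:
  assumes "distinct (A @ B @ C)"
  shows "radially_realizable (A @ B @ C @ rev A @ rev B @ rev C)"
proof -
  define p q where "p = length A" and "q = length B"
  define ws where "ws = A @ B @ C"
  define m where "m = length ws"
  define w where "w = A @ B @ C @ rev A @ rev B @ rev C"
  interpret band_word p q m by standard (simp add: p_def q_def m_def ws_def)
  have len: "length w = 2 * m" by (simp add: w_def m_def ws_def)
  have nth1: "w ! j = ws ! j" if "j < m" for j
  proof -
    have "w = ws @ rev A @ rev B @ rev C" by (simp add: w_def ws_def)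
    then show ?thesis using that by (simp only: m_def nth_append if_True)
  qed
  have nth2: "w ! (m + mate j) = ws ! j" if "j < m" for j
  proof -
    have "w ! (m + mate j) = (rev A @ rev B @ rev C) ! mate j"
      using nth_append_length_plus[of ws "rev A @ rev B @ rev C" "mate j"] by (simp add: w_def ws_def m_def)
    also have "\<dots> = ws ! j"
    proof -
      have m_eq: "m = p + q + length C" by (simp add: m_def ws_def p_def q_def)
      have app: "(X @ Y @ Z) ! i = (if i < length X then X ! i else if i < length X + length Y then Y ! (i - length X)
          else Z ! (i - length X - length Y))" for X Y Z :: "'a list" and i
        by (auto simp: nth_append)
      consider "j < p" | "p \<le> j" "j < p + q" | "p + q \<le> j" by linarith
      then show ?thesis
      proof cases
        case 1
        then show ?thesis unfolding ws_def app by (simp add: mate_def p_def[symmetric] rev_nth)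
      next
        case 2
        then have "mate j = 2 * p + q - 1 - j" by (simp add: mate_def)
        then have "\<not> mate j < p" "mate j < p + q" "q - Suc (mate j - p) = j - p" using 2 by linarith+
        then show ?thesis using 2 unfolding ws_def app length_rev p_def[symmetric] q_def[symmetric]
          by (simp add: rev_nth q_def[symmetric])
      next
        case 3
        then have "mate j = m + p + q - 1 - j" by (simp add: mate_def)
        then have "\<not> mate j < p" "\<not> mate j < p + q" "mate j - p - q < length C" "length C - Suc (mate j - p - q) = j - p - q"
          using 3 \<open>j < m\<close> m_eq by linarith+
        then show ?thesis using 3 unfolding ws_def app length_rev p_def[symmetric] q_def[symmetric]
          by (simp add: rev_nth)
      qed
    qed
    finally show ?thesis .
  qed
  define ix where "ix x = (THE j. j < m \<and> ws ! j = x)" for x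
  have ix: "ix (ws ! j) = j" if "j < m" for j
    unfolding ix_def by (rule the_equality) (use that assms in \<open>auto simp: m_def ws_def[symmetric] nth_eq_iff_index_eq\<close>)
  have ix_set: "ix x < m \<and> ws ! ix x = x" if "x \<in> set w" for x
  proof -
    have "x \<in> set ws" using that by (auto simp: w_def ws_def)
    then obtain j where "j < m" "x = ws ! j" by (auto simp: in_set_conv_nth m_def)
    then show ?thesis using ix by simp
  qed
  define \<gamma> where "\<gamma> x = strand_loop (band (ix x)) (height (ix x))" for x
  have "torus_drawing (1, 1) \<gamma> (set w)"
    unfolding torus_drawing_def
  proof (intro conjI ballI impI)
    fix x assume x: "x \<in> set w"
    show "simple_path (\<gamma> x)"
      unfolding \<gamma>_def using ix_set[OF x] height_bounds band_le by (intro simple_path_strand_loop) auto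
    show "path_image (\<gamma> x) \<subseteq> torus"
      using chart_in_torus by (auto simp: \<gamma>_def path_image_def strand_loop_def)
    show "pathstart (\<gamma> x) = (1, 1)" "pathfinish (\<gamma> x) = (1, 1)"
      by (auto simp: \<gamma>_def pathstart_def pathfinish_def strand_loop_ends)
    fix y assume y: "y \<in> set w" and "x \<noteq> y"
    then have ne: "band (ix x) \<noteq> band (ix y) \<or> height (ix x) \<noteq> height (ix y)"
      using height_inj ix_set x by metis
    show "path_image (\<gamma> x) \<inter> path_image (\<gamma> y) = {(1, 1)}"
    proof
      show "path_image (\<gamma> x) \<inter> path_image (\<gamma> y) \<subseteq> {(1, 1)}"
      proof
        fix z assume "z \<in> path_image (\<gamma> x) \<inter> path_image (\<gamma> y)"
        then obtain t t' where t: "0 \<le> t" "t \<le> 1" "0 \<le> t'" "t' \<le> 1" and z: "z = \<gamma> x t" "z = \<gamma> y t'"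
          by (auto simp: path_image_def)
        have "tent t = 0"
          by (rule strand_loops_meet[OF _ _ _ _ band_le band_le t _ ne])
             (use z height_bounds ix_set[OF x] ix_set[OF y] in \<open>auto simp: \<gamma>_def\<close>)
        then show "z \<in> {(1, 1)}" using z t tent_eq_0_iff[of t] by (auto simp: \<gamma>_def strand_loop_ends)
      qed
      have "\<gamma> x 0 \<in> path_image (\<gamma> x)" for x by (auto simp: path_image_def)
      then show "{(1, 1)} \<subseteq> path_image (\<gamma> x) \<inter> path_image (\<gamma> y)"
        by (auto simp: \<gamma>_def strand_loop_ends)
    qed
  qed (rule base_point_in_torus)
  moreover have "end_angle i < end_angle j \<and> end_angle j < end_angle i + 2 * pi" if "i < j" "j < length w" for i j
    using end_angle_strict_mono[OF that(1)] end_angle_range[of i] end_angle_range[of j] that len by auto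
  moreover have "\<exists>p q. p < length w \<and> q < length w \<and> p \<noteq> q \<and> w ! p = x \<and> w ! q = x \<and>
      radial_loop (pi / 4) (\<gamma> x) (end_angle p) (end_angle q)" if x: "x \<in> set w" for x
  proof -
    let ?j = "ix x"
    have j: "?j < m" "ws ! ?j = x" using ix_set[OF x] by auto
    have "radial_loop (pi / 4) (\<gamma> x) (band_angle (band ?j) (height ?j)) (band_angle (band ?j + 3) (height ?j))"
      unfolding \<gamma>_def using height_bounds[OF j(1)] band_le by (intro radial_strand_loop) auto
    moreover have "end_angle ?j = band_angle (band ?j) (height ?j)"
      using j by (simp add: end_angle_def block_def loop_of_def)
    moreover have "end_angle (m + mate ?j) = band_angle (band ?j + 3) (height ?j)"
      using j mate by (simp add: end_angle_def block_def loop_of_def add.commute)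
    ultimately show ?thesis
      using j nth1 nth2 mate(1)[OF j(1)] len
      by (intro exI[of _ ?j] exI[of _ "m + mate ?j"]) auto
  qed
  ultimately show ?thesis
    unfolding radially_realizable_def w_def[symmetric]
    by (intro exI[of _ \<gamma>] exI[of _ "pi / 4"] exI[of _ end_angle]) auto
qed

section \<open>Interlacement\<close>

lemma inv_count_append:
  "inv_count x y (u @ v) = inv_count x y u + inv_count x y v + count_list u x * count_list v y"
  by (induction u) (auto simp: algebra_simps)

lemma inv_count_notin: "x \<notin> set v \<or> y \<notin> set v \<Longrightarrow> inv_count x y v = 0"
  by (induction v) (auto simp: count_list_0_iff)

lemma inv_count_add_swap:
  "x \<noteq> y \<Longrightarrow> inv_count x y v + inv_count y x v = count_list v x * count_list v y"
  by (induction v) (auto simp: algebra_simps)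

lemma count_list_pos_iff: "0 < count_list v x \<longleftrightarrow> x \<in> set v"
  using count_list_0_iff[of v x] by auto

lemma distinct_if_count_list_le_1: "(\<And>x. count_list v x \<le> 1) \<Longrightarrow> distinct v"
proof (induction v)
  case (Cons a v)
  have "count_list v x \<le> 1" for x using Cons.prems[of x] by (simp split: if_splits)
  moreover have "a \<notin> set v" using Cons.prems[of a] count_list_pos_iff[of v a] by auto
  ultimately show ?case using Cons.IH by simp
qed simp

lemma hieroglyph_count: "hieroglyph w \<Longrightarrow> count_list w x = (if x \<in> set w then 2 else 0)"
  by (auto simp: hieroglyph_def count_list_0_iff)

lemma hieroglyph_append_commute: "hieroglyph (u @ v) \<Longrightarrow> hieroglyph (v @ u)"
  by (auto simp: hieroglyph_def add.commute)

text \<open>The shift exchanges the mixed terms \<open>count_list u x * count_list v y\<close> and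
  \<open>count_list v x * count_list u y\<close>. Since the counts of a letter in \<open>u\<close>
  and \<open>v\<close> add up to two, these have the same parity.\<close>

lemma torus_form_append_commute:
  assumes "hieroglyph (u @ v)" "torus_form (u @ v)"
  shows "torus_form (v @ u)"
proof -
  have "odd (inv_count x y (v @ u)) \<longleftrightarrow> odd (inv_count x y (u @ v))"
    if "x \<in> set (u @ v)" "y \<in> set (u @ v)" for x y
  proof -
    have "count_list u x + count_list v x = 2" "count_list u y + count_list v y = 2"
      using assms(1) that by (auto simp: hieroglyph_def)
    then have "count_list u x * count_list v y + 2 * count_list u y = count_list v x * count_list u y + 2 * count_list u x"
      by (smt (verit) add_mult_distrib mult.commute add.assoc add.commute)
    then have "even (count_list u x * count_list v y) \<longleftrightarrow> even (count_list v x * count_list u y)"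
      by (metis dvd_add_left_iff dvd_triv_left)
    then show ?thesis by (simp add: inv_count_append) blast
  qed
  then show ?thesis using assms(2) unfolding torus_form_def by (simp add: Un_commute)
qed

text \<open>\<open>trim\<close> is cancellation across the cut between the end and the beginning of
  the word.\<close>

inductive reduces :: "'a list \<Rightarrow> 'a list \<Rightarrow> bool" for w where
  start: "reduces w w"
| cancel: "reduces w (u @ [x, x] @ v) \<Longrightarrow> reduces w (u @ v)"
| trim: "reduces w (x # u @ [x]) \<Longrightarrow> reduces w u"

text \<open>The form passes down to the reduced word and drawings pass up from it, a petal replacing
  each cancelled loop. With a drawing of the reduced word, these close the circle of
  implications.\<close>

lemma reduces_invariants:
  assumes "reduces w u" "hieroglyph w"
  shows "hieroglyph u \<and> set u \<subseteq> set w \<and> (torus_form w \<longrightarrow> torus_form u) \<and> (radially_realizable u \<longrightarrow> radially_realizable w)"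
  using assms
proof (induction rule: reduces.induct)
  case (cancel u x v)
  then have IH: "hieroglyph (u @ [x, x] @ v)" by simp
  have x: "x \<notin> set (u @ v)" using hieroglyph_count[OF IH, of x] by (auto simp: count_list_0_iff)
  have h: "hieroglyph (u @ v)"
    unfolding hieroglyph_def
  proof
    fix y assume "y \<in> set (u @ v)"
    then have "y \<noteq> x" using x by auto
    then show "count_list (u @ v) y = 2" using \<open>y \<in> set (u @ v)\<close> hieroglyph_count[OF IH, of y] by auto
  qed
  have "inv_count y z (u @ [x, x] @ v) = inv_count y z (u @ v)" if "y \<in> set (u @ v)" "z \<in> set (u @ v)" for y z
    using that x by (auto simp: inv_count_append)
  then have "torus_form (u @ [x, x] @ v) \<Longrightarrow> torus_form (u @ v)"
    unfolding torus_form_def using x by (metis Un_iff set_append)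
  moreover have "radially_realizable (u @ [x, x] @ v)" if "radially_realizable (u @ v)"
  proof -
    have "radially_realizable ((v @ u) @ [x, x])"
      by (rule radially_realizable_add_loop[OF radially_realizable_append_commute[OF that]]) (use x in auto)
    then show ?thesis using radially_realizable_append_commute[of v "u @ [x, x]"] by simp
  qed
  ultimately show ?case using h cancel by auto
next
  case (trim x u)
  then have IH: "hieroglyph (x # u @ [x])" by simp
  have x: "x \<notin> set u" using hieroglyph_count[OF IH, of x] by (auto simp: count_list_0_iff)
  have h: "hieroglyph u"
    unfolding hieroglyph_def
  proof
    fix y assume "y \<in> set u"
    then have "y \<noteq> x" using x by auto
    then show "count_list u y = 2" using \<open>y \<in> set u\<close> hieroglyph_count[OF IH, of y] by (auto split: if_splits)
  qed
  have "inv_count y z (x # u @ [x]) = inv_count y z u" if "y \<in> set u" "z \<in> set u" for y z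
    using that x by (auto simp: inv_count_append)
  then have "torus_form (x # u @ [x]) \<Longrightarrow> torus_form u"
    unfolding torus_form_def using x by (metis Un_iff insert_iff list.simps(15) set_append)
  moreover have "radially_realizable (x # u @ [x])" if "radially_realizable u"
    using radially_realizable_append_commute[of "u @ [x]" "[x]"] radially_realizable_add_loop[OF that x] by simp
  ultimately show ?case using h trim by auto
qed simp

section \<open>Reduced words\<close>

definition cyc_reduced :: "'a list \<Rightarrow> bool" where
  "cyc_reduced u \<longleftrightarrow> successively (\<noteq>) u \<and> (u \<noteq> [] \<longrightarrow> last u \<noteq> hd u)"

text \<open>Without interlacing, the factor between the two ends of the first letter consists of
  whole letters: it is empty, which is a repetition, or a shorter word of the same kind.\<close>

lemma planar_word_has_repetition:
  assumes "hieroglyph v" "v \<noteq> []" "\<And>y z. \<lbrakk>y \<in> set v; z \<in> set v; y \<noteq> z\<rbrakk> \<Longrightarrow> even (inv_count y z v)"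
  shows "\<not> successively (\<noteq>) v"
  using assms
proof (induction v rule: length_induct)
  case (1 v)
  obtain y v' where v: "v = y # v'" using 1(3) by (cases v) auto
  have "y \<in> set v'" using hieroglyph_count[OF 1(2), of y] count_list_pos_iff[of v' y] v by auto
  then obtain v1 v2 where v': "v' = v1 @ y # v2" by (auto simp: in_set_conv_decomp)
  have y: "y \<notin> set v1" "y \<notin> set v2"
    using hieroglyph_count[OF 1(2), of y] v v' by (auto simp: count_list_0_iff)
  show ?case
  proof (cases "v1 = []")
    case True
    then show ?thesis using v v' by simp
  next
    case False
    have z: "count_list v2 z = 0" "count_list v1 z = 2" if "z \<in> set v1" for z
    proof -
      have "z \<noteq> y" using y that by auto
      then have "count_list v1 z + count_list v2 z = 2"
        using hieroglyph_count[OF 1(2), of z] that v v' by auto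
      moreover have "even (inv_count y z v)" using 1(4)[of y z] that v v' \<open>z \<noteq> y\<close> by (simp del: inv_count.simps)
      then have "even (count_list v1 z + count_list v2 z + count_list v2 z)"
        using v v' y \<open>z \<noteq> y\<close> by (simp add: inv_count_append inv_count_notin)
      moreover have "0 < count_list v1 z" using that count_list_pos_iff by metis
      ultimately show "count_list v2 z = 0" "count_list v1 z = 2" by presburger+
    qed
    have "hieroglyph v1" using z by (simp add: hieroglyph_def)
    moreover have "even (inv_count a b v1)" if "a \<in> set v1" "b \<in> set v1" "a \<noteq> b" for a b
    proof -
      have "inv_count a b v = inv_count a b v1"
        using that y z by (auto simp: v v' inv_count_append inv_count_notin count_list_0_iff)
      then show ?thesis using 1(4)[of a b] that v v' by auto
    qed
    ultimately have "\<not> successively (\<noteq>) v1" using 1(1) False v v' by auto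
    then show ?thesis by (simp add: v v' successively_Cons successively_append_iff)
  qed
qed

text \<open>Pairs of booleans encode vectors over the field with two elements.\<close>

definition det2 :: "bool \<times> bool \<Rightarrow> bool \<times> bool \<Rightarrow> bool" where
  "det2 v w \<longleftrightarrow> (fst v \<and> snd w) \<noteq> (fst w \<and> snd v)"

locale torus_word =
  fixes u :: "'a list" and f :: "'a \<Rightarrow> bool \<times> bool"
  assumes hier: "hieroglyph u"
    and form: "\<And>y z. \<lbrakk>y \<in> set u; z \<in> set u; y \<noteq> z\<rbrakk> \<Longrightarrow> odd (inv_count y z u) \<longleftrightarrow> det2 (f y) (f z)"
    and red: "cyc_reduced u"
begin

text \<open>A factor made of whole letters inherits the absence of repetitions, so it cannot be
  planar.\<close>

lemma closed_factor_crosses: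
  assumes "u = e @ v @ g" "v \<noteq> []" "hieroglyph v"
  obtains y z where "y \<in> set v" "z \<in> set v" "det2 (f y) (f z)"
proof -
  have "successively (\<noteq>) v" using red unfolding cyc_reduced_def assms(1) by (simp add: successively_append_iff)
  then obtain y z where yz: "y \<in> set v" "z \<in> set v" "y \<noteq> z" "odd (inv_count y z v)"
    using planar_word_has_repetition[OF assms(3,2)] by blast
  have "count_list e x = 0 \<and> count_list g x = 0" if "x \<in> set v" for x
    using hieroglyph_count[OF hier, of x] hieroglyph_count[OF assms(3), of x] that assms(1) by auto
  then have "inv_count y z u = inv_count y z v"
    using yz by (simp add: assms(1) inv_count_append inv_count_notin count_list_0_iff)
  then have "det2 (f y) (f z)" using form[of y z] yz assms(1) by auto
  then show ?thesis using that yz by blast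
qed

lemma odd_inv_count_factor:
  assumes "u = e @ z # v @ z # g" "y \<noteq> z"
  shows "odd (inv_count z y u) \<longleftrightarrow> odd (count_list v y)"
proof -
  have "z \<notin> set e \<and> z \<notin> set v \<and> z \<notin> set g"
    using hieroglyph_count[OF hier, of z] assms(1) by (auto simp: count_list_0_iff)
  then have "inv_count z y u = count_list v y + 2 * count_list g y"
    using assms by (simp add: inv_count_append inv_count_notin count_list_0_iff)
  then show ?thesis by simp
qed

text \<open>Otherwise both sides of \<open>x\<close> consist of whole letters and each contains an
  interlacing pair, while no letter of one side interlaces one of the other. In a plane, a vector
  with zero determinant against two independent ones is zero.\<close>

lemma letter_not_isolated:
  assumes u: "u = x # s @ x # r"
  obtains y where "y \<in> set u" "det2 (f x) (f y)"
proof (rule ccontr)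
  assume "\<not> thesis"
  then have no: "\<not> det2 (f x) (f y)" if "y \<in> set u" for y using that \<open>\<And>y. \<lbrakk>y \<in> set u; det2 (f x) (f y)\<rbrakk> \<Longrightarrow> thesis\<close> by blast
  have x: "x \<notin> set s" "x \<notin> set r"
    using hieroglyph_count[OF hier, of x] u by (auto simp: count_list_0_iff)
  have sides: "even (count_list s y) \<and> count_list s y + count_list r y = 2" if "y \<in> set s \<union> set r" for y
  proof -
    have y: "y \<noteq> x" "y \<in> set u" using that x u by auto
    then have "even (inv_count x y u)" using form[of x y] no[of y] u by auto
    then have "even (count_list s y)" using odd_inv_count_factor[of "[]" x s r y] u y by auto
    then show ?thesis using hieroglyph_count[OF hier, of y] u y by simp
  qed
  have "hieroglyph s" "hieroglyph r"
    unfolding hieroglyph_def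
  proof safe
    fix y assume "y \<in> set s"
    then have "even (count_list s y) \<and> count_list s y + count_list r y = 2" "0 < count_list s y"
      using sides[of y] count_list_pos_iff[of s y] by auto
    then show "count_list s y = 2" by presburger
  next
    fix y assume "y \<in> set r"
    then have "even (count_list s y) \<and> count_list s y + count_list r y = 2" "0 < count_list r y"
      using sides[of y] count_list_pos_iff[of r y] by auto
    then show "count_list r y = 2" by presburger
  qed
  moreover have "s \<noteq> []" "r \<noteq> []" using red u by (auto simp: cyc_reduced_def)
  ultimately obtain y z y' z' where yz: "y \<in> set s" "z \<in> set s" "det2 (f y) (f z)" "y' \<in> set r" "z' \<in> set r" "det2 (f y') (f z')"
    using closed_factor_crosses[of "[x]" s "x # r"] closed_factor_crosses[of "x # s @ [x]" r "[]"] u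
    by (metis append.assoc append.left_neutral append.right_neutral append_Cons)
  have "\<not> det2 (f a) (f b)" if "a \<in> set s" "b \<in> set r" for a b
  proof -
    have c: "count_list s a = 2" "count_list r b = 2" "count_list r a = 0" "count_list s b = 0"
      using sides[of a] sides[of b] that \<open>hieroglyph s\<close> \<open>hieroglyph r\<close> by (auto simp: hieroglyph_def)
    then have "a \<noteq> b" using that by (metis count_list_0_iff)
    have "a \<noteq> x" "b \<noteq> x" using that x by auto
    then have "inv_count a b u = 4"
      using c u by (simp add: inv_count_append inv_count_notin count_list_0_iff)
    then show ?thesis using form[of a b] \<open>a \<noteq> b\<close> that u by auto
  qed
  from this[of y y'] this[of y z'] this[of z y'] this[of z z'] yz show False
    unfolding det2_def by blast
qed

text \<open>Every letter of a trimmed side interlaces \<open>x\<close>. If one had both ends in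
  \<sigma>, so would the first letter of \<sigma>, and behind its second end there would be a closed
  factor without interlacing letters.\<close>

lemma trimmed_side_crosses:
  assumes u: "u = x # s @ x # r" and s: "s = Y @ \<sigma> @ rev Y" and \<sigma>: "length \<sigma> \<le> 1 \<or> hd \<sigma> \<noteq> last \<sigma>"
    and z: "z \<in> set \<sigma>"
  shows "count_list s z = 1" "count_list \<sigma> z = 1" "count_list r z = 1"
proof -
  have x: "x \<notin> set s" "x \<notin> set r"
    using hieroglyph_count[OF hier, of x] u by (auto simp: count_list_0_iff)
  have total: "count_list s y + count_list r y = 2" if "y \<in> set s \<union> set r" for y
  proof -
    have "y \<noteq> x" using that x by auto
    then show ?thesis using hieroglyph_count[OF hier, of y] u that by (auto split: if_splits)
  qed
  have \<sigma>s: "count_list s y = count_list \<sigma> y" "y \<notin> set Y" "y \<noteq> x" "y \<in> set u" "0 < count_list \<sigma> y" if "y \<in> set \<sigma>" for y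
  proof -
    show pos: "0 < count_list \<sigma> y" using that count_list_pos_iff by metis
    have "y \<in> set s" using that s by auto
    then show "y \<noteq> x" "y \<in> set u" using x u by auto
    have "2 * count_list Y y + count_list \<sigma> y \<le> 2"
      using total[of y] \<open>y \<in> set s\<close> s by (auto simp: count_list_rev)
    then have "count_list Y y = 0" using pos by linarith
    then show "y \<notin> set Y" "count_list s y = count_list \<sigma> y" using s by (auto simp: count_list_rev count_list_0_iff)
  qed
  obtain y0 where y0: "det2 (f x) (f y0)" using letter_not_isolated[OF u] by blast
  have cross_x: "det2 (f x) (f y) \<longleftrightarrow> odd (count_list s y)" if "y \<in> set s \<union> set r" for y
    using odd_inv_count_factor[of "[]" x s r y] form[of x y] that x u by auto
  have le2: "count_list s y \<le> 2" for y
    using total[of y] count_list_pos_iff[of s y] by (cases "y \<in> set s \<union> set r") (auto simp: count_list_0_iff)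
  have cross: "det2 (f a) (f y) \<longleftrightarrow> odd (count_list e2 y)"
    if "\<sigma> = e1 @ a # e2 @ a # e3" "y \<noteq> a" "y \<in> set \<sigma>" for e1 a e2 e3 y
  proof -
    have "u = (x # Y @ e1) @ a # e2 @ a # (e3 @ rev Y @ x # r)" using u s that(1) by simp
    from odd_inv_count_factor[OF this that(2)] show ?thesis
      using form[of a y] \<sigma>s(4)[of y] \<sigma>s(4)[of a] that by auto
  qed
  \<comment> \<open>Such a letter does not interlace \<open>x\<close>, so its class is zero or the
    nonzero class of \<open>x\<close>. Class zero would make the factor between its ends closed, yet
    none of the letters in there interlaces \<open>x\<close>, so all their classes are multiples of
    one vector.\<close>
  have bad: "f a = f x" if a: "a \<in> set \<sigma>" "count_list \<sigma> a = 2" for a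
  proof (rule ccontr)
    assume "f a \<noteq> f x"
    have "\<not> det2 (f x) (f a)" using cross_x[of a] \<sigma>s[OF a(1)] a s by auto
    with \<open>f a \<noteq> f x\<close> y0 have zero: "f a = (False, False)"
      unfolding det2_def by (cases "f a"; cases "f x"; cases "f y0") auto
    obtain e1 e' where e': "\<sigma> = e1 @ a # e'" "a \<notin> set e1" using a(1) by (meson split_list_first)
    then have "count_list e' a = 1" using a(2) by (simp add: count_list_0_iff)
    then have "a \<in> set e'" using count_list_pos_iff[of e' a] by simp
    then obtain e2 e3 where e: "\<sigma> = e1 @ a # e2 @ a # e3" using e' by (metis split_list)
    have ane: "a \<notin> set e2" using a(2) e by (auto simp: count_list_0_iff)
    have c2: "count_list e2 y = 2 \<and> count_list \<sigma> y = 2" if "y \<in> set e2" for y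
    proof -
      have "y \<noteq> a" using ane that by auto
      moreover have "y \<in> set \<sigma>" using that e by auto
      ultimately have "even (count_list e2 y)" using cross[OF e, of y] zero by (simp add: det2_def)
      moreover have "0 < count_list e2 y" using that count_list_pos_iff by metis
      moreover have "count_list e2 y \<le> count_list \<sigma> y" using e by auto
      moreover have "count_list \<sigma> y \<le> 2" using le2[of y] \<sigma>s(1)[OF \<open>y \<in> set \<sigma>\<close>] by simp
      ultimately show ?thesis by presburger
    qed
    have "u = (x # Y @ e1 @ [a]) @ e2 @ (a # e3 @ rev Y @ x # r)" using u s e by simp
    moreover have "e2 \<noteq> []" using red u s e by (auto simp: cyc_reduced_def successively_append_iff successively_Cons)
    moreover have "hieroglyph e2" using c2 by (simp add: hieroglyph_def)
    ultimately obtain y z where yz: "y \<in> set e2" "z \<in> set e2" "det2 (f y) (f z)"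
      by (rule closed_factor_crosses)
    have nx: "\<not> det2 (f x) (f y)" if "y \<in> set e2" for y
    proof -
      have "y \<in> set \<sigma>" "y \<in> set s" using that e s by auto
      then show ?thesis using cross_x[of y] \<sigma>s(1)[of y] c2[OF that] by simp
    qed
    have "\<not> det2 (f x) (f y)" "\<not> det2 (f x) (f z)" using nx yz by auto
    then show False using yz(3) y0 unfolding det2_def by blast
  qed
  have good: "count_list \<sigma> y = 1" if "y \<in> set \<sigma>" "count_list \<sigma> y \<noteq> 2" for y
    using \<sigma>s[OF that(1)] le2[of y] that(2) by linarith
  \<comment> \<open>A letter with a single end in \<sigma> interlaces \<open>x\<close>, hence also
    \<open>a\<close>, which has the class of \<open>x\<close>; so that end lies between the two ends
    of \<open>a\<close>.\<close>
  have ends: False if "a \<in> set \<sigma>" "count_list \<sigma> a = 2" and e: "\<sigma> = e1 @ a # e2 @ a # e3"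
    and y: "count_list \<sigma> y = 1" "y \<in> set e1 \<union> set e3" for a y e1 e2 e3
  proof -
    have "y \<noteq> a" using y(1) that(2) by auto
    have "y \<in> set \<sigma>" using y(2) e by auto
    have "0 < count_list e1 y + count_list e3 y" using y(2) count_list_pos_iff[of e1 y] count_list_pos_iff[of e3 y] by auto
    moreover have "count_list \<sigma> y = count_list e1 y + count_list e2 y + count_list e3 y"
      using e \<open>y \<noteq> a\<close> by simp
    ultimately have "count_list e2 y = 0" using y(1) by linarith
    then have "\<not> det2 (f a) (f y)" using cross[OF e \<open>y \<noteq> a\<close> \<open>y \<in> set \<sigma>\<close>] by simp
    moreover have "det2 (f x) (f y)" using cross_x[of y] \<sigma>s(1)[OF \<open>y \<in> set \<sigma>\<close>] y(1) \<open>y \<in> set \<sigma>\<close> s by simp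
    ultimately show False using bad[OF that(1,2)] by simp
  qed
  have one: "count_list \<sigma> z = 1"
  proof (rule ccontr)
    assume "count_list \<sigma> z \<noteq> 1"
    then have z2: "count_list \<sigma> z = 2" using good[OF z] by blast
    have split2: "\<exists>e1 e2 e3. \<sigma> = e1 @ a # e2 @ a # e3 \<and> a \<notin> set e1 \<and> a \<notin> set e2 \<and> a \<notin> set e3" if "count_list \<sigma> a = 2" for a
    proof -
      have "a \<in> set \<sigma>" using that count_list_pos_iff[of \<sigma> a] by simp
      then obtain e1 e' where e': "\<sigma> = e1 @ a # e'" "a \<notin> set e1" by (meson split_list_first)
      then have "count_list e' a = 1" using that by (simp add: count_list_0_iff)
      moreover from this have "a \<in> set e'" using count_list_pos_iff[of e' a] by simp
      then obtain e2 e3 where "e' = e2 @ a # e3" by (meson split_list)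
      ultimately show ?thesis using e' by (intro exI[of _ e1] exI[of _ e2] exI[of _ e3]) (auto simp: count_list_0_iff)
    qed
    obtain e1 e2 e3 where e: "\<sigma> = e1 @ z # e2 @ z # e3" using split2[OF z2] by blast
    define g h where "g = hd \<sigma>" and "h = last \<sigma>"
    have "\<sigma> \<noteq> []" "\<not> length \<sigma> \<le> 1" using e by auto
    then have gh: "g \<in> set \<sigma>" "h \<in> set \<sigma>" "g \<noteq> h" using \<sigma> unfolding g_def h_def by simp_all
    \<comment> \<open>A single end of the first letter would have to lie between the ends of
      \<open>z\<close>.\<close>
    have g2: "count_list \<sigma> g = 2"
    proof (rule ccontr)
      assume n: "count_list \<sigma> g \<noteq> 2"
      then have "g \<noteq> z" using z2 by auto
      then have "g \<in> set e1" using e g_def by (cases e1) auto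
      then show False using ends[OF z z2 e, of g] good[OF gh(1) n] by auto
    qed
    obtain d1 d2 d3 where d: "\<sigma> = d1 @ g # d2 @ g # d3" "g \<notin> set d1" "g \<notin> set d3" using split2[OF g2] by blast
    have "d1 = []"
    proof (rule ccontr)
      assume "d1 \<noteq> []"
      then have "hd \<sigma> \<in> set d1" using d(1) by simp
      then show False using d(2) by (simp add: g_def)
    qed
    \<comment> \<open>The trimming enters here: a longer core does not begin and end with the same
      letter.\<close>
    have "d3 \<noteq> []"
    proof
      assume "d3 = []"
      then have "last \<sigma> = g" using d(1) by simp
      then show False using gh(3) by (simp add: h_def)
    qed
    \<comment> \<open>Letters behind the second \<open>g\<close> have both ends in \<sigma>, hence
      the class of \<open>g\<close>; they do not interlace it, so they lie wholly behind it.\<close>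
    have fd: "f y = f x \<and> count_list d3 y = 2" if y: "y \<in> set d3" for y
    proof -
      have "y \<in> set \<sigma>" "y \<noteq> g" using y d by auto
      have "count_list \<sigma> y = 2"
        using ends[OF gh(1) g2 d(1), of y] good[OF \<open>y \<in> set \<sigma>\<close>] y by blast
      then have "f y = f x" using bad \<open>y \<in> set \<sigma>\<close> by blast
      then have "\<not> det2 (f g) (f y)" using bad[OF gh(1) g2] by (auto simp: det2_def)
      then have "even (count_list d2 y)" using cross[OF d(1) \<open>y \<noteq> g\<close> \<open>y \<in> set \<sigma>\<close>] by simp
      moreover have "count_list d2 y + count_list d3 y = 2"
        using \<open>count_list \<sigma> y = 2\<close> d(1) \<open>d1 = []\<close> \<open>y \<noteq> g\<close> by simp
      moreover have "0 < count_list d3 y" using y count_list_pos_iff by metis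
      ultimately have "count_list d3 y = 2" by presburger
      then show ?thesis using \<open>f y = f x\<close> by simp
    qed
    have "u = (x # Y @ d1 @ g # d2 @ [g]) @ d3 @ (rev Y @ x # r)" using u s d by simp
    moreover have "hieroglyph d3" using fd by (simp add: hieroglyph_def)
    ultimately obtain y z where "y \<in> set d3" "z \<in> set d3" "det2 (f y) (f z)"
      using \<open>d3 \<noteq> []\<close> closed_factor_crosses by blast
    then show False using fd by (auto simp: det2_def)
  qed
  then show "count_list \<sigma> z = 1" "count_list s z = 1" using \<sigma>s(1)[OF z] by auto
  then show "count_list r z = 1" using total[of z] z s by auto
qed

end

section \<open>From the form to the shape of the two cores\<close>

lemma torus_form_imp_torus_word:
  assumes "hieroglyph u" "torus_form u" "cyc_reduced u"
  obtains f where "torus_word u f"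
proof -
  from assms(2) obtain a b :: "'a \<Rightarrow> int" where
    ab: "\<forall>x\<in>set u. \<forall>y\<in>set u. x \<noteq> y \<longrightarrow> (odd (inv_count x y u) \<longleftrightarrow> odd (a x * b y - a y * b x))"
    unfolding torus_form_def by blast
  have "torus_word u (\<lambda>x. (odd (a x), odd (b x)))"
    by standard (use assms ab in \<open>auto simp: det2_def\<close>)
  then show ?thesis by (rule that)
qed

lemma sorted_wrt_inv_count: "sorted_wrt (\<lambda>y z. 0 < inv_count y z (e @ v)) v"
proof (induction v arbitrary: e)
  case (Cons a v)
  have "0 < inv_count a z (e @ a # v)" if "z \<in> set v" for z
    using that count_list_pos_iff[of v z] by (simp add: inv_count_append)
  then show ?case using Cons[of "e @ [a]"] by simp
qed simp

text \<open>Parities of \<open>inv_count\<close> only give the order of any two letters of \<rho>;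
  this lemma recovers the whole word from it.\<close>

lemma sorted_wrt_antisym_unique:
  assumes "sorted_wrt R xs" "sorted_wrt R ys" "set xs = set ys" "distinct xs" "distinct ys"
    "\<And>a b. \<lbrakk>a \<in> set xs; b \<in> set xs; R a b; R b a\<rbrakk> \<Longrightarrow> a = b"
  shows "xs = ys"
  using assms
proof (induction xs arbitrary: ys)
  case (Cons a xs)
  then obtain b ys' where ys: "ys = b # ys'" by (cases ys) auto
  have "a = b"
  proof (rule ccontr)
    assume "a \<noteq> b"
    then have "b \<in> set xs" "a \<in> set ys'" using Cons.prems(3) ys by auto
    then have "R a b" "R b a" using Cons.prems(1,2) ys by auto
    then show False using Cons.prems(6)[of a b] \<open>b \<in> set xs\<close> \<open>a \<noteq> b\<close> by auto
  qed
  then have "set xs = set ys'" using Cons.prems(3-5) ys by auto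
  then have "xs = ys'" using Cons.IH[of ys'] Cons.prems ys by auto
  then show ?case using ys \<open>a = b\<close> by simp
qed simp

text \<open>In the second case \<rho> is \<open>rev (B @ [g]) @ rev C\<close> with its first letter
  written out. That letter and its first occurrence in \<sigma> determine the splitting, so no
  search over splittings is needed.\<close>

definition band_pair :: "'a list \<Rightarrow> 'a list \<Rightarrow> bool" where
  "band_pair \<sigma> \<rho> \<longleftrightarrow> \<sigma> = [] \<and> \<rho> = [] \<or>
     (\<exists>B g C. \<sigma> = B @ g # C \<and> g \<notin> set B \<and> \<rho> = g # rev B @ rev C)"

text \<open>All letters of the cores interlace \<open>x\<close>, and only two vectors have
  determinant one against a given nonzero vector. Two of these letters interlace exactly when
  \<sigma> and \<rho> list them in the same order: within a class \<rho> reverses the order, between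
  the two classes it keeps it.\<close>

lemma torus_form_imp_band_pair:
  assumes hier: "hieroglyph u" and "torus_form u" and red: "cyc_reduced u"
    and u: "u = x # s @ x # r"
    and s: "s = Y @ \<sigma> @ rev Y" "length \<sigma> \<le> 1 \<or> hd \<sigma> \<noteq> last \<sigma>"
    and r: "r = Z @ \<rho> @ rev Z" "length \<rho> \<le> 1 \<or> hd \<rho> \<noteq> last \<rho>"
  shows "band_pair \<sigma> \<rho>"
proof -
  obtain f where "torus_word u f" using torus_form_imp_torus_word[OF assms(1-3)] .
  then interpret torus_word u f .
  \<comment> \<open>The word read from the second \<open>x\<close>, so that the result on trimmed
    sides applies to \<open>r\<close> too.\<close>
  define u' where "u' = x # r @ x # s"
  have "hieroglyph u'" "torus_form u'"
    using hieroglyph_append_commute[of "x # s" "x # r"] torus_form_append_commute[of "x # s" "x # r"] assms(1,2) u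
    by (auto simp: u'_def)
  moreover have "cyc_reduced u'"
    using red u unfolding u'_def cyc_reduced_def successively_append_iff[of _ "x # _" "x # _", simplified append_Cons]
    by (auto simp: successively_append_iff successively_Cons)
  ultimately obtain f' where "torus_word u' f'" by (rule torus_form_imp_torus_word)
  then interpret T': torus_word u' f' .
  have S: "count_list s z = 1" "count_list \<sigma> z = 1" "count_list r z = 1" if "z \<in> set \<sigma>" for z
    using trimmed_side_crosses[OF u s that] by auto
  have R: "count_list r z = 1" "count_list \<rho> z = 1" "count_list s z = 1" if "z \<in> set \<rho>" for z
    using T'.trimmed_side_crosses[OF u'_def r that] by auto
  have dist: "distinct \<sigma>" "distinct \<rho>"
  proof -
    show "distinct \<sigma>" by (rule distinct_if_count_list_le_1) (metis S(2) count_list_0_iff le_numeral_extra(4) zero_le)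
    show "distinct \<rho>" by (rule distinct_if_count_list_le_1) (metis R(2) count_list_0_iff le_numeral_extra(4) zero_le)
  qed
  have in_core: "z \<in> set \<tau>" if "count_list (W @ \<tau> @ rev W) z = 1" for W \<tau> :: "'a list" and z
  proof -
    have "count_list W z + count_list \<tau> z + count_list W z = 1" using that by (simp add: count_list_rev)
    then have "0 < count_list \<tau> z" by presburger
    then show ?thesis by (simp add: count_list_pos_iff)
  qed
  have sets: "set \<sigma> = set \<rho>" using S(3) R(3) in_core s(1) r(1) by blast
  show ?thesis
  proof (cases \<rho>)
    case Nil
    then show ?thesis using sets by (simp add: band_pair_def)
  next
    case (Cons g \<rho>')
    then obtain B C where BC: "\<sigma> = B @ g # C" "g \<notin> set B" using sets by (metis list.set_intros(1) split_list_first)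
    have x: "x \<notin> set s" "x \<notin> set r"
      using hieroglyph_count[OF hier, of x] u by (auto simp: count_list_0_iff)
    have crx: "det2 (f x) (f y)" if "y \<in> set \<sigma>" for y
    proof -
      have "y \<in> set u" "y \<noteq> x" using that s x u by auto
      then show ?thesis using odd_inv_count_factor[of "[]" x s r y] form[of x y] S[OF that] u by auto
    qed
    have cr: "det2 (f y) (f z) \<longleftrightarrow> odd (inv_count y z \<sigma> + inv_count y z \<rho> + 1)"
      if yz: "y \<in> set \<sigma>" "z \<in> set \<sigma>" "y \<noteq> z" for y z
    proof -
      have out: "count_list Y a = 0 \<and> count_list Z a = 0 \<and> a \<noteq> x" if a: "a \<in> set \<sigma>" for a
        using S[OF a] R[of a] a sets s(1) r(1) x by (auto simp: count_list_rev)
      have "inv_count y z u = inv_count y z \<sigma> + inv_count y z \<rho> + count_list \<sigma> y * count_list \<rho> z"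
        using out[OF yz(1)] out[OF yz(2)] yz unfolding u s r
        by (auto simp: inv_count_append inv_count_notin count_list_0_iff count_list_rev)
      also have "\<dots> = inv_count y z \<sigma> + inv_count y z \<rho> + 1"
        using S[OF yz(1)] R[of z] yz sets by simp
      finally show ?thesis using form[of y z] yz u s by auto
    qed
    have swap: "inv_count y z v + inv_count z y v = 1" if "y \<in> set \<sigma>" "z \<in> set \<sigma>" "y \<noteq> z" "v = \<sigma> \<or> v = \<rho>" for y z v
      using inv_count_add_swap[OF that(3), of v] S[of y] S[of z] R[of y] R[of z] that sets by auto
    have before: "inv_count y z \<sigma> = 1" if "\<sigma> = e1 @ e2" "y \<in> set e1" "z \<in> set e2" for y z e1 e2
    proof -
      have "y \<noteq> z" using dist(1) that by auto
      moreover have "0 < count_list e1 y * count_list e2 z" using that count_list_pos_iff by (metis nat_0_less_mult_iff)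
      then have "0 < inv_count y z \<sigma>" using that(1) by (simp add: inv_count_append)
      ultimately show ?thesis using swap[of y z \<sigma>] that by auto
    qed
    have g_first: "inv_count g y \<rho> = 1" if "y \<in> set \<sigma>" "y \<noteq> g" for y
    proof -
      have "0 < inv_count g y \<rho>" using that sets Cons count_list_pos_iff[of \<rho>' y] by auto
      then show ?thesis using swap[of g y \<rho>] that BC by auto
    qed
    \<comment> \<open>Since \<open>g\<close> is first in \<rho>, a letter before it in \<sigma> does
      not interlace it and shares its class.\<close>
    have B: "f y = f g" if "y \<in> set B" for y
    proof -
      have "y \<in> set \<sigma>" "y \<noteq> g" "g \<in> set \<sigma>" using that BC by auto
      moreover have "inv_count y g \<sigma> = 1" using before[of B "g # C" y g] BC that by simp
      moreover have "inv_count y g \<rho> = 0" using g_first[of y] swap[of y g \<rho>] calculation by auto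
      ultimately have "\<not> det2 (f y) (f g)" using cr[of y g] by simp
      then show ?thesis using crx[OF \<open>y \<in> set \<sigma>\<close>] crx[OF \<open>g \<in> set \<sigma>\<close>]
        unfolding det2_def by (cases "f y"; cases "f g"; cases "f x") auto
    qed
    have C: "det2 (f g) (f y)" if "y \<in> set C" for y
    proof -
      have "y \<in> set \<sigma>" "y \<noteq> g" "g \<in> set \<sigma>" using that BC dist(1) by auto
      moreover have "inv_count g y \<sigma> = 1" using before[of "B @ [g]" C g y] BC that by simp
      ultimately show ?thesis using cr[of g y] g_first[of y] by simp
    qed
    \<comment> \<open>The only vector with determinant one against both independent classes, those
      of \<open>x\<close> and \<open>g\<close>, is their sum.\<close>
    have C': "f y = f z" if "y \<in> set C" "z \<in> set C" for y z
      using C[OF that(1)] C[OF that(2)] crx[of y] crx[of z] crx[of g] that BC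
      unfolding det2_def by (cases "f y"; cases "f z"; cases "f g"; cases "f x") auto
    have B': "f y = f g" if "y \<in> set (B @ [g])" for y using B that by auto
    define R where "R y z \<longleftrightarrow> 0 < inv_count y z \<rho>" for y z
    have reversed: "sorted_wrt (\<lambda>y z. R z y) v"
      if v: "\<sigma> = e1 @ v @ e2" and eq: "\<And>y z. \<lbrakk>y \<in> set v; z \<in> set v\<rbrakk> \<Longrightarrow> f y = f z" for v e1 e2
    proof -
      have "sorted_wrt (\<lambda>y z. 0 < inv_count y z (e1 @ v)) v" by (rule sorted_wrt_inv_count)
      then show ?thesis
      proof (rule sorted_wrt_mono_rel[rotated])
        fix y z assume yz: "y \<in> set v" "z \<in> set v" and "0 < inv_count y z (e1 @ v)"
        then have \<sigma>1: "0 < inv_count y z \<sigma>" using v by (auto simp: inv_count_append)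
        have y\<sigma>: "y \<in> set \<sigma>" "z \<in> set \<sigma>" using yz v by auto
        have "y \<noteq> z"
        proof
          assume "y = z"
          have "inv_count y y w = 0" if "count_list w y \<le> 1" for w
            using that by (induction w) (auto split: if_splits)
          then show False using \<sigma>1 S(2)[OF y\<sigma>(1)] \<open>y = z\<close> by auto
        qed
        have "inv_count y z \<sigma> = 1" using swap[of y z \<sigma>] \<sigma>1 y\<sigma> \<open>y \<noteq> z\<close> by auto
        moreover have "\<not> det2 (f y) (f z)" using eq[OF yz] by (auto simp: det2_def)
        ultimately have "even (inv_count y z \<rho>)" using cr[OF y\<sigma> \<open>y \<noteq> z\<close>] by simp
        moreover have "inv_count y z \<rho> + inv_count z y \<rho> = 1" using swap[OF y\<sigma> \<open>y \<noteq> z\<close>] by blast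
        ultimately have "inv_count z y \<rho> = 1" by presburger
        then show "R z y" by (simp add: R_def)
      qed
    qed
    have "\<rho> = rev (B @ [g]) @ rev C"
    proof (rule sorted_wrt_antisym_unique[of R])
      show "sorted_wrt R \<rho>" using sorted_wrt_inv_count[of "[]" \<rho>] unfolding R_def append_Nil .
      show "sorted_wrt R (rev (B @ [g]) @ rev C)"
      proof (subst sorted_wrt_append, intro conjI ballI)
        show "sorted_wrt R (rev (B @ [g]))"
          unfolding sorted_wrt_rev
        proof (rule reversed[of "[]" _ C])
          show "\<sigma> = [] @ (B @ [g]) @ C" using BC by simp
          show "f y = f z" if "y \<in> set (B @ [g])" "z \<in> set (B @ [g])" for y z
            by (rule trans[OF B'[OF that(1)] B'[OF that(2), symmetric]])
        qed
        show "sorted_wrt R (rev C)"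
          unfolding sorted_wrt_rev
        proof (rule reversed[of "B @ [g]" _ "[]"])
          show "\<sigma> = (B @ [g]) @ C @ []" using BC by simp
        qed (rule C')
        fix y z assume yz: "y \<in> set (rev (B @ [g]))" "z \<in> set (rev C)"
        then have y: "y \<in> set (B @ [g])" "z \<in> set C" "y \<in> set \<sigma>" "z \<in> set \<sigma>" "y \<noteq> z"
          using BC dist(1) by auto
        have "det2 (f y) (f z)" using B'[OF y(1)] C[OF y(2)] by simp
        moreover have "inv_count y z \<sigma> = 1" using before[of "B @ [g]" C y z] BC y by simp
        ultimately have "odd (inv_count y z \<rho>)" using cr[OF y(3-5)] by simp
        then show "R y z" unfolding R_def by (cases "inv_count y z \<rho>") auto
      qed
      show "set \<rho> = set (rev (B @ [g]) @ rev C)" using sets BC by auto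
      show "distinct \<rho>" "distinct (rev (B @ [g]) @ rev C)" using dist BC by auto
      fix a b assume ab: "a \<in> set \<rho>" "b \<in> set \<rho>" "R a b" "R b a"
      show "a = b"
      proof (rule ccontr)
        assume "a \<noteq> b"
        then show False using swap[of a b \<rho>] ab sets by (auto simp: R_def)
      qed
    qed
    then show ?thesis using BC unfolding band_pair_def by (intro disjI2 exI[of _ B] exI[of _ g] exI[of _ C]) simp
  qed
qed

text \<open>The letters stripped from both sides are parallel to \<open>x\<close> and form the band
  \<open>A\<close> together with it; shifting the final \<open>rev Z\<close> to the front gives the
  banded word.\<close>

lemma band_pair_imp_radially_realizable:
  assumes hier: "hieroglyph u" and u: "u = x # (Y @ \<sigma> @ rev Y) @ x # (Z @ \<rho> @ rev Z)" and "band_pair \<sigma> \<rho>"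
  shows "radially_realizable u"
proof -
  obtain B C where BC: "\<sigma> = B @ C" "\<rho> = rev B @ rev C"
  proof -
    consider "\<sigma> = []" "\<rho> = []" | B g C where "\<sigma> = B @ g # C" "\<rho> = g # rev B @ rev C"
      using assms(3) unfolding band_pair_def by blast
    then show ?thesis
    proof cases
      case 1
      then show ?thesis using that[of "[]" "[]"] by simp
    next
      case (2 B g C)
      then show ?thesis using that[of "B @ [g]" C] by simp
    qed
  qed
  define A where "A = rev Z @ [x] @ Y"
  have "distinct (A @ B @ C)"
  proof (rule distinct_if_count_list_le_1)
    fix z
    have "count_list u z = 2 * count_list (A @ B @ C) z"
      unfolding u BC A_def by (simp add: count_list_rev)
    moreover have "count_list u z \<le> 2" using hieroglyph_count[OF hier, of z] by simp
    ultimately show "count_list (A @ B @ C) z \<le> 1" by linarith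
  qed
  then have "radially_realizable (A @ B @ C @ rev A @ rev B @ rev C)" by (rule radially_realizable_bands)
  then have "radially_realizable (rev Z @ (x # Y @ B @ C @ rev Y @ x # Z @ rev B @ rev C))"
    by (simp add: A_def)
  then have "radially_realizable ((x # Y @ B @ C @ rev Y @ x # Z @ rev B @ rev C) @ rev Z)"
    by (rule radially_realizable_append_commute)
  then show ?thesis by (simp add: u BC)
qed

lemma radially_realizable_Nil: "radially_realizable []"
  using radially_realizable_bands[of "[]" "[]" "[]"] by simp

theorem realizable_on_torus_iff:
  assumes w: "hieroglyph w" and red: "reduces w u" "cyc_reduced u"
    and u: "u = x # s @ x # r"
    and s: "s = Y @ \<sigma> @ rev Y" "length \<sigma> \<le> 1 \<or> hd \<sigma> \<noteq> last \<sigma>"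
    and r: "r = Z @ \<rho> @ rev Z" "length \<rho> \<le> 1 \<or> hd \<rho> \<noteq> last \<rho>"
  shows "realizable_on_torus w \<longleftrightarrow> band_pair \<sigma> \<rho>"
proof
  note inv = reduces_invariants[OF red(1) w]
  show "band_pair \<sigma> \<rho>" if "realizable_on_torus w"
    using torus_form_imp_band_pair[OF _ _ red(2) u s r] inv realizable_imp_torus_form[OF w that] by blast
  show "realizable_on_torus w" if "band_pair \<sigma> \<rho>"
    using band_pair_imp_radially_realizable[OF _ _ that, of u x Y Z] inv u s r radially_realizable_imp_realizable
    by blast
qed

lemma reduces_Nil_imp_realizable:
  assumes "hieroglyph w" "reduces w []"
  shows "realizable_on_torus w"
  using reduces_invariants[OF assms(2,1)] radially_realizable_Nil radially_realizable_imp_realizable by blast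

section \<open>Straight-line execution of program fragments\<close>

fun relocate :: "nat \<Rightarrow> instr \<Rightarrow> instr" where
  "relocate l (Jump_If_Zero a t) = Jump_If_Zero a (l + t)"
| "relocate l i = i"

text \<open>The jump target \<open>1000\<close> of a fragment leaves the program, which halts there.\<close>

definition code_at :: "instr list \<Rightarrow> nat \<Rightarrow> instr list \<Rightarrow> bool" where
  "code_at P l c \<longleftrightarrow> l + length c \<le> length P \<and> length P \<le> 1000 \<and> (\<forall>i<length c. P ! (l + i) = relocate l (c ! i))"

text \<open>Only \<open>Const\<close> and \<open>Add\<close> can produce a number larger than all
  those present.\<close>

fun no_overflow :: "nat \<Rightarrow> (nat \<Rightarrow> nat) \<Rightarrow> instr \<Rightarrow> bool" where
  "no_overflow B R (Const d c) \<longleftrightarrow> c \<le> B"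
| "no_overflow B R (Add d a b) \<longleftrightarrow> R a + R b \<le> B"
| "no_overflow B R i \<longleftrightarrow> True"

text \<open>\<open>n\<close> is only an upper bound, so that estimates can be relaxed; the size
  bound covers every intermediate configuration, as the cost model demands.\<close>

definition reaches :: "instr list \<Rightarrow> nat \<Rightarrow> nat \<Rightarrow> config \<Rightarrow> config \<Rightarrow> bool" where
  "reaches P B n s s' \<longleftrightarrow>
     (fits B s \<longrightarrow> (\<exists>t\<le>n. (step P ^^ t) s = s' \<and> (\<forall>v\<le>t. fits B ((step P ^^ v) s))))"

lemma reaches_refl: "reaches P B n s s"
  unfolding reaches_def by (intro impI exI[of _ 0]) auto

lemma reaches_mono: "reaches P B n s s' \<Longrightarrow> n \<le> n' \<Longrightarrow> reaches P B n' s s'"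
  unfolding reaches_def using order_trans[of _ n n'] by blast

lemma reaches_trans:
  assumes "reaches P B n s s'" "reaches P B n' s' s''"
  shows "reaches P B (n + n') s s''"
  unfolding reaches_def
proof
  assume "fits B s"
  then obtain t where t: "t \<le> n" "(step P ^^ t) s = s'" "\<forall>v\<le>t. fits B ((step P ^^ v) s)"
    using assms(1) unfolding reaches_def by blast
  then have "fits B s'" by blast
  then obtain t' where t': "t' \<le> n'" "(step P ^^ t') s' = s''" "\<forall>v\<le>t'. fits B ((step P ^^ v) s')"
    using assms(2) unfolding reaches_def by blast
  have split: "(step P ^^ (v + t)) s = (step P ^^ v) s'" for v
    using t(2) by (simp add: funpow_add)
  have "fits B ((step P ^^ v) s)" if "v \<le> t' + t" for v
  proof (cases "v \<le> t")
    case False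
    then have "fits B ((step P ^^ (v - t)) s')" using t'(3) that by simp
    then show ?thesis using split[of "v - t"] False by simp
  qed (use t(3) in simp)
  then show "\<exists>t\<le>n + n'. (step P ^^ t) s = s'' \<and> (\<forall>v\<le>t. fits B ((step P ^^ v) s))"
    using t(1) t'(1,2) split[of t'] by (intro exI[of _ "t' + t"]) auto
qed

lemma fits_exec:
  assumes "fits B (pc, R, M)" "no_overflow B R i"
  shows "fits B (exec i (pc, R, M))"
  using assms by (cases i) (auto simp: fits_def intro: le_trans[OF diff_le_self])

text \<open>Symbolic execution of exactly \<open>n\<close> instructions: for a concrete fragment the
  simplifier unfolds it, and facts on the registers decide the branches.\<close>

fun wp :: "instr list \<Rightarrow> nat \<Rightarrow> nat \<Rightarrow> config \<Rightarrow> (config \<Rightarrow> bool) \<Rightarrow> bool" where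
  "wp c B 0 s Q \<longleftrightarrow> Q s"
| "wp c B (Suc n) (i, R, M) Q \<longleftrightarrow>
     i < length c \<and> no_overflow B R (c ! i) \<and> wp c B n (exec (c ! i) (i, R, M)) Q"

lemma wp_reaches:
  assumes "code_at P l c" "wp c B n (i, R, M) Q"
  shows "\<exists>i' R' M'. reaches P B n (l + i, R, M) (l + i', R', M') \<and> Q (i', R', M')"
  using assms(2)
proof (induction n arbitrary: i R M)
  case 0
  then show ?case using reaches_refl[of P B 0 "(l + i, R, M)"] by (intro exI conjI) auto
next
  case (Suc n)
  let ?j = "c ! i"
  have i: "i < length c" "no_overflow B R ?j" "wp c B n (exec ?j (i, R, M)) Q" using Suc.prems by auto
  obtain i1 R1 M1 where e: "exec ?j (i, R, M) = (i1, R1, M1)" by (cases "exec ?j (i, R, M)") auto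
  have P: "l + i < length P" "P ! (l + i) = relocate l ?j" using assms(1) i(1) by (auto simp: code_at_def)
  have s: "step P (l + i, R, M) = (l + i1, R1, M1)"
    using e P by (cases ?j) (auto simp: step_def halted_def)
  have "reaches P B 1 (l + i, R, M) (l + i1, R1, M1)"
    unfolding reaches_def
  proof (intro impI exI[of _ 1] conjI allI)
    assume f: "fits B (l + i, R, M)"
    then have "fits B (i, R, M)" by (simp add: fits_def)
    then have "fits B (i1, R1, M1)" using fits_exec[OF _ i(2)] e by metis
    then have "fits B (l + i1, R1, M1)" by (simp add: fits_def)
    then show "fits B ((step P ^^ v) (l + i, R, M))" if "v \<le> 1" for v
      using that f s by (cases v) auto
  qed (use s in auto)
  moreover obtain i' R' M' where "reaches P B n (l + i1, R1, M1) (l + i', R', M')" "Q (i', R', M')"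
    using Suc.IH i(3) e by metis
  ultimately show ?case using reaches_trans[of P B 1 _ _ n] by (metis plus_1_eq_Suc)
qed

text \<open>Register \<open>1\<close> holds \<open>0\<close> and register \<open>2\<close> holds \<open>1\<close>. Registers \<open>4\<close> and \<open>3\<close> delimit the current
  segment of the memory, and \<open>5\<close>, \<open>6\<close> and \<open>7\<close> are scratch registers.\<close>

definition cancel_code :: "instr list" where
  "cancel_code = [Sub 5 0 8, Jump_If_Zero 5 17, Load 6 8, Add 8 8 2, Jump_If_Zero 3 14,
     Sub 5 3 2, Load 7 5, Sub 5 6 7, Sub 7 7 6, Add 5 5 7, Jump_If_Zero 5 12, Jump_If_Zero 1 14,
     Sub 3 3 2, Jump_If_Zero 1 0, Store 3 6, Add 3 3 2, Jump_If_Zero 1 0]"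

definition trim_code :: "instr list" where
  "trim_code = [Sub 5 3 4, Sub 5 5 2, Jump_If_Zero 5 14, Sub 5 3 2, Load 7 5, Load 6 4,
     Sub 5 6 7, Sub 7 7 6, Add 5 5 7, Jump_If_Zero 5 11, Jump_If_Zero 1 14,
     Add 4 4 2, Sub 3 3 2, Jump_If_Zero 1 0]"

definition find_code :: "instr list" where
  "find_code = [Sub 5 3 8, Jump_If_Zero 5 9, Load 7 8, Sub 5 6 7, Sub 7 7 6, Add 5 5 7,
     Jump_If_Zero 5 11, Add 8 8 2, Jump_If_Zero 1 0, Const 0 0, Jump_If_Zero 1 1000]"

text \<open>Register 4 runs up through \<rho> to the end in 9, while 8 runs down through \<sigma>
  from the position of \<open>g\<close> to the start in 10 and then continues from the end in 11.
  Jumps on register 1 are unconditional.\<close>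

definition match_code :: "instr list" where
  "match_code = [Sub 5 9 4, Jump_If_Zero 5 17, Load 6 4, Load 7 8, Sub 5 6 7, Sub 7 7 6, Add 5 5 7,
     Jump_If_Zero 5 10, Const 0 0, Jump_If_Zero 1 1000, Add 4 4 2, Sub 5 8 10, Jump_If_Zero 5 15,
     Sub 8 8 2, Jump_If_Zero 1 0, Sub 8 11 2, Jump_If_Zero 1 0, Const 0 1, Jump_If_Zero 1 1000]"

text \<open>Subtraction being truncated, equality is tested by adding both differences, one of which
  is zero; the test value stays within the bound.\<close>

lemma abs_diff_le: "\<lbrakk>x \<le> B; y \<le> B\<rbrakk> \<Longrightarrow> x - y + (y - x) \<le> (B :: nat)"
  by linarith

section \<open>Memory segments and the loops of the program\<close>

definition seg :: "(nat \<Rightarrow> nat) \<Rightarrow> nat \<Rightarrow> nat \<Rightarrow> nat list" where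
  "seg M a b = map M [a..<b]"

lemma length_seg [simp]: "length (seg M a b) = b - a"
  by (simp add: seg_def)

lemma seg_Nil [simp]: "b \<le> a \<Longrightarrow> seg M a b = []"
  by (simp add: seg_def)

lemma seg_Cons: "a < b \<Longrightarrow> seg M a b = M a # seg M (Suc a) b"
  by (simp add: seg_def upt_conv_Cons)

lemma seg_snoc: "a \<le> b \<Longrightarrow> seg M a (Suc b) = seg M a b @ [M b]"
  by (simp add: seg_def)

lemma seg_append: "a \<le> b \<Longrightarrow> b \<le> c \<Longrightarrow> seg M a c = seg M a b @ seg M b c"
  by (metis le_Suc_ex map_append seg_def upt_add_eq_append)

lemma seg_nth: "i < b - a \<Longrightarrow> seg M a b ! i = M (a + i)"
  by (simp add: seg_def)

lemma set_seg: "set (seg M a b) = M ` {a..<b}"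
  by (simp add: seg_def)

abbreviation trims :: "instr list \<Rightarrow> nat \<Rightarrow> (nat \<Rightarrow> nat) \<Rightarrow> nat \<Rightarrow> (nat \<Rightarrow> nat) \<Rightarrow> (nat \<Rightarrow> nat) \<Rightarrow> nat list \<Rightarrow> bool" where
  "trims P B M l R R' Y \<equiv> reaches P B (13 * (R 3 - R 4) + 11) (l, R, M) (l + 14, R', M) \<and>
    (\<forall>i. i \<notin> {3, 4, 5, 6, 7} \<longrightarrow> R' i = R i) \<and> R' 4 = R 4 + length Y \<and> R' 3 + length Y = R 3 \<and> R' 4 \<le> R' 3 \<and>
    seg M (R 4) (R 3) = Y @ seg M (R' 4) (R' 3) @ rev Y \<and>
    (R' 3 - R' 4 \<le> 1 \<or> M (R' 4) \<noteq> M (R' 3 - 1))"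

text \<open>A round of at most 13 steps strips one entry from each end; the entries stripped in
  front form \<open>Y\<close>.\<close>

lemma trim_loop:
  assumes code: "code_at P l trim_code"
    and "R 1 = 0" "R 2 = 1" "R 4 \<le> R 3" "R 3 \<le> B" "\<And>i. M i \<le> B"
  shows "\<exists>R' Y. trims P B M l R R' Y"
  using assms(2-)
proof (induction "R 3 - R 4" arbitrary: R rule: less_induct)
  case less
  show ?case
  proof (cases "R 3 - R 4 \<le> 1")
    case True
    have "wp trim_code B 3 (0, R, M) (\<lambda>(i', R', M'). i' = 14 \<and> M' = M \<and> (\<forall>i. i \<noteq> 5 \<longrightarrow> R' i = R i))"
      using less.prems True by (simp add: trim_code_def eval_nat_numeral)
    from wp_reaches[OF code this] obtain R' where
      R': "reaches P B 3 (l, R, M) (l + 14, R', M)" "\<forall>i. i \<noteq> 5 \<longrightarrow> R' i = R i" by auto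
    show ?thesis
      by (rule exI[of _ R'], rule exI[of _ "[]"]) (use R' less.prems True reaches_mono[OF R'(1)] in auto)
  next
    case F: False
    show ?thesis
    proof (cases "M (R 4) = M (R 3 - 1)")
      case False
      then have "M (R 4) - M (R 3 - 1) + (M (R 3 - 1) - M (R 4)) \<noteq> 0" by linarith
      then have "wp trim_code B 11 (0, R, M) (\<lambda>(i', R', M'). i' = 14 \<and> M' = M \<and> (\<forall>i. i \<notin> {5, 6, 7} \<longrightarrow> R' i = R i))"
        using less.prems F by (auto simp: trim_code_def eval_nat_numeral abs_diff_le)
      from wp_reaches[OF code this] obtain R' where
        R': "reaches P B 11 (l, R, M) (l + 14, R', M)" "\<forall>i. i \<notin> {5, 6, 7} \<longrightarrow> R' i = R i" by auto
      show ?thesis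
        by (rule exI[of _ R'], rule exI[of _ "[]"]) (use R' less.prems False reaches_mono[OF R'(1)] in auto)
    next
      case True
      have "wp trim_code B 13 (0, R, M) (\<lambda>(i', R', M'). i' = 0 \<and> M' = M \<and> R' 4 = R 4 + 1 \<and> R' 3 = R 3 - 1 \<and>
          (\<forall>i. i \<notin> {3, 4, 5, 6, 7} \<longrightarrow> R' i = R i))"
        using less.prems F True by (auto simp: trim_code_def eval_nat_numeral abs_diff_le)
      from wp_reaches[OF code this] obtain R1 where
        R1: "reaches P B 13 (l, R, M) (l, R1, M)" "R1 4 = R 4 + 1" "R1 3 = R 3 - 1"
          "\<forall>i. i \<notin> {3, 4, 5, 6, 7} \<longrightarrow> R1 i = R i" by auto
      have "\<exists>R' Y. trims P B M l R1 R' Y"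
        by (rule less.hyps) (use R1 less.prems F in auto)
      then obtain R' Y where R': "reaches P B (13 * (R1 3 - R1 4) + 11) (l, R1, M) (l + 14, R', M)"
        "\<forall>i. i \<notin> {3, 4, 5, 6, 7} \<longrightarrow> R' i = R1 i" "R' 4 = R1 4 + length Y" "R' 3 + length Y = R1 3" "R' 4 \<le> R' 3"
        "seg M (R1 4) (R1 3) = Y @ seg M (R' 4) (R' 3) @ rev Y"
        "R' 3 - R' 4 \<le> 1 \<or> M (R' 4) \<noteq> M (R' 3 - 1)"
        by blast
      have "reaches P B (13 * (R 3 - R 4) + 11) (l, R, M) (l + 14, R', M)"
        by (rule reaches_mono[OF reaches_trans[OF R1(1) R'(1)]]) (use R1 F in simp)
      moreover have "seg M (R 4) (R 3) = M (R 4) # seg M (R1 4) (R1 3) @ [M (R 4)]"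
      proof -
        obtain k where k: "R 3 = Suc k" "R 4 < k" using F by (cases "R 3") auto
        have "seg M (R 4) (R 3) = seg M (R 4) k @ [M k]"
          unfolding k(1) by (rule seg_snoc) (use k(2) in simp)
        moreover have "seg M (R 4) k = M (R 4) # seg M (Suc (R 4)) k"
          by (rule seg_Cons) (rule k(2))
        ultimately show ?thesis using R1(2,3) True k by simp
      qed
      ultimately show ?thesis
        using R' R1 F by (intro exI[of _ R'] exI[of _ "M (R 4) # Y"]) auto
    qed
  qed
qed

abbreviation finds :: "instr list \<Rightarrow> nat \<Rightarrow> (nat \<Rightarrow> nat) \<Rightarrow> nat \<Rightarrow> (nat \<Rightarrow> nat) \<Rightarrow> (nat \<Rightarrow> nat) \<Rightarrow> bool" where
  "finds P B M l R R' \<equiv> if R 6 \<in> M ` {R 8..<R 3}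
     then reaches P B (9 * (R 3 - R 8)) (l, R, M) (l + 11, R', M) \<and> (\<forall>i. i \<notin> {5, 7, 8} \<longrightarrow> R' i = R i) \<and>
       R 8 \<le> R' 8 \<and> R' 8 < R 3 \<and> M (R' 8) = R 6 \<and> R 6 \<notin> M ` {R 8..<R' 8}
     else reaches P B (9 * (R 3 - R 8) + 4) (l, R, M) (l + 1000, R', M) \<and> R' 0 = 0"

lemma find_loop:
  assumes code: "code_at P l find_code"
    and "R 1 = 0" "R 2 = 1" "R 3 \<le> B" "\<And>i. M i \<le> B" "R 6 \<le> B"
  shows "\<exists>R'. finds P B M l R R'"
  using assms(2-)
proof (induction "R 3 - R 8" arbitrary: R rule: less_induct)
  case less
  show ?case
  proof (cases "R 3 \<le> R 8")
    case True
    have "wp find_code B 4 (0, R, M) (\<lambda>(i', R', M'). i' = 1000 \<and> M' = M \<and> R' 0 = 0)"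
      using less.prems True by (simp add: find_code_def eval_nat_numeral)
    from wp_reaches[OF code this] obtain R' where
      R': "reaches P B 4 (l, R, M) (l + 1000, R', M)" "R' 0 = 0" by auto
    then show ?thesis using True by (intro exI[of _ R']) auto
  next
    case F: False
    show ?thesis
    proof (cases "M (R 8) = R 6")
      case True
      have "wp find_code B 7 (0, R, M) (\<lambda>(i', R', M'). i' = 11 \<and> M' = M \<and> (\<forall>i. i \<notin> {5, 7} \<longrightarrow> R' i = R i))"
        using less.prems F True by (simp add: find_code_def eval_nat_numeral)
      from wp_reaches[OF code this] obtain R' where
        R': "reaches P B 7 (l, R, M) (l + 11, R', M)" "\<forall>i. i \<notin> {5, 7} \<longrightarrow> R' i = R i" by auto
      have "R 6 \<in> M ` {R 8..<R 3}" using True F by force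
      then show ?thesis
        using R' reaches_mono[OF R'(1), of "9 * (R 3 - R 8)"] F True by (intro exI[of _ R']) auto
    next
      case False
      then have "R 6 - M (R 8) + (M (R 8) - R 6) \<noteq> 0" by linarith
      then have "wp find_code B 9 (0, R, M) (\<lambda>(i', R', M'). i' = 0 \<and> M' = M \<and> R' 8 = R 8 + 1 \<and> (\<forall>i. i \<notin> {5, 7, 8} \<longrightarrow> R' i = R i))"
        using less.prems F by (auto simp: find_code_def eval_nat_numeral abs_diff_le)
      from wp_reaches[OF code this] obtain R1 where
        R1: "reaches P B 9 (l, R, M) (l, R1, M)" "R1 8 = R 8 + 1" "\<forall>i. i \<notin> {5, 7, 8} \<longrightarrow> R1 i = R i" by auto
      have "{R 8..<R 3} = insert (R 8) {R1 8..<R1 3}" using R1 F by auto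
      then have iff: "R 6 \<in> M ` {R 8..<R 3} \<longleftrightarrow> R1 6 \<in> M ` {R1 8..<R1 3}" using False R1(3) by auto
      have IH: "\<exists>R'. finds P B M l R1 R'"
        by (rule less.hyps) (use R1 less.prems F in auto)
      have time: "9 + 9 * (R1 3 - R1 8) = 9 * (R 3 - R 8)" using R1 F by simp
      show ?thesis
      proof (cases "R1 6 \<in> M ` {R1 8..<R1 3}")
        case True
        with IH obtain R' where R': "reaches P B (9 * (R1 3 - R1 8)) (l, R1, M) (l + 11, R', M)"
            "\<forall>i. i \<notin> {5, 7, 8} \<longrightarrow> R' i = R1 i" "R1 8 \<le> R' 8" "R' 8 < R1 3" "M (R' 8) = R1 6" "R1 6 \<notin> M ` {R1 8..<R' 8}"
          by auto
        have "{R 8..<R' 8} = insert (R 8) {R1 8..<R' 8}" using R1 R'(3) by auto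
        then have "R 6 \<notin> M ` {R 8..<R' 8}" using R'(6) R1(3) False by auto
        then show ?thesis
          using True iff R' R1 reaches_trans[OF R1(1) R'(1)] time by (intro exI[of _ R']) auto
      next
        case F2: False
        with IH obtain R' where R': "reaches P B (9 * (R1 3 - R1 8) + 4) (l, R1, M) (l + 1000, R', M)" "R' 0 = 0"
          by auto
        have "reaches P B (9 * (R 3 - R 8) + 4) (l, R, M) (l + 1000, R', M)"
          using reaches_trans[OF R1(1) R'(1)] time by (simp add: add.assoc[symmetric])
        then show ?thesis using F2 iff R'(2) by (intro exI[of _ R']) auto
      qed
    qed
  qed
qed

text \<open>With \<open>\<sigma>\<close> at the addresses \<open>a\<close> to \<open>a + n - 1\<close>, this is the address of entry \<open>j\<close> of
  \<open>rev (take (p + 1) \<sigma>) @ rev (drop (p + 1) \<sigma>)\<close>.\<close>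

definition rotated_address :: "nat \<Rightarrow> nat \<Rightarrow> nat \<Rightarrow> nat \<Rightarrow> nat" where
  "rotated_address a n p j = (if j \<le> p then a + p - j else a + n + p - j)"

text \<open>The pointer into \<sigma> wraps around after entry \<open>p\<close>, which is the case
  distinction of \<open>rotated_address\<close>.\<close>

lemma compare_loop:
  assumes code: "code_at P l match_code"
    and regs: "R 1 = 0" "R 2 = 1" "R 10 = a" "R 11 = a + n" "R 9 = c + n" "R 4 = c + j" "R 8 = rotated_address a n p j"
    and "p < n" "j \<le> n" "c + n \<le> B" "a + n \<le> B" "\<And>i. M i \<le> B" "1 \<le> B"
  shows "\<exists>R'. reaches P B (16 * (n - j) + 10) (l, R, M) (l + 1000, R', M) \<and>
    R' 0 = of_bool (\<forall>i. j \<le> i \<and> i < n \<longrightarrow> M (c + i) = M (rotated_address a n p i))"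
  using assms(2-)
proof (induction "n - j" arbitrary: R j rule: less_induct)
  case less
  show ?case
  proof (cases "j = n")
    case True
    have "wp match_code B 4 (0, R, M) (\<lambda>(i', R', M'). i' = 1000 \<and> M' = M \<and> R' 0 = 1)"
      using less.prems True by (simp add: match_code_def eval_nat_numeral)
    from wp_reaches[OF code this] obtain R' where
      R': "reaches P B 4 (l, R, M) (l + 1000, R', M)" "R' 0 = 1" by auto
    then show ?thesis using True reaches_mono[OF R'(1)] by (intro exI[of _ R']) auto
  next
    case F: False
    then have j: "j < n" using less.prems by simp
    show ?thesis
    proof (cases "M (R 4) = M (R 8)")
      case False
      then have "M (R 4) - M (R 8) + (M (R 8) - M (R 4)) \<noteq> 0" by linarith
      then have "wp match_code B 10 (0, R, M) (\<lambda>(i', R', M'). i' = 1000 \<and> M' = M \<and> R' 0 = 0)"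
        using less.prems j by (auto simp: match_code_def eval_nat_numeral abs_diff_le)
      from wp_reaches[OF code this] obtain R' where
        R': "reaches P B 10 (l, R, M) (l + 1000, R', M)" "R' 0 = 0" by auto
      moreover have "\<not> (\<forall>i. j \<le> i \<and> i < n \<longrightarrow> M (c + i) = M (rotated_address a n p i))"
        using False j less.prems by auto
      ultimately show ?thesis using reaches_mono[OF R'(1)] by (intro exI[of _ R']) auto
    next
      case True
      have "\<exists>R1 k. reaches P B k (l, R, M) (l, R1, M) \<and> k \<le> 16 \<and> R1 4 = c + Suc j \<and> R1 8 = rotated_address a n p (Suc j) \<and>
          (\<forall>i. i \<notin> {4, 5, 6, 7, 8} \<longrightarrow> R1 i = R i)"
      proof (cases "j = p")
        case jp: True
        then have "R 8 = a" using less.prems by (simp add: rotated_address_def)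
        then have "wp match_code B 13 (0, R, M) (\<lambda>(i', R', M'). i' = 0 \<and> M' = M \<and> R' 4 = c + Suc j \<and> R' 8 = a + n - 1 \<and>
            (\<forall>i. i \<notin> {4, 5, 6, 7, 8} \<longrightarrow> R' i = R i))"
          using less.prems j True by (simp add: match_code_def eval_nat_numeral)
        from wp_reaches[OF code this] obtain R1 where
          R1: "reaches P B 13 (l, R, M) (l, R1, M)" "R1 4 = c + Suc j" "R1 8 = a + n - 1"
            "\<forall>i. i \<notin> {4, 5, 6, 7, 8} \<longrightarrow> R1 i = R i" by auto
        moreover have "a + n - 1 = rotated_address a n p (Suc j)" using jp by (simp add: rotated_address_def)
        ultimately show ?thesis by (intro exI[of _ R1] exI[of _ 13]) auto
      next
        case jp: False
        then have "a < R 8" using less.prems j by (auto simp: rotated_address_def)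
        then have "wp match_code B 13 (0, R, M) (\<lambda>(i', R', M'). i' = 0 \<and> M' = M \<and> R' 4 = c + Suc j \<and> R' 8 = R 8 - 1 \<and>
            (\<forall>i. i \<notin> {4, 5, 6, 7, 8} \<longrightarrow> R' i = R i))"
          using less.prems j True by (simp add: match_code_def eval_nat_numeral)
        from wp_reaches[OF code this] obtain R1 where
          R1: "reaches P B 13 (l, R, M) (l, R1, M)" "R1 4 = c + Suc j" "R1 8 = R 8 - 1"
            "\<forall>i. i \<notin> {4, 5, 6, 7, 8} \<longrightarrow> R1 i = R i" by auto
        moreover have "R 8 - 1 = rotated_address a n p (Suc j)" using jp j less.prems by (auto simp: rotated_address_def)
        ultimately show ?thesis by (intro exI[of _ R1] exI[of _ 13]) auto
      qed
      then obtain R1 k where R1: "reaches P B k (l, R, M) (l, R1, M)" "k \<le> 16" "R1 4 = c + Suc j"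
        "R1 8 = rotated_address a n p (Suc j)" "\<forall>i. i \<notin> {4, 5, 6, 7, 8} \<longrightarrow> R1 i = R i" by blast
      have "\<exists>R'. reaches P B (16 * (n - Suc j) + 10) (l, R1, M) (l + 1000, R', M) \<and>
        R' 0 = of_bool (\<forall>i. Suc j \<le> i \<and> i < n \<longrightarrow> M (c + i) = M (rotated_address a n p i))"
        by (rule less.hyps) (use R1 less.prems j in auto)
      then obtain R' where R': "reaches P B (16 * (n - Suc j) + 10) (l, R1, M) (l + 1000, R', M)"
        "R' 0 = of_bool (\<forall>i. Suc j \<le> i \<and> i < n \<longrightarrow> M (c + i) = M (rotated_address a n p i))" by blast
      have "reaches P B (16 * (n - j) + 10) (l, R, M) (l + 1000, R', M)"
        by (rule reaches_mono[OF reaches_trans[OF R1(1) R'(1)]]) (use R1(2) j in simp)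
      moreover have "(\<forall>i. j \<le> i \<and> i < n \<longrightarrow> M (c + i) = M (rotated_address a n p i)) \<longleftrightarrow>
          (\<forall>i. Suc j \<le> i \<and> i < n \<longrightarrow> M (c + i) = M (rotated_address a n p i))"
        using True less.prems by (metis Suc_leD le_antisym not_less_eq_eq)
      ultimately show ?thesis using R'(2) by (intro exI[of _ R']) simp
    qed
  qed
qed

lemma hd_seg: "a < b \<Longrightarrow> hd (seg M a b) = M a"
  by (simp add: seg_Cons)

lemma last_seg: "a < b \<Longrightarrow> last (seg M a b) = M (b - 1)"
  by (simp add: seg_def last_map)

lemma seg_cong: "(\<And>i. a \<le> i \<Longrightarrow> i < b \<Longrightarrow> M i = M' i) \<Longrightarrow> seg M a b = seg M' a b"
  by (simp add: seg_def)

abbreviation cancels :: "nat list \<Rightarrow> instr list \<Rightarrow> nat \<Rightarrow> nat \<Rightarrow> nat \<Rightarrow> (nat \<Rightarrow> nat) \<Rightarrow> (nat \<Rightarrow> nat) \<Rightarrow> (nat \<Rightarrow> nat) \<Rightarrow> (nat \<Rightarrow> nat) \<Rightarrow> bool" where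
  "cancels w P B N l R M R' M' \<equiv> reaches P B (15 * (N - R 8) + 2) (l, R, M) (l + 17, R', M') \<and>
    (\<forall>i. i \<notin> {3, 5, 6, 7, 8} \<longrightarrow> R' i = R i) \<and> R' 3 \<le> N \<and> (\<forall>i. M' i \<le> B) \<and>
    reduces w (seg M' 0 (R' 3)) \<and> successively (\<noteq>) (seg M' 0 (R' 3))"

text \<open>The memory below register 3 is a stack holding the entries read so far after
  cancellation. It never overwrites unread input, since register 3 is at most register 8. The
  invariant says that stack followed by unread input is a reduction of \<open>w\<close>.\<close>

lemma cancel_loop:
  assumes code: "code_at P l cancel_code"
    and "R 0 = N" "R 1 = 0" "R 2 = 1" "R 8 \<le> N" "R 3 \<le> R 8" "N \<le> B" "\<And>i. M i \<le> B"
    and "reduces w (seg M 0 (R 3) @ seg M (R 8) N)" "successively (\<noteq>) (seg M 0 (R 3))"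
  shows "\<exists>R' M'. cancels w P B N l R M R' M'"
  using assms(2-)
proof (induction "N - R 8" arbitrary: R M rule: less_induct)
  case less
  note p = less.prems
  show ?case
  proof (cases "R 8 = N")
    case True
    have "wp cancel_code B 2 (0, R, M) (\<lambda>(i', R', M'). i' = 17 \<and> M' = M \<and> (\<forall>i. i \<noteq> 5 \<longrightarrow> R' i = R i))"
      using p True by (simp add: cancel_code_def eval_nat_numeral)
    from wp_reaches[OF code this] obtain R' where
      R': "reaches P B 2 (l, R, M) (l + 17, R', M)" "\<forall>i. i \<noteq> 5 \<longrightarrow> R' i = R i" by auto
    show ?thesis
      by (rule exI[of _ R'], rule exI[of _ M]) (use R' p True reaches_mono[OF R'(1)] in auto)
  next
    case F: False
    then have iN: "R 8 < N" using p by simp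
    have next_iter: ?thesis
      if R1: "reaches P B 15 (l, R, M) (l, R1, M1)" "\<forall>i. i \<notin> {3, 5, 6, 7, 8} \<longrightarrow> R1 i = R i"
        "R1 8 = R 8 + 1" "R1 3 \<le> R 8 + 1" "\<And>i. M1 i \<le> B"
        "reduces w (seg M1 0 (R1 3) @ seg M1 (R 8 + 1) N)" "successively (\<noteq>) (seg M1 0 (R1 3))" for R1 M1
    proof -
      have "\<exists>R' M'. cancels w P B N l R1 M1 R' M'"
        by (rule less.hyps) (use R1 p iN in auto)
      then obtain R' M' where R': "reaches P B (15 * (N - R1 8) + 2) (l, R1, M1) (l + 17, R', M')"
        "\<forall>i. i \<notin> {3, 5, 6, 7, 8} \<longrightarrow> R' i = R1 i"
        "R' 3 \<le> N" "\<forall>i. M' i \<le> B" "reduces w (seg M' 0 (R' 3))" "successively (\<noteq>) (seg M' 0 (R' 3))" by blast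
      have "reaches P B (15 * (N - R 8) + 2) (l, R, M) (l + 17, R', M')"
        by (rule reaches_mono[OF reaches_trans[OF R1(1) R'(1)]]) (use R1(3) iN in simp)
      then show ?thesis using R' R1(2) by (intro exI[of _ R'] exI[of _ M']) auto
    qed
    have seg_i: "seg M (R 8) N = M (R 8) # seg M (R 8 + 1) N" using seg_Cons[OF iN] by simp
    define M1 where "M1 = M(R 3 := M (R 8))"
    have push: "seg M1 0 (R 3 + 1) = seg M 0 (R 3) @ [M (R 8)]" "seg M1 (R 8 + 1) N = seg M (R 8 + 1) N"
      using p by (auto simp: M1_def seg_snoc intro!: seg_cong)
    have push_red: "reduces w (seg M1 0 (R 3 + 1) @ seg M1 (R 8 + 1) N)"
      using p(8) unfolding push seg_i by simp
    have M1: "M1 i \<le> B" for i using p by (simp add: M1_def)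
    show ?thesis
    proof (cases "R 3 = 0")
      case True
      have "wp cancel_code B 8 (0, R, M) (\<lambda>(i', R', M'). i' = 0 \<and> M' = M1 \<and> R' 3 = R 3 + 1 \<and> R' 8 = R 8 + 1 \<and>
          (\<forall>i. i \<notin> {3, 5, 6, 7, 8} \<longrightarrow> R' i = R i))"
        using p True iN by (auto simp: cancel_code_def eval_nat_numeral M1_def)
      from wp_reaches[OF code this] obtain R1 where
        R1: "reaches P B 8 (l, R, M) (l, R1, M1)" "R1 3 = R 3 + 1" "R1 8 = R 8 + 1"
          "\<forall>i. i \<notin> {3, 5, 6, 7, 8} \<longrightarrow> R1 i = R i" by auto
      show ?thesis
      proof (rule next_iter[of R1 M1])
        show "reaches P B 15 (l, R, M) (l, R1, M1)" by (rule reaches_mono[OF R1(1)]) simp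
        show "reduces w (seg M1 0 (R1 3) @ seg M1 (R 8 + 1) N)" unfolding R1(2) by (rule push_red)
        show "successively (\<noteq>) (seg M1 0 (R1 3))" unfolding R1(2) push using True by simp
      qed (use R1 p M1 in auto)
    next
      case pos: False
      have top: "seg M 0 (R 3) = seg M 0 (R 3 - 1) @ [M (R 3 - 1)]"
        using pos seg_snoc[of 0 "R 3 - 1" M] by simp
      show ?thesis
      proof (cases "M (R 8) = M (R 3 - 1)")
        case True
        have "wp cancel_code B 13 (0, R, M) (\<lambda>(i', R', M'). i' = 0 \<and> M' = M \<and> R' 3 = R 3 - 1 \<and> R' 8 = R 8 + 1 \<and>
            (\<forall>i. i \<notin> {3, 5, 6, 7, 8} \<longrightarrow> R' i = R i))"
          using p True iN pos by (auto simp: cancel_code_def eval_nat_numeral)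
        from wp_reaches[OF code this] obtain R1 where
          R1: "reaches P B 13 (l, R, M) (l, R1, M)" "R1 3 = R 3 - 1" "R1 8 = R 8 + 1"
            "\<forall>i. i \<notin> {3, 5, 6, 7, 8} \<longrightarrow> R1 i = R i" by auto
        show ?thesis
        proof (rule next_iter[of R1 M])
          show "reaches P B 15 (l, R, M) (l, R1, M)" by (rule reaches_mono[OF R1(1)]) simp
          show "reduces w (seg M 0 (R1 3) @ seg M (R 8 + 1) N)"
            unfolding R1(2) by (rule reduces.cancel[of _ _ "M (R 8)"]) (use p(8) in \<open>simp add: top seg_i True\<close>)
          show "successively (\<noteq>) (seg M 0 (R1 3))"
            using p(9) unfolding R1(2) top by (simp add: successively_append_iff)
        qed (use R1 p in auto)
      next
        case False
        then have "M (R 8) - M (R 3 - 1) + (M (R 3 - 1) - M (R 8)) \<noteq> 0" by linarith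
        then have "wp cancel_code B 15 (0, R, M) (\<lambda>(i', R', M'). i' = 0 \<and> M' = M1 \<and> R' 3 = R 3 + 1 \<and> R' 8 = R 8 + 1 \<and>
            (\<forall>i. i \<notin> {3, 5, 6, 7, 8} \<longrightarrow> R' i = R i))"
          using p iN pos by (auto simp: cancel_code_def eval_nat_numeral M1_def abs_diff_le)
        from wp_reaches[OF code this] obtain R1 where
          R1: "reaches P B 15 (l, R, M) (l, R1, M1)" "R1 3 = R 3 + 1" "R1 8 = R 8 + 1"
            "\<forall>i. i \<notin> {3, 5, 6, 7, 8} \<longrightarrow> R1 i = R i" by auto
        show ?thesis
        proof (rule next_iter[of R1 M1])
          show "reaches P B 15 (l, R, M) (l, R1, M1)" by (rule R1(1))
          show "reduces w (seg M1 0 (R1 3) @ seg M1 (R 8 + 1) N)" unfolding R1(2) by (rule push_red)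
          show "successively (\<noteq>) (seg M1 0 (R1 3))"
            unfolding R1(2) push using p(9) False pos last_seg[of 0 "R 3" M]
            by (auto simp: successively_append_iff)
        qed (use R1 p M1 in auto)
      qed
    qed
  qed
qed

section \<open>The program\<close>

definition start_code :: "instr list" where
  "start_code = [Sub 5 3 4, Jump_If_Zero 5 3, Jump_If_Zero 1 5, Const 0 1, Jump_If_Zero 1 1000,
     Load 6 4, Add 4 4 2, Add 8 4 1]"

text \<open>Cores of different lengths are rejected and two empty ones accepted; register 5 keeps a
  length for the second test. Otherwise the first letter of \<rho> is loaded, to be searched for in
  \<sigma>.\<close>

definition check_code :: "instr list" where
  "check_code = [Sub 5 11 10, Sub 6 3 4, Sub 7 5 6, Sub 6 6 5, Add 7 7 6, Jump_If_Zero 7 8,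
     Const 0 0, Jump_If_Zero 1 1000, Jump_If_Zero 5 10, Jump_If_Zero 1 12, Const 0 1, Jump_If_Zero 1 1000,
     Load 6 4, Add 8 10 1, Add 9 3 1, Add 3 11 1]"

fun link :: "nat \<Rightarrow> instr list list \<Rightarrow> instr list" where
  "link l [] = []"
| "link l (c # cs) = map (relocate l) c @ link (l + length c) cs"

lemma length_link: "length (link l cs) = sum_list (map length cs)"
  by (induction cs arbitrary: l) auto

lemma link_append: "link l (cs @ ds) = link l cs @ link (l + sum_list (map length cs)) ds"
  by (induction cs arbitrary: l) (auto simp: add.assoc)

lemma code_at_link:
  assumes "P = link 0 (cs @ c # ds)" "l = sum_list (map length cs)" "length P \<le> 1000"
  shows "code_at P l c"
proof -
  have "P = link 0 cs @ map (relocate l) c @ link (l + length c) ds"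
    using assms by (simp add: link_append)
  moreover have "length (link 0 cs) = l" by (simp add: length_link assms(2))
  ultimately show ?thesis using assms(3) by (auto simp: code_at_def nth_append)
qed

definition fragments :: "instr list list" where
  "fragments = [[Const 2 1], cancel_code, trim_code, start_code, find_code, [Add 9 3 1, Add 3 8 1], trim_code,
     [Add 10 4 1, Add 11 3 1, Add 4 8 2, Add 3 9 1], trim_code, check_code, find_code, match_code]"

definition torus_program :: "instr list" where
  "torus_program = link 0 fragments"

lemma fragment_at:
  assumes "k < 12"
  shows "code_at torus_program ([0, 1, 18, 32, 40, 51, 53, 67, 71, 85, 101, 112] ! k) (fragments ! k)"
proof -
  have "\<forall>k<12. [0, 1, 18, 32, 40, 51, 53, 67, 71, 85, 101, 112] ! k = sum_list (map length (take k fragments))"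
    by (simp add: All_less_Suc eval_nat_numeral fragments_def cancel_code_def trim_code_def start_code_def find_code_def check_code_def match_code_def)
  moreover have "fragments = take k fragments @ fragments ! k # drop (Suc k) fragments"
    using assms by (intro id_take_nth_drop) (simp add: fragments_def)
  moreover have "length torus_program \<le> 1000"
    unfolding torus_program_def length_link fragments_def
    by (simp add: cancel_code_def trim_code_def start_code_def find_code_def check_code_def match_code_def)
  ultimately show ?thesis using assms by (intro code_at_link[of _ "take k fragments" _ "drop (Suc k) fragments"]) (auto simp: torus_program_def)
qed

section \<open>Correctness and running time of the program\<close>

lemma reduces_trim: "reduces w (Y @ u @ rev Y) \<Longrightarrow> reduces w u"
proof (induction Y)
  case (Cons y Y)
  then have "reduces w (y # (Y @ u @ rev Y) @ [y])" by simp
  then show ?case by (rule Cons.IH[OF reduces.trim])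
qed simp

lemma band_pair_iff_rotated:
  assumes "\<sigma> = B @ g # C" "g \<notin> set B" "\<rho> \<noteq> []" "hd \<rho> = g"
  shows "band_pair \<sigma> \<rho> \<longleftrightarrow> \<rho> = rev (B @ [g]) @ rev C"
proof
  have first: "takeWhile (\<lambda>y. y \<noteq> x) (D @ x # E) = D" if "x \<notin> set D" for x D and E :: "'a list"
    using that by (induction D) auto
  assume "band_pair \<sigma> \<rho>"
  then obtain B' g' C' where *: "\<sigma> = B' @ g' # C'" "g' \<notin> set B'" "\<rho> = g' # rev B' @ rev C'"
    using assms(3) unfolding band_pair_def by blast
  then have "g' = g" using assms(4) by simp
  then have "B' = B" using first[OF *(2), of C'] first[OF assms(2), of C] * assms(1) by simp
  then show "\<rho> = rev (B @ [g]) @ rev C" using * assms(1) \<open>g' = g\<close> by simp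
qed (use assms in \<open>auto simp: band_pair_def\<close>)

lemma nth_rotated:
  assumes "p < n" "i < n" "\<sigma> = seg M a (a + n)"
  shows "(rev (take (Suc p) \<sigma>) @ rev (drop (Suc p) \<sigma>)) ! i = M (rotated_address a n p i)"
proof (cases "i \<le> p")
  case True
  then show ?thesis
    using assms Suc_leI[OF assms(1)] by (simp add: nth_append rev_nth seg_nth rotated_address_def min_absorb2)
next
  case False
  then have "n - Suc p - Suc (i - Suc p) = n - Suc i" using assms by simp
  moreover have "Suc p + (n - Suc i) = n + p - i" using assms False by simp
  ultimately show ?thesis using assms False
    using Suc_leI[OF assms(1)] by (simp add: nth_append rev_nth seg_nth rotated_address_def min_absorb2 add.assoc)
qed

lemma length_eq_num_loops:
  assumes "hieroglyph w"
  shows "length w = 2 * num_loops w"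
proof -
  have "length w = (\<Sum>x\<in>set w. count_list w x)" by (simp add: sum_count_set)
  also have "\<dots> = (\<Sum>x\<in>set w. 2)" using assms by (intro sum.cong) (auto simp: hieroglyph_def)
  finally show ?thesis by (simp add: num_loops_def)
qed

lemma torus_program_correct:
  assumes w: "hieroglyph w" and N: "N = length w" "N \<le> B" and "1 \<le> B" and wB: "\<And>x. x \<in> set w \<Longrightarrow> x \<le> B"
  shows "\<exists>pc R M. reaches torus_program B (90 * N + 100) (initial w) (pc, R, M) \<and> 1000 \<le> pc \<and>
    R 0 = of_bool (realizable_on_torus w)"
proof -
  note code = fragment_at[simplified fragments_def]
  have codes: "code_at torus_program 0 [Const 2 1]" "code_at torus_program 1 cancel_code" "code_at torus_program 18 trim_code"
    "code_at torus_program 32 start_code" "code_at torus_program 40 find_code"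
    "code_at torus_program 51 [Add 9 3 1, Add 3 8 1]" "code_at torus_program 53 trim_code"
    "code_at torus_program 67 [Add 10 4 1, Add 11 3 1, Add 4 8 2, Add 3 9 1]"
    "code_at torus_program 71 trim_code" "code_at torus_program 85 check_code"
    "code_at torus_program 101 find_code" "code_at torus_program 112 match_code"
    using code[of 0] code[of 1] code[of 2] code[of 3] code[of 4] code[of 5] code[of 6] code[of 7] code[of 8]
      code[of 9] code[of 10] code[of 11] by (simp_all del: One_nat_def)
  define M0 where "M0 = (\<lambda>i. if i < N then w ! i else 0)"
  define R0 where "R0 = (\<lambda>_ :: nat. 0 :: nat)(0 := N)"
  have init: "initial w = (0, R0, M0)" by (simp add: initial_def R0_def M0_def N)
  have M0: "M0 i \<le> B" for i using wB by (simp add: M0_def N)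
  have segM0: "seg M0 0 N = w" by (intro nth_equalityI) (simp_all add: seg_nth M0_def N)
  have s1: "reaches torus_program B 1 (0, R0, M0) (1, R0(2 := 1), M0)"
  proof -
    have "wp [Const 2 1] B 1 (0, R0, M0) (\<lambda>s'. s' = (1, R0(2 := 1), M0))" using assms(4) by simp
    from wp_reaches[OF codes(1) this] show ?thesis by auto
  qed
  let ?R1 = "R0(2 := 1)"
  have "\<exists>R' M'. cancels w torus_program B N 1 ?R1 M0 R' M'"
    by (rule cancel_loop[OF codes(2)]) (use N M0 segM0 in \<open>auto simp: R0_def intro: reduces.start\<close>)
  then obtain R2 M where s2: "reaches torus_program B (15 * N + 2) (1, ?R1, M0) (18, R2, M)"
    and R2: "\<forall>i. i \<notin> {3, 5, 6, 7, 8} \<longrightarrow> R2 i = ?R1 i" "R2 3 \<le> N"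
    and M: "\<And>i. M i \<le> B" and red2: "reduces w (seg M 0 (R2 3))" "successively (\<noteq>) (seg M 0 (R2 3))"
    by (auto simp: R0_def)
  have "\<exists>R' Y. trims torus_program B M 18 R2 R' Y"
    by (rule trim_loop[OF codes(3)]) (use R2 M N in \<open>auto simp: R0_def\<close>)
  then obtain R3 Y0 where s3: "reaches torus_program B (13 * (R2 3 - R2 4) + 11) (18, R2, M) (32, R3, M)"
    and R3: "\<forall>i. i \<notin> {3, 4, 5, 6, 7} \<longrightarrow> R3 i = R2 i" "R3 3 + length Y0 = R2 3" "R3 4 \<le> R3 3"
    and Y0: "seg M (R2 4) (R2 3) = Y0 @ seg M (R3 4) (R3 3) @ rev Y0"
    and core: "R3 3 - R3 4 \<le> 1 \<or> M (R3 4) \<noteq> M (R3 3 - 1)"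
    by (auto simp: add.commute)
  define lo hi where "lo = R3 4" and "hi = R3 3"
  have hi: "lo \<le> hi" "hi \<le> N" using R3 R2 by (auto simp: lo_def hi_def)
  define u where "u = seg M lo hi"
  have R2_4: "R2 4 = 0" using R2 by (auto simp: R0_def)
  have u_red: "reduces w u" using red2(1) Y0 reduces_trim unfolding R2_4 u_def lo_def hi_def by metis
  have u_hier: "hieroglyph u" using reduces_invariants[OF u_red w] by blast
  have u_cyc: "cyc_reduced u"
  proof -
    have "successively (\<noteq>) u" using red2(2) Y0 unfolding R2_4 u_def lo_def hi_def by (simp add: successively_append_iff)
    moreover have "last u \<noteq> hd u" if "u \<noteq> []"
    proof -
      \<comment> \<open>The trimming loop may also stop at a single entry; hieroglyphs have even
        length.\<close>
      have "length u \<noteq> 1" using length_eq_num_loops[OF u_hier] by presburger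
      moreover have "lo < hi" using that hi by (cases "lo = hi") (auto simp: u_def)
      ultimately show ?thesis using core that by (auto simp: u_def lo_def hi_def hd_seg last_seg)
    qed
    ultimately show ?thesis by (simp add: cyc_reduced_def)
  qed
  have regs3: "R3 1 = 0" "R3 2 = 1" using R3(1) R2(1) by (auto simp: R0_def)
  have t3: "reaches torus_program B (28 * N + 14) (initial w) (32, R3, M)"
    unfolding init by (rule reaches_mono[OF reaches_trans[OF reaches_trans[OF s1 s2] s3]]) (use R2 R2_4 in auto)
  show ?thesis
  proof (cases "lo = hi")
    case True
    have "wp start_code B 4 (0, R3, M) (\<lambda>(i', R', M'). i' = 1000 \<and> R' 0 = 1)"
      using True regs3 assms(4) by (simp add: start_code_def eval_nat_numeral lo_def hi_def)
    from wp_reaches[OF codes(4) this] obtain R' M' where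
      R': "reaches torus_program B 4 (32, R3, M) (1032, R', M')" "R' 0 = 1" by auto
    have "realizable_on_torus w" using True u_red reduces_Nil_imp_realizable[OF w] by (simp add: u_def)
    then show ?thesis
      using R' reaches_mono[OF reaches_trans[OF t3 R'(1)], of "90 * N + 100"]
      by (intro exI[of _ 1032] exI[of _ R'] exI[of _ M']) auto
  next
    case F: False
    then have lohi: "lo < hi" using hi by simp
    define x where "x = M lo"
    have "wp start_code B 6 (0, R3, M) (\<lambda>(i', R', M'). i' = 8 \<and> M' = M \<and> R' 6 = x \<and> R' 4 = lo + 1 \<and> R' 8 = lo + 1 \<and>
        (\<forall>i. i \<notin> {4, 5, 6, 8} \<longrightarrow> R' i = R3 i))"
      using lohi hi regs3 N by (auto simp: start_code_def eval_nat_numeral lo_def hi_def x_def)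
    from wp_reaches[OF codes(4) this] obtain R4 where
      s4: "reaches torus_program B 6 (32, R3, M) (40, R4, M)" and R4: "R4 6 = x" "R4 4 = lo + 1" "R4 8 = lo + 1"
        "\<forall>i. i \<notin> {4, 5, 6, 8} \<longrightarrow> R4 i = R3 i" by auto
    have u_Cons: "u = x # seg M (Suc lo) hi" using lohi by (simp add: u_def x_def seg_Cons)
    then have "x \<in> set (seg M (Suc lo) hi)"
      using hieroglyph_count[OF u_hier, of x] count_list_pos_iff[of "seg M (Suc lo) hi" x] by simp
    then have x_in: "x \<in> M ` {lo + 1..<hi}" by (simp add: set_seg)
    have R4_3: "R4 3 = hi" using R4(4) by (simp add: hi_def)
    have "\<exists>R'. finds torus_program B M 40 R4 R'"
      by (rule find_loop[OF codes(5)]) (use R4 R4_3 regs3 M N hi x_def in auto)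
    then obtain R5 where s5: "reaches torus_program B (9 * (R4 3 - R4 8)) (40, R4, M) (51, R5, M)"
      and R5: "\<forall>i. i \<notin> {5, 7, 8} \<longrightarrow> R5 i = R4 i" "lo + 1 \<le> R5 8" "R5 8 < hi" "M (R5 8) = x"
      using x_in R4 R4_3 by auto
    define t where "t = R5 8"
    have regs5: "R5 1 = 0" "R5 2 = 1" "R5 3 = hi" "R5 4 = lo + 1" using R5(1) R4 R4_3 regs3 by auto
    have "wp [Add 9 3 1, Add 3 8 1] B 2 (0, R5, M) (\<lambda>(i', R', M'). i' = 2 \<and> M' = M \<and> R' 9 = hi \<and> R' 3 = t \<and>
        (\<forall>i. i \<notin> {3, 9} \<longrightarrow> R' i = R5 i))"
      using regs5 R5 hi N by (auto simp: eval_nat_numeral t_def)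
    from wp_reaches[OF codes(6) this] obtain R6 where
      s6: "reaches torus_program B 2 (51, R5, M) (53, R6, M)" and R6: "R6 9 = hi" "R6 3 = t"
        "\<forall>i. i \<notin> {3, 9} \<longrightarrow> R6 i = R5 i" by auto
    have regs6: "R6 1 = 0" "R6 2 = 1" "R6 4 = lo + 1" "R6 8 = t" using R6 regs5 by (auto simp: t_def)
    have "\<exists>R' Y. trims torus_program B M 53 R6 R' Y"
      by (rule trim_loop[OF codes(7)]) (use regs6 R6 R5 M N hi t_def in auto)
    then obtain R7 Y where s7: "reaches torus_program B (13 * (R6 3 - R6 4) + 11) (53, R6, M) (67, R7, M)"
      and R7: "\<forall>i. i \<notin> {3, 4, 5, 6, 7} \<longrightarrow> R7 i = R6 i" "R7 3 + length Y = t" "R7 4 \<le> R7 3"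
      and Y: "seg M (lo + 1) t = Y @ seg M (R7 4) (R7 3) @ rev Y"
      and coreY: "R7 3 - R7 4 \<le> 1 \<or> M (R7 4) \<noteq> M (R7 3 - 1)"
      using R6 regs6 by auto
    define a b where "a = R7 4" and "b = R7 3"
    have ab: "a \<le> b" "b \<le> t" "t < hi" using R7 R5 by (auto simp: a_def b_def t_def)
    have regs7: "R7 1 = 0" "R7 2 = 1" "R7 8 = t" "R7 9 = hi" using R7(1) regs6 R6 by auto
    have "wp [Add 10 4 1, Add 11 3 1, Add 4 8 2, Add 3 9 1] B 4 (0, R7, M)
        (\<lambda>(i', R', M'). i' = 4 \<and> M' = M \<and> R' 10 = a \<and> R' 11 = b \<and> R' 4 = t + 1 \<and> R' 3 = hi \<and>
          (\<forall>i. i \<notin> {3, 4, 10, 11} \<longrightarrow> R' i = R7 i))"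
      using regs7 ab hi N by (auto simp: eval_nat_numeral a_def b_def)
    from wp_reaches[OF codes(8) this] obtain R8 where
      s8: "reaches torus_program B 4 (67, R7, M) (71, R8, M)" and R8: "R8 10 = a" "R8 11 = b" "R8 4 = t + 1" "R8 3 = hi"
        "\<forall>i. i \<notin> {3, 4, 10, 11} \<longrightarrow> R8 i = R7 i" by auto
    have regs8: "R8 1 = 0" "R8 2 = 1" using R8 regs7 by auto
    have "\<exists>R' Y. trims torus_program B M 71 R8 R' Y"
      by (rule trim_loop[OF codes(9)]) (use regs8 R8 ab M N hi in auto)
    then obtain R9 Z where s9: "reaches torus_program B (13 * (R8 3 - R8 4) + 11) (71, R8, M) (85, R9, M)"
      and R9: "\<forall>i. i \<notin> {3, 4, 5, 6, 7} \<longrightarrow> R9 i = R8 i" "R9 3 + length Z = hi" "R9 4 \<le> R9 3"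
      and Z: "seg M (t + 1) hi = Z @ seg M (R9 4) (R9 3) @ rev Z"
      and coreZ: "R9 3 - R9 4 \<le> 1 \<or> M (R9 4) \<noteq> M (R9 3 - 1)"
      using R8 by auto
    define c d where "c = R9 4" and "d = R9 3"
    have cd: "c \<le> d" "d \<le> hi" using R9 by (auto simp: c_def d_def)
    have regs9: "R9 1 = 0" "R9 2 = 1" "R9 10 = a" "R9 11 = b" using R9(1) regs8 R8 by auto
    define \<sigma> \<rho> where "\<sigma> = seg M a b" and "\<rho> = seg M c d"
    have iff: "realizable_on_torus w \<longleftrightarrow> band_pair \<sigma> \<rho>"
    proof (rule realizable_on_torus_iff[OF w u_red u_cyc])
      have "seg M (Suc lo) hi = seg M (lo + 1) t @ seg M t hi"
        using R5 ab by (simp add: seg_append[of "Suc lo" t hi] t_def)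
      also have "seg M t hi = x # seg M (t + 1) hi" using ab R5(4) by (simp add: seg_Cons t_def)
      finally show "u = x # seg M (lo + 1) t @ x # seg M (t + 1) hi" by (simp add: u_Cons)
      show "seg M (lo + 1) t = Y @ \<sigma> @ rev Y" "seg M (t + 1) hi = Z @ \<rho> @ rev Z"
        using Y Z by (simp_all add: \<sigma>_def \<rho>_def a_def b_def c_def d_def)
      have ends: "length (seg M k j) \<le> 1 \<or> hd (seg M k j) \<noteq> last (seg M k j)" if "j - k \<le> 1 \<or> M k \<noteq> M (j - 1)" for k j
        using that hd_seg[of k j M] last_seg[of k j M] by (cases "k < j") auto
      show "length \<sigma> \<le> 1 \<or> hd \<sigma> \<noteq> last \<sigma>" unfolding \<sigma>_def a_def b_def by (rule ends[OF coreY])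
      show "length \<rho> \<le> 1 \<or> hd \<rho> \<noteq> last \<rho>" unfolding \<rho>_def c_def d_def by (rule ends[OF coreZ])
    qed
    have t9: "reaches torus_program B (63 * N + 59) (initial w) (85, R9, M)"
    proof -
      note reaches_trans[OF reaches_trans[OF reaches_trans[OF reaches_trans[OF reaches_trans[OF reaches_trans[OF t3 s4] s5] s6] s7] s8] s9]
      then show ?thesis
        by (rule reaches_mono) (use R4 R4_3 R6 regs6 R8 hi ab in simp)
    qed
    have lens: "length \<sigma> = b - a" "length \<rho> = d - c" by (simp_all add: \<sigma>_def \<rho>_def)
    \<comment> \<open>The two linear bounds add up to \<open>90 * N + 100\<close>; the second one
      covers the length test, the search for \<open>g\<close> and the comparison.\<close>
    have finish: ?thesis if "reaches torus_program B n (85, R9, M) (l + 1000, R', M)" "n \<le> 27 * N + 41"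
        "R' 0 = of_bool (band_pair \<sigma> \<rho>)" for n l R'
      using that iff reaches_mono[OF reaches_trans[OF t9 that(1)], of "90 * N + 100"]
      by (intro exI[of _ "l + 1000"] exI[of _ R'] exI[of _ M]) auto
    show ?thesis
    proof (cases "b - a = d - c")
      case False
      then have "d - c - (b - a) + (b - a - (d - c)) \<noteq> 0" by linarith
      then have "wp check_code B 8 (0, R9, M) (\<lambda>(i', R', M'). i' = 1000 \<and> M' = M \<and> R' 0 = 0)"
        using regs9 ab cd hi N False by (auto simp: check_code_def eval_nat_numeral a_def b_def c_def d_def)
      from wp_reaches[OF codes(10) this] obtain R' where
        R': "reaches torus_program B 8 (85, R9, M) (85 + 1000, R', M)" "R' 0 = 0" by auto
      have "\<not> band_pair \<sigma> \<rho>" using False lens by (auto simp: band_pair_def)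
      then show ?thesis using finish[OF R'(1)] R'(2) by simp
    next
      case len: True
      show ?thesis
      proof (cases "b - a = 0")
        case True
        then have "wp check_code B 9 (0, R9, M) (\<lambda>(i', R', M'). i' = 1000 \<and> M' = M \<and> R' 0 = 1)"
          using regs9 len assms(4) by (simp add: check_code_def eval_nat_numeral a_def b_def c_def d_def)
        from wp_reaches[OF codes(10) this] obtain R' where
          R': "reaches torus_program B 9 (85, R9, M) (85 + 1000, R', M)" "R' 0 = 1" by auto
        have "band_pair \<sigma> \<rho>" using True len lens by (simp add: band_pair_def)
        then show ?thesis using finish[OF R'(1)] R'(2) by simp
      next
        case pos: False
        define n where "n = b - a"
        have n: "b = a + n" "d = c + n" "0 < n" using pos len ab cd by (auto simp: n_def)
        define g where "g = M c"
        have "wp check_code B 12 (0, R9, M) (\<lambda>(i', R', M'). i' = 16 \<and> M' = M \<and> R' 6 = g \<and> R' 8 = a \<and> R' 9 = d \<and> R' 3 = b \<and>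
            (\<forall>i. i \<notin> {3, 5, 6, 7, 8, 9} \<longrightarrow> R' i = R9 i))"
          using regs9 len pos n ab cd hi N by (auto simp: check_code_def eval_nat_numeral a_def b_def c_def d_def g_def)
        from wp_reaches[OF codes(10) this] obtain R10 where
          s10: "reaches torus_program B 12 (85, R9, M) (101, R10, M)" and R10: "R10 6 = g" "R10 8 = a" "R10 9 = d" "R10 3 = b"
            "\<forall>i. i \<notin> {3, 5, 6, 7, 8, 9} \<longrightarrow> R10 i = R9 i" by auto
        have regs10: "R10 1 = 0" "R10 2 = 1" "R10 10 = a" "R10 11 = b" "R10 4 = c" using R10 regs9 by (auto simp: c_def)
        have "\<exists>R'. finds torus_program B M 101 R10 R'"
          by (rule find_loop[OF codes(11)]) (use R10 regs10 M N hi ab g_def in auto)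
        note found = this[unfolded R10]
        have \<rho>: "\<rho> \<noteq> []" "hd \<rho> = g" using n by (auto simp: \<rho>_def g_def hd_seg seg_Cons)
        have nN: "n \<le> N" using n ab hi by linarith
        show ?thesis
        proof (cases "g \<in> M ` {a..<b}")
          case False
          then obtain R' where R': "reaches torus_program B (9 * (b - a) + 4) (101, R10, M) (101 + 1000, R', M)" "R' 0 = 0"
            using found by auto
          have "g \<notin> set \<sigma>" using False by (simp add: \<sigma>_def set_seg)
          then have "\<not> band_pair \<sigma> \<rho>" using \<rho> by (auto simp: band_pair_def)
          then show ?thesis using finish[OF reaches_trans[OF s10 R'(1)]] R'(2) nN n by simp
        next
          case True
          then obtain R11 where s11: "reaches torus_program B (9 * (b - a)) (101, R10, M) (112, R11, M)"
            and R11: "\<forall>i. i \<notin> {5, 7, 8} \<longrightarrow> R11 i = R10 i" "a \<le> R11 8" "R11 8 < b" "M (R11 8) = g" "g \<notin> M ` {a..<R11 8}"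
            using found by auto
          define p where "p = R11 8 - a"
          have p: "p < n" "R11 8 = a + p" using R11 n by (auto simp: p_def)
          have "\<exists>R'. reaches torus_program B (16 * (n - 0) + 10) (112, R11, M) (112 + 1000, R', M) \<and>
            R' 0 = of_bool (\<forall>i. 0 \<le> i \<and> i < n \<longrightarrow> M (c + i) = M (rotated_address a n p i))"
            by (rule compare_loop[OF codes(12)]) (use R11 R10 regs10 n p M N hi ab cd assms(4) in \<open>auto simp: rotated_address_def\<close>)
          then obtain R' where R': "reaches torus_program B (16 * n + 10) (112, R11, M) (112 + 1000, R', M)"
            "R' 0 = of_bool (\<forall>i<n. M (c + i) = M (rotated_address a n p i))" by auto
          have \<sigma>: "\<sigma> = take p \<sigma> @ g # drop (Suc p) \<sigma>"
          proof -
            have "\<sigma> ! p = g" using R11(4) p n by (simp add: \<sigma>_def seg_nth)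
            then show ?thesis using id_take_nth_drop[of p \<sigma>] p n lens by simp
          qed
          have "g \<notin> set (take p \<sigma>)"
          proof -
            have "\<sigma> = seg M a (R11 8) @ seg M (R11 8) b"
              unfolding \<sigma>_def using R11(2,3) by (intro seg_append) auto
            then have "take p \<sigma> = seg M a (R11 8)" by (simp add: p_def)
            then show ?thesis using R11(5) by (simp add: set_seg)
          qed
          from band_pair_iff_rotated[OF \<sigma> this \<rho>]
          have "band_pair \<sigma> \<rho> \<longleftrightarrow> \<rho> = rev (take p \<sigma> @ [g]) @ rev (drop (Suc p) \<sigma>)" .
          also have "take p \<sigma> @ [g] = take (Suc p) \<sigma>"
          proof -
            have "\<sigma> ! p = g" using R11(4) p n by (simp add: \<sigma>_def seg_nth)
            then show ?thesis using p n lens by (simp add: take_Suc_conv_app_nth)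
          qed
          also have "\<rho> = rev (take (Suc p) \<sigma>) @ rev (drop (Suc p) \<sigma>) \<longleftrightarrow>
              (\<forall>i<n. M (c + i) = M (rotated_address a n p i))"
          proof -
            have "length \<rho> = n" "length (rev (take (Suc p) \<sigma>) @ rev (drop (Suc p) \<sigma>)) = n"
              using lens n p by auto
            moreover have "\<rho> ! i = M (c + i)" if "i < n" for i using that n by (simp add: \<rho>_def seg_nth)
            moreover have "(rev (take (Suc p) \<sigma>) @ rev (drop (Suc p) \<sigma>)) ! i = M (rotated_address a n p i)" if "i < n" for i
              using nth_rotated[OF p(1) that, of \<sigma> M a] n by (simp add: \<sigma>_def)
            ultimately show ?thesis by (simp add: list_eq_iff_nth_eq)
          qed
          finally have "R' 0 = of_bool (band_pair \<sigma> \<rho>)" using R'(2) by simp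
          then show ?thesis using finish[OF reaches_trans[OF reaches_trans[OF s10 s11] R'(1)]] nN n by simp
        qed
      qed
    qed
  qed
qed

theorem theorem2:
  "\<exists>(P :: instr list) (T :: nat \<Rightarrow> nat).
     decides_in_time P hieroglyph realizable_on_torus num_loops T \<and>
     (\<lambda>n. real (T n)) \<in> O(\<lambda>n. real n)"
proof (intro exI conjI)
  \<comment> \<open>A word has two entries per loop, which doubles the factor 90.\<close>
  let ?T = "\<lambda>n. 180 * n + 100 :: nat"
  show "decides_in_time torus_program hieroglyph realizable_on_torus num_loops ?T"
    unfolding decides_in_time_def
  proof (rule exI[of _ 1], intro allI impI)
    fix w :: "nat list" assume w: "hieroglyph w"
    define B where "B = 1 * (1 + Max (insert (length w) (set w)))"
    have le: "x \<le> B" if "x \<in> insert (length w) (set w)" for x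
      unfolding B_def using Max_ge[OF _ that] by simp
    obtain pc R M where run: "reaches torus_program B (90 * length w + 100) (initial w) (pc, R, M)" "1000 \<le> pc"
      "R 0 = of_bool (realizable_on_torus w)"
      using torus_program_correct[OF w refl, of B] le by (auto simp: B_def)
    have "fits B (initial w)" using le by (auto simp: fits_def initial_def)
    then obtain t where t: "t \<le> 90 * length w + 100" "(step torus_program ^^ t) (initial w) = (pc, R, M)"
      "\<forall>v\<le>t. fits B ((step torus_program ^^ v) (initial w))"
      using run(1) unfolding reaches_def by blast
    have "length torus_program \<le> 1000" using fragment_at[of 0] by (simp add: code_at_def)
    then have "halted torus_program (run torus_program w t)"
      using run(2) t(2) by (simp add: halted_def run_def)
    moreover have "answer (run torus_program w t) = (if realizable_on_torus w then 1 else 0)"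
      using run(3) t(2) by (simp add: answer_def run_def)
    moreover have "t \<le> ?T (num_loops w)" using t(1) length_eq_num_loops[OF w] by simp
    ultimately show "\<exists>t\<le>?T (num_loops w). halted torus_program (Defs.run torus_program w t) \<and>
        answer (Defs.run torus_program w t) = (if realizable_on_torus w then 1 else 0) \<and>
        (\<forall>u\<le>t. fits (1 * (1 + Max (insert (length w) (set w)))) (Defs.run torus_program w u))"
      using t(3) unfolding run_def B_def by (intro exI[of _ t]) auto
  qed
  show "(\<lambda>n. real (?T n)) \<in> O(\<lambda>n. real n)"
  proof (rule bigoI[of _ 280])
    show "\<forall>\<^sub>F n in at_top. norm (real (?T n)) \<le> 280 * norm (real n)"
      using eventually_ge_at_top[of 1] by eventually_elim simp
  qed
qed

end
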